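(* Let $C=\mathbb{R}^2/\langle \tau\rangle$ be the flat cylinder, where $\tau$ is a translation of the plane, and let $S$ be a finite point set on $C$. If two triangulations of $S$ have the same boundaries (i.e. the regions they triangulate are bounded by the same boundary segments), then one can be transformed into the other by a sequence of flips.
   Context: The flat cylinder carries the quotient metric (distance between orbits is the minimum Euclidean distance between representatives). The segment joining two points is the unique shortest geodesic joining them. A triangulation of a finite point set $S$ is a maximal set of pairwise non-crossing segments with endpoints in $S$ such that each bounded region is triangular; the union of its triangles is the triangulated region, whose boundary consists of segments of the triangulation (when $S$ wraps around the cylinder, this region is bounded by two closed polygonal lines each going around the cylinder, and different triangulations of the same $S$ may have different such boundaries). A flip replaces the common segment $\overline{v_iv_j}$ of two triangles $\{v_i,v_j,v_k\},\{v_i,v_j,v_l\}$ by the segment $\overline{v_kv_l}$, provided the latter is contained in the quadrilateral $\{v_i,v_k,v_j,v_l\}$. *)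

theory Defs
  imports "HOL-Analysis.Analysis"
begin

text \<open>The plane is modelled by the complex numbers. The flat cylinder C is the quotient of
  the plane by the group generated by the translation by tau (tau nonzero). A point of C is an
  orbit; a subset of C is represented by its preimage (lift) in the plane.\<close>

definition orb :: "complex \<Rightarrow> complex \<Rightarrow> complex set" where
  "orb \<tau> p = {p + of_int k * \<tau> | k. True}"

definition lift :: "complex \<Rightarrow> complex set \<Rightarrow> complex set" where
  "lift \<tau> A = {z + of_int k * \<tau> | z k. z \<in> A}"

definition cyl_points :: "complex \<Rightarrow> complex set set" where
  "cyl_points \<tau> = range (orb \<tau>)"

text \<open>q is a representative of its orbit closest to p (so the projected straight segment
  from p to q is a shortest geodesic).\<close>
definition shortest :: "complex \<Rightarrow> complex \<Rightarrow> complex \<Rightarrow> bool" where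
  "shortest \<tau> p q \<longleftrightarrow> (\<forall>k::int. norm (p - q) \<le> norm (p - (q + of_int k * \<tau>)))"

definition unique_shortest :: "complex \<Rightarrow> complex set \<Rightarrow> complex set \<Rightarrow> bool" where
  "unique_shortest \<tau> a b \<longleftrightarrow>
     (\<forall>p\<in>a. \<forall>q\<in>b. \<forall>q'\<in>b. shortest \<tau> p q \<and> shortest \<tau> p q' \<longrightarrow> q = q')"

definition segpts :: "complex \<Rightarrow> complex set \<Rightarrow> complex set \<Rightarrow> complex set" where
  "segpts \<tau> a b = \<Union>{lift \<tau> (closed_segment p q) | p q. p \<in> a \<and> q \<in> b \<and> shortest \<tau> p q}"

text \<open>A segment with endpoints in S, identified with its (unordered) pair of endpoints.
  It must be the unique shortest geodesic and contain no point of S other than its endpoints.\<close>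
definition is_segment :: "complex \<Rightarrow> complex set set \<Rightarrow> complex set set \<Rightarrow> bool" where
  "is_segment \<tau> S e \<longleftrightarrow> (\<exists>a b. e = {a, b} \<and> a \<in> S \<and> b \<in> S \<and> a \<noteq> b \<and>
      unique_shortest \<tau> a b \<and> segpts \<tau> a b \<inter> \<Union>S \<subseteq> a \<union> b)"

definition edge_pts :: "complex \<Rightarrow> complex set set \<Rightarrow> complex set" where
  "edge_pts \<tau> e = \<Union>{segpts \<tau> a b | a b. e = {a, b}}"

definition crossing :: "complex \<Rightarrow> complex set set \<Rightarrow> complex set set \<Rightarrow> bool" where
  "crossing \<tau> e f \<longleftrightarrow> \<not> (edge_pts \<tau> e \<inter> edge_pts \<tau> f \<subseteq> \<Union>(e \<inter> f))"

definition covered :: "complex \<Rightarrow> complex set set set \<Rightarrow> complex set" where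
  "covered \<tau> T = \<Union>(edge_pts \<tau> ` T)"

text \<open>A subset of the plane whose projection to C is bounded in the quotient metric.\<close>
definition bounded_mod :: "complex \<Rightarrow> complex set \<Rightarrow> bool" where
  "bounded_mod \<tau> K \<longleftrightarrow> (\<exists>B. bounded B \<and> K \<subseteq> lift \<tau> B)"

definition face :: "complex \<Rightarrow> complex set set \<Rightarrow> complex set set set
    \<Rightarrow> complex \<Rightarrow> complex \<Rightarrow> complex \<Rightarrow> bool" where
  "face \<tau> S T p q r \<longleftrightarrow> orb \<tau> p \<in> S \<and> orb \<tau> q \<in> S \<and> orb \<tau> r \<in> S \<and>
     \<not> collinear {p, q, r} \<and> interior (convex hull {p, q, r}) \<in> components (- covered \<tau> T)"

definition triangulation :: "complex \<Rightarrow> complex set set \<Rightarrow> complex set set set \<Rightarrow> bool" where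
  "triangulation \<tau> S T \<longleftrightarrow>
     (\<forall>e\<in>T. is_segment \<tau> S e) \<and>
     (\<forall>e\<in>T. \<forall>f\<in>T. e \<noteq> f \<longrightarrow> \<not> crossing \<tau> e f) \<and>
     (\<forall>e. is_segment \<tau> S e \<and> e \<notin> T \<longrightarrow> (\<exists>f\<in>T. crossing \<tau> e f)) \<and>
     (\<forall>K\<in>components (- covered \<tau> T). bounded_mod \<tau> K \<longrightarrow>
        (\<exists>p q r. face \<tau> S T p q r \<and> K = interior (convex hull {p, q, r})))"

definition tri_region :: "complex \<Rightarrow> complex set set \<Rightarrow> complex set set set \<Rightarrow> complex set" where
  "tri_region \<tau> S T = \<Union>{convex hull {p, q, r} | p q r. face \<tau> S T p q r}"

definition boundary_edges :: "complex \<Rightarrow> complex set set \<Rightarrow> complex set set set \<Rightarrow> complex set set set" where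
  "boundary_edges \<tau> S T = {e \<in> T. edge_pts \<tau> e \<subseteq> frontier (tri_region \<tau> S T)}"

definition flip :: "complex \<Rightarrow> complex set set \<Rightarrow> complex set set set \<Rightarrow> complex set set set \<Rightarrow> bool" where
  "flip \<tau> S T T' \<longleftrightarrow> (\<exists>p q r s.
     face \<tau> S T p q r \<and> face \<tau> S T p q s \<and>
     {orb \<tau> p, orb \<tau> q} \<in> T \<and> edge_pts \<tau> {orb \<tau> p, orb \<tau> q} = lift \<tau> (closed_segment p q) \<and>
     is_segment \<tau> S {orb \<tau> r, orb \<tau> s} \<and>
     edge_pts \<tau> {orb \<tau> r, orb \<tau> s} = lift \<tau> (closed_segment r s) \<and>
     closed_segment r s \<subseteq> convex hull {p, q, r} \<union> convex hull {p, q, s} \<and>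
     T' = insert {orb \<tau> r, orb \<tau> s} (T - {{orb \<tau> p, orb \<tau> q}}))"

end

theory Submission
  imports Defs
begin

text \<open>
  Lift everything to the plane and let x be the coordinate along tau, normalised so that tau has
  length 1. Two points are joined by a segment iff some representatives differ by less than 1/2 in x,
  a property that passes to points with x-coordinates in between. Tilt x slightly to a coordinate u in
  general position and run Lawson's flip algorithm for the lifting of the vertices to the parabola u^2:
  flip an edge pq with adjacent triangles pqr and pqs whenever the chord over rs passes below the chord
  over pq. Then pqrs is convex, and rs is again short enough to be a segment: otherwise p and q would lie
  between r and s in the u-order, and the chord over rs would pass above the one over pq. As the
  lifted surface decreases, an edge that was flipped away stays above it and never returns, so the
  algorithm stops. The surface of a triangulation without such flips is strictly convex across each
  interior edge, hence lies strictly below every segment that crosses only interior edges. Two final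
  triangulations with the same boundary can therefore not cross: at a crossing each of the two segments
  would lie strictly below the other.

  The combinatorial structure needed for this, a triangle on each side of an edge that has something
  vertically above or below it, follows from maximality by looking at vertical trapezoids.
\<close>

text \<open>The lifting function is u^2 and not the usual paraboloid because a new diagonal must
  stay short around the cylinder. With p, q at (0, 10), (0, -10) and r, s at (-0.4, 0), (0.4, 0) the
  paraboloid would ask for the diagonal r s, whose width 0.8 exceeds half a turn, although the four
  sides of the quadrilateral are short. The excess (u z - u a) (u b - u z) of u^2 sees only widths,
  so a lower diagonal cannot overhang the old one at both ends. In return u^2 is constant along
  vertical lines, and two crossing edges can have equal heights over their crossing point. The tilt
  removes these ties, since each tie is a nonzero quadratic equation for the tilt. The tilt also
  separates vertices with equal x, so that no edge is vertical. It has to be so small that u refines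
  the order by x and that edges stay narrower than 1; then distinct translates of an edge lie in
  disjoint strips. A second difficulty is that a maximal non-crossing set may contain isolated
  vertices and edges without any triangle. Such edges do not count as boundary edges;
  \<open>two_sided_crossing\<close> deals with them.\<close>

type_synonym edge_set = "(complex \<times> complex) set"

definition cov :: "edge_set \<Rightarrow> complex set" where
  "cov E = (\<Union>(a, b)\<in>E. closed_segment a b)"

text \<open>A face described through its edges alone; that its interior is a whole component of the
  complement is \<open>empty_triangle_component\<close>.\<close>

definition empty_triangle :: "edge_set \<Rightarrow> complex \<Rightarrow> complex \<Rightarrow> complex \<Rightarrow> bool" where
  "empty_triangle E p q r \<longleftrightarrow> (p, q) \<in> E \<and> (q, r) \<in> E \<and> (p, r) \<in> E \<and> \<not> collinear {p, q, r} \<and>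
     interior (convex hull {p, q, r}) \<inter> cov E = {}"

text \<open>A frame consists of a linear coordinate u in general position, in which tau has length 1, and a
  second coordinate v; lines u = const are called vertical. W a b stands for: a and b are joined by a
  unique shortest geodesic, represented by the segment a b. Nothing distinguishes v from -v, so each
  statement about points below an edge has its mirror image above (lemma mirror).\<close>

locale sweep_frame =
  fixes u v :: "complex \<Rightarrow> real" and tau nn :: complex
    and P :: "complex set" and W :: "complex \<Rightarrow> complex \<Rightarrow> bool"
  assumes u_lin: "linear u" and v_lin: "linear v"
    and dec: "\<And>z. z = u z *\<^sub>R tau + v z *\<^sub>R nn"
    and coords: "u tau = 1" "v tau = 0" "u nn = 0" "v nn = 1"
    and P_shift: "\<And>p k. p \<in> P \<Longrightarrow> p + of_int k * tau \<in> P"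
    and P_fin: "\<And>s t. finite {p \<in> P. s \<le> u p \<and> u p \<le> t}"
    and u_inj: "inj_on u P"
    and W_sym: "\<And>a b. W a b \<Longrightarrow> W b a"
    and W_shift: "\<And>a b k. W a b \<Longrightarrow> W (a + of_int k * tau) (b + of_int k * tau)"
    and W_mono: "\<And>a b c d. \<lbrakk>a \<in> P; b \<in> P; c \<in> P; d \<in> P; W a b;
        u a \<le> u c; u c \<le> u d; u d \<le> u b\<rbrakk> \<Longrightarrow> W c d"
    and W_width: "\<And>a b. \<lbrakk>a \<in> P; b \<in> P; W a b\<rbrakk> \<Longrightarrow> \<bar>u a - u b\<bar> < 1"
    and generic: "\<And>a b c d z. \<lbrakk>a \<in> P; b \<in> P; c \<in> P; d \<in> P; W a b; W c d;
        z \<in> open_segment a b; z \<in> open_segment c d;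
        (u b - u a) * (v d - v c) \<noteq> (u d - u c) * (v b - v a)\<rbrakk>
        \<Longrightarrow> (u z - u a) * (u b - u z) \<noteq> (u z - u c) * (u d - u z)"
begin

definition admissible :: "complex \<Rightarrow> complex \<Rightarrow> bool" where
  "admissible a b \<longleftrightarrow> a \<in> P \<and> b \<in> P \<and> a \<noteq> b \<and> W a b \<and> closed_segment a b \<inter> P \<subseteq> {a, b}"

text \<open>E represents a triangulation by the pairs of endpoints of all lifts of its edges, in both orders.\<close>

definition max_noncrossing :: "edge_set \<Rightarrow> bool" where
  "max_noncrossing E \<longleftrightarrow> (\<forall>a b. (a, b) \<in> E \<longrightarrow> admissible a b \<and> (b, a) \<in> E
       \<and> (\<forall>k. (a + of_int k * tau, b + of_int k * tau) \<in> E)) \<and>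
     (\<forall>a b c d z. (a, b) \<in> E \<and> (c, d) \<in> E \<and> z \<in> closed_segment a b \<and> z \<in> closed_segment c d
        \<and> z \<notin> P \<longrightarrow> {a, b} = {c, d}) \<and>
     (\<forall>a b. admissible a b \<and> (a, b) \<notin> E \<longrightarrow>
        (\<exists>c d z. (c, d) \<in> E \<and> z \<in> closed_segment a b \<and> z \<in> closed_segment c d \<and> z \<notin> P))"

text \<open>Height over u = t of the line through a and b; junk if u a = u b.\<close>

definition line_ht :: "complex \<Rightarrow> complex \<Rightarrow> real \<Rightarrow> real" where
  "line_ht a b t = v a + (t - u a) * (v b - v a) / (u b - u a)"

definition excess :: "complex \<Rightarrow> complex \<Rightarrow> complex \<Rightarrow> real" where
  "excess a b z = (u z - u a) * (u b - u z)"

definition pt :: "real \<Rightarrow> real \<Rightarrow> complex" where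
  "pt s t = s *\<^sub>R tau + t *\<^sub>R nn"

text \<open>The witness may lie arbitrarily far down and may be an isolated vertex. By
  \<open>empty_triangle_below\<close> this weak condition already forces a triangle on the lower
  side of an edge.\<close>

definition below :: "edge_set \<Rightarrow> complex \<Rightarrow> complex \<Rightarrow> bool" where
  "below E a b \<longleftrightarrow> (\<exists>w \<in> cov E \<union> P. u a < u w \<and> u w < u b \<and> v w < line_ht a b (u w))"

definition above :: "edge_set \<Rightarrow> complex \<Rightarrow> complex \<Rightarrow> bool" where
  "above E a b \<longleftrightarrow> (\<exists>w \<in> cov E \<union> P. u a < u w \<and> u w < u b \<and> v w > line_ht a b (u w))"

section \<open>Coordinates, and segments as graphs over u\<close>

lemma u_simps [simp]: "u (a + b) = u a + u b" "u (a - b) = u a - u b" "u (c *\<^sub>R a) = c * u a"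
  "u (- a) = - u a" "u 0 = 0"
  using u_lin by (simp_all add: linear_add linear_diff linear_scale linear_neg linear_0)

lemma v_simps [simp]: "v (a + b) = v a + v b" "v (a - b) = v a - v b" "v (c *\<^sub>R a) = c * v a"
  "v (- a) = - v a" "v 0 = 0"
  using v_lin by (simp_all add: linear_add linear_diff linear_scale linear_neg linear_0)

lemma uv_shift [simp]: "u (of_int k * tau) = of_int k" "v (of_int k * tau) = 0"
proof -
  have "of_int k * tau = of_int k *\<^sub>R tau" by (simp add: scaleR_conv_of_real)
  then show "u (of_int k * tau) = of_int k" "v (of_int k * tau) = 0"
    using coords by (metis u_simps(3) mult.right_neutral, metis v_simps(3) coords(2) mult_zero_right)
qed

lemma uv_eqI: "u z = u w \<Longrightarrow> v z = v w \<Longrightarrow> z = w"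
  using dec[of z] dec[of w] by simp

lemma uv_pt [simp]: "u (pt s t) = s" "v (pt s t) = t"
  unfolding pt_def using coords by simp_all

lemma P_eqI: "p \<in> P \<Longrightarrow> q \<in> P \<Longrightarrow> u p = u q \<Longrightarrow> p = q"
  using u_inj by (auto simp: inj_on_def)

lemma mirror: "sweep_frame u (\<lambda>z. - v z) tau (- nn) P W"
proof (rule sweep_frame.intro)
  show "linear (\<lambda>z. - v z)" using v_lin by (rule linear_compose_neg)
  show "z = u z *\<^sub>R tau + - v z *\<^sub>R - nn" for z using dec[of z] by simp
next
  fix a b c d z
  assume *: "a \<in> P" "b \<in> P" "c \<in> P" "d \<in> P" "W a b" "W c d"
    "z \<in> open_segment a b" "z \<in> open_segment c d"
    "(u b - u a) * (- v d - - v c) \<noteq> (u d - u c) * (- v b - - v a)"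
  have "(u b - u a) * (v d - v c) \<noteq> (u d - u c) * (v b - v a)"
    using *(9) by (auto simp: algebra_simps)
  then show "(u z - u a) * (u b - u z) \<noteq> (u z - u c) * (u d - u z)"
    using generic[OF *(1-8)] by blast
next
  show "- v (- nn) = 1" "- v tau = 0" "u (- nn) = 0" using coords by simp_all
qed (fact u_lin coords P_shift P_fin u_inj W_sym W_shift W_mono W_width)+

lemma line_ht_ends [simp]: "line_ht a b (u a) = v a" "u a \<noteq> u b \<Longrightarrow> line_ht a b (u b) = v b"
  unfolding line_ht_def by auto

lemma line_ht_affine: "\<exists>m k. \<forall>t. line_ht a b t = m * t + k"
proof -
  define m where "m = (v b - v a) / (u b - u a)"
  have "\<forall>t. line_ht a b t = m * t + (v a - u a * m)"
    unfolding line_ht_def times_divide_eq_right[symmetric] m_def[symmetric] by (simp add: algebra_simps)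
  then show ?thesis by blast
qed

lemma line_ht_mix: "line_ht a b ((1 - x) * s + x * t) = (1 - x) * line_ht a b s + x * line_ht a b t"
proof -
  obtain m k where "\<And>t. line_ht a b t = m * t + k" using line_ht_affine by blast
  then show ?thesis by (simp add: algebra_simps)
qed

lemma in_seg_iff:
  assumes "u a < u b"
  shows "z \<in> closed_segment a b \<longleftrightarrow> u a \<le> u z \<and> u z \<le> u b \<and> v z = line_ht a b (u z)"
proof
  assume "z \<in> closed_segment a b"
  then obtain x where x: "0 \<le> x" "x \<le> 1" "z = (1 - x) *\<^sub>R a + x *\<^sub>R b"
    by (auto simp: closed_segment_def)
  have uz: "u z = (1 - x) * u a + x * u b" by (simp add: x(3))
  have "v z = (1 - x) * v a + x * v b" by (simp add: x(3))
  then have "v z = line_ht a b (u z)" unfolding uz line_ht_mix using assms by simp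
  moreover have "u z = u a + x * (u b - u a)" "u z = u b - (1 - x) * (u b - u a)"
    unfolding uz by (simp_all add: algebra_simps)
  moreover have "x * (u b - u a) \<ge> 0" "(1 - x) * (u b - u a) \<ge> 0" using x assms by auto
  ultimately show "u a \<le> u z \<and> u z \<le> u b \<and> v z = line_ht a b (u z)" by linarith
next
  assume *: "u a \<le> u z \<and> u z \<le> u b \<and> v z = line_ht a b (u z)"
  define x where "x = (u z - u a) / (u b - u a)"
  have x: "0 \<le> x" "x \<le> 1" using * assms by (auto simp: x_def)
  have "x * (u b - u a) = u z - u a" using assms by (simp add: x_def)
  then have uz: "u z = (1 - x) * u a + x * u b" by (simp add: algebra_simps)
  have "v z = (1 - x) * v a + x * v b"
    using * assms line_ht_mix[of a b x "u a" "u b"] uz by simp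
  then have "z = (1 - x) *\<^sub>R a + x *\<^sub>R b" using uz by (intro uv_eqI) simp_all
  then show "z \<in> closed_segment a b" using x by (auto simp: closed_segment_def)
qed

lemma in_open_seg_iff:
  assumes "u a < u b"
  shows "z \<in> open_segment a b \<longleftrightarrow> u a < u z \<and> u z < u b \<and> v z = line_ht a b (u z)"
proof -
  have "z = a \<longleftrightarrow> u z = u a" if "v z = line_ht a b (u z)" using that by (auto intro: uv_eqI)
  moreover have "z = b \<longleftrightarrow> u z = u b" if "v z = line_ht a b (u z)" using that assms by (auto intro: uv_eqI)
  ultimately show ?thesis
    unfolding open_segment_def using in_seg_iff[OF assms, of z] assms by auto
qed

lemma pt_in_seg: "u a < u b \<Longrightarrow> u a \<le> t \<Longrightarrow> t \<le> u b \<Longrightarrow> pt t (line_ht a b t) \<in> closed_segment a b"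
  by (simp add: in_seg_iff)

lemma seg_ne: "admissible a b \<Longrightarrow> u a \<noteq> u b"
  unfolding admissible_def using P_eqI by blast

lemma seg_sym: "admissible a b \<Longrightarrow> admissible b a"
  unfolding admissible_def using W_sym by (auto simp: closed_segment_commute)

lemma seg_P: "admissible a b \<Longrightarrow> z \<in> closed_segment a b \<Longrightarrow> z \<in> P \<Longrightarrow> z = a \<or> z = b"
  unfolding admissible_def by blast

text \<open>The difference of the two lines is affine and at most 0 on both sides of a zero, hence
  has slope 0.\<close>

lemma line_ht_lin_touch:
  assumes "s < t" "t < s'" "line_ht a b s \<le> line_ht c d s" "line_ht a b s' \<le> line_ht c d s'" "line_ht a b t = line_ht c d t"
  shows "line_ht a b x = line_ht c d x"
proof -
  obtain m k where 1: "\<And>t. line_ht a b t = m * t + k" using line_ht_affine by blast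
  obtain m' k' where 2: "\<And>t. line_ht c d t = m' * t + k'" using line_ht_affine by blast
  have e: "m * t + k = m' * t + k'" using assms 1 2 by metis
  have "m * s + k \<le> m' * s + k'" "m * s' + k \<le> m' * s' + k'" using assms 1 2 by metis+
  then have "(m - m') * (s - t) \<le> 0" "(m - m') * (s' - t) \<le> 0" using e by (simp_all add: algebra_simps)
  then have "m = m'" using assms(1,2)
    by (smt (verit) mult_neg_neg mult_pos_pos)
  then show ?thesis using e 1 2 by simp
qed


section \<open>Order of the edges along vertical lines\<close>

lemma line_ht_le:
  assumes "s \<le> t" "t \<le> s'" "line_ht a b s \<le> line_ht c d s" "line_ht a b s' \<le> line_ht c d s'"
  shows "line_ht a b t \<le> line_ht c d t"
proof (cases "s = s'")
  case True then show ?thesis using assms by auto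
next
  case False
  obtain m k where 1: "\<And>t. line_ht a b t = m * t + k" using line_ht_affine by blast
  obtain m' k' where 2: "\<And>t. line_ht c d t = m' * t + k'" using line_ht_affine by blast
  have "((m' - m) * s + (k' - k)) * (s' - t) \<ge> 0" "((m' - m) * s' + (k' - k)) * (t - s) \<ge> 0"
    by (rule mult_nonneg_nonneg; use assms in \<open>simp add: 1 2 algebra_simps\<close>)+
  then have "((m' - m) * t + (k' - k)) * (s' - s) \<ge> 0" by (simp add: algebra_simps)
  then have "(m' - m) * t + (k' - k) \<ge> 0" using False assms by (simp add: zero_le_mult_iff)
  then show ?thesis unfolding 1 2 by (simp add: algebra_simps)
qed

lemma line_ht_less:
  assumes "s \<le> t" "t \<le> s'" "line_ht a b s \<le> line_ht c d s" "line_ht a b s' \<le> line_ht c d s'"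
    "(s < t \<and> line_ht a b s' < line_ht c d s') \<or> (t < s' \<and> line_ht a b s < line_ht c d s)"
  shows "line_ht a b t < line_ht c d t"
proof (rule ccontr)
  assume "\<not> ?thesis"
  then have eq: "line_ht a b t = line_ht c d t" using line_ht_le[OF assms(1-4)] by linarith
  then have "s < t" "t < s'" using assms by (cases "s = t"; cases "t = s'"; auto)+
  then have "line_ht a b x = line_ht c d x" for x using line_ht_lin_touch[of s t s' a b c d] assms(3,4) eq by blast
  then show False using assms(5) by auto
qed

lemma line_ht_cross:
  assumes "line_ht a b s < line_ht c d s" "line_ht a b s' > line_ht c d s'"
  obtains t where "min s s' < t" "t < max s s'" "line_ht a b t = line_ht c d t"
proof -
  obtain m k where 1: "\<And>t. line_ht a b t = m * t + k" using line_ht_affine by blast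
  obtain m' k' where 2: "\<And>t. line_ht c d t = m' * t + k'" using line_ht_affine by blast
  have ne: "m \<noteq> m'" using assms unfolding 1 2 by auto
  define t where "t = (k' - k) / (m - m')"
  have eq: "(m - m') * t = k' - k" using ne unfolding t_def by simp
  have "(m - m') * (s - t) < 0" "(m - m') * (s' - t) > 0"
    using assms eq unfolding 1 2 by (auto simp: algebra_simps)
  then have "min s s' < t" "t < max s s'"
    by (auto simp: mult_less_0_iff zero_less_mult_iff)
  moreover have "line_ht a b t = line_ht c d t" using eq unfolding 1 2 by (simp add: algebra_simps)
  ultimately show ?thesis using that by blast
qed

lemma noncrossingD:
  assumes "max_noncrossing E"
  shows noncrossing_seg: "(a, b) \<in> E \<Longrightarrow> admissible a b" and noncrossing_sym: "(a, b) \<in> E \<Longrightarrow> (b, a) \<in> E"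
    and noncrossing_shift: "(a, b) \<in> E \<Longrightarrow> (a + of_int k * tau, b + of_int k * tau) \<in> E"
    and noncrossing_nc: "\<lbrakk>(a, b) \<in> E; (c, d) \<in> E; z \<in> closed_segment a b; z \<in> closed_segment c d; z \<notin> P\<rbrakk>
      \<Longrightarrow> {a, b} = {c, d}"
    and noncrossing_max: "\<lbrakk>admissible a b; (a, b) \<notin> E\<rbrakk> \<Longrightarrow>
      \<exists>c d z. (c, d) \<in> E \<and> z \<in> closed_segment a b \<and> z \<in> closed_segment c d \<and> z \<notin> P"
  using assms unfolding max_noncrossing_def by blast+

lemma noncrossing_P: "max_noncrossing E \<Longrightarrow> (a, b) \<in> E \<Longrightarrow> a \<in> P \<and> b \<in> P \<and> W a b \<and> u a \<noteq> u b \<and> a \<noteq> b"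
  using noncrossing_seg[of E a b] seg_ne[of a b] unfolding admissible_def by auto

lemma oriented:
  assumes "max_noncrossing E" "(a, b) \<in> E" "z \<in> closed_segment a b"
  obtains c d where "(c, d) \<in> E" "u c < u d" "z \<in> closed_segment c d" "{a, b} = {c, d}"
proof (cases "u a < u b")
  case True then show ?thesis using assms that by blast
next
  case False
  then show ?thesis using assms that[of b a] noncrossing_P[OF assms(1,2)] noncrossing_sym[OF assms(1,2)]
    by (auto simp: closed_segment_commute)
qed

lemma covI: "(a, b) \<in> E \<Longrightarrow> z \<in> closed_segment a b \<Longrightarrow> z \<in> cov E"
  unfolding cov_def by auto

lemma cov_edge:
  assumes "max_noncrossing E" "w \<in> cov E"
  obtains a b where "(a, b) \<in> E" "u a < u b" "u a \<le> u w" "u w \<le> u b" "v w = line_ht a b (u w)"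
    "w \<in> closed_segment a b"
proof -
  obtain a b where "(a, b) \<in> E" "w \<in> closed_segment a b" using assms(2) unfolding cov_def by auto
  then obtain c d where "(c, d) \<in> E" "u c < u d" "w \<in> closed_segment c d"
    using oriented[OF assms(1)] by metis
  then show ?thesis using that in_seg_iff by blast
qed

lemma cov_pt: "(a, b) \<in> E \<Longrightarrow> u a < u b \<Longrightarrow> u a \<le> t \<Longrightarrow> t \<le> u b \<Longrightarrow> pt t (line_ht a b t) \<in> cov E"
  using covI pt_in_seg by blast

lemma edge_P:
  assumes "max_noncrossing E" "(a, b) \<in> E" "u a < u b" "p \<in> P" "u a < u p" "u p < u b"
  shows "v p \<noteq> line_ht a b (u p)"
proof
  assume "v p = line_ht a b (u p)"
  then have "p \<in> closed_segment a b" using assms by (simp add: in_seg_iff)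
  then show False using seg_P[OF noncrossing_seg[OF assms(1,2)]] assms by auto
qed

text \<open>A common point outside \<open>P\<close> makes the two edges equal; a common point in
  \<open>P\<close> is an endpoint of each, because edges contain no other vertices.\<close>

lemma edges_meet:
  assumes "max_noncrossing E" "(a, b) \<in> E" "u a < u b" "(c, d) \<in> E" "u c < u d"
    "u a \<le> t" "t \<le> u b" "u c \<le> t" "t \<le> u d" "line_ht a b t = line_ht c d t"
  shows "(a = c \<and> b = d) \<or> ((t = u a \<or> t = u b) \<and> (t = u c \<or> t = u d))"
proof (cases "pt t (line_ht a b t) \<in> P")
  case True
  let ?z = "pt t (line_ht a b t)"
  have "?z \<in> closed_segment a b" "?z \<in> closed_segment c d"
    using assms pt_in_seg[of a b t] pt_in_seg[of c d t] by auto
  then have "?z = a \<or> ?z = b" "?z = c \<or> ?z = d"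
    using True seg_P noncrossing_seg[OF assms(1)] assms(2,4) by blast+
  then show ?thesis by (metis uv_pt(1))
next
  case False
  have "{a, b} = {c, d}"
    using noncrossing_nc[OF assms(1,2,4) _ _ False] pt_in_seg[of a b t] pt_in_seg[of c d t] assms by auto
  then show ?thesis using assms(3,5) by (auto simp: doubleton_eq_iff)
qed

text \<open>A change of order would need a common point strictly between the two columns, which
  \<open>edges_meet\<close> forbids for different edges. Strictness can fail only where both edges
  end.\<close>

lemma edges_order:
  assumes "max_noncrossing E" "(a, b) \<in> E" "u a < u b" "(c, d) \<in> E" "u c < u d"
    "u a \<le> s" "s \<le> u b" "u c \<le> s" "s \<le> u d" "u a \<le> t" "t \<le> u b" "u c \<le> t" "t \<le> u d"
    "line_ht c d s < line_ht a b s"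
  shows "line_ht c d t \<le> line_ht a b t"
    and "u a < t \<and> t < u b \<or> u c < t \<and> t < u d \<Longrightarrow> line_ht c d t < line_ht a b t"
proof -
  have ne: "\<not> (a = c \<and> b = d)" using assms(14) by auto
  show le: "line_ht c d t \<le> line_ht a b t"
  proof (rule ccontr)
    assume "\<not> ?thesis"
    then have "line_ht c d t > line_ht a b t" by simp
    from line_ht_cross[OF assms(14) this] obtain x where
      x: "min s t < x" "x < max s t" "line_ht c d x = line_ht a b x" by blast
    then show False using edges_meet[OF assms(1-5), of x] ne assms(6-13) by linarith
  qed
  assume "u a < t \<and> t < u b \<or> u c < t \<and> t < u d"
  then show "line_ht c d t < line_ht a b t"
    using le edges_meet[OF assms(1-5) assms(10-13)] ne by fastforce
qed

text \<open>Edges are narrower than 1, so only those with both ends within 1 of t reach the column,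
  and that strip holds finitely many vertices. This is what provides a nearest edge above or below a
  given point.\<close>

lemma finite_column:
  assumes "max_noncrossing E"
  shows "finite {v w |w. w \<in> cov E \<union> P \<and> u w = t}"
proof -
  let ?Q = "{p \<in> P. t - 1 \<le> u p \<and> u p \<le> t + 1}"
  have "{v w |w. w \<in> cov E \<union> P \<and> u w = t} \<subseteq> (\<lambda>(a, b). line_ht a b t) ` (?Q \<times> ?Q) \<union> v ` ?Q"
  proof
    fix h assume "h \<in> {v w |w. w \<in> cov E \<union> P \<and> u w = t}"
    then obtain w where w: "h = v w" "w \<in> cov E \<union> P" "u w = t" by blast
    show "h \<in> (\<lambda>(a, b). line_ht a b t) ` (?Q \<times> ?Q) \<union> v ` ?Q"
    proof (cases "w \<in> P")
      case True then show ?thesis using w by auto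
    next
      case False
      then have "w \<in> cov E" using w by blast
      then obtain a b where ab: "(a, b) \<in> E" "u a < u b" "u a \<le> u w" "u w \<le> u b" "v w = line_ht a b (u w)"
        using cov_edge[OF assms] by metis
      have "\<bar>u a - u b\<bar> < 1" "a \<in> P" "b \<in> P" using noncrossing_P[OF assms ab(1)] W_width by auto
      then have "(a, b) \<in> ?Q \<times> ?Q" using ab w(3) by auto
      moreover have "h = (\<lambda>(a, b). line_ht a b t) (a, b)" using ab(5) w by simp
      ultimately show ?thesis by blast
    qed
  qed
  then show ?thesis using P_fin by (meson finite_SigmaI finite_UnI finite_imageI finite_subset)
qed

lemma highest_below:
  assumes "max_noncrossing E" "w0 \<in> cov E \<union> P" "u w0 = t" "v w0 < y"
  shows "\<exists>w \<in> cov E \<union> P. u w = t \<and> v w < y \<and> v w0 \<le> v w \<and>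
    (\<forall>w' \<in> cov E \<union> P. u w' = t \<longrightarrow> v w' < y \<longrightarrow> v w' \<le> v w)"
proof -
  let ?H = "{h \<in> {v w |w. w \<in> cov E \<union> P \<and> u w = t}. h < y}"
  have fin: "finite ?H" using finite_column[OF assms(1), of t] by simp
  have mem: "v w0 \<in> ?H" using assms by auto
  have "Max ?H \<in> ?H" using Max_in[OF fin] mem by blast
  then obtain w where w: "w \<in> cov E \<union> P" "u w = t" "v w < y" "v w = Max ?H"
    unfolding mem_Collect_eq by metis
  have "v w0 \<le> v w" using w(4) mem fin by simp
  moreover have "v w' \<le> v w" if "w' \<in> cov E \<union> P" "u w' = t" "v w' < y" for w'
    unfolding w(4) using that by (intro Max_ge[OF fin]) auto
  ultimately show ?thesis using w(1-3) by blast
qed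

lemma mirror_line_ht: "sweep_frame.line_ht u (\<lambda>z. - v z) a b t = - line_ht a b t"
proof -
  have "(t - u a) * (- v b - - v a) / (u b - u a) = - ((t - u a) * (v b - v a) / (u b - u a))"
    by (simp add: field_simps minus_divide_left del: minus_divide_left[symmetric])
  then show ?thesis unfolding sweep_frame.line_ht_def[OF mirror] line_ht_def by simp
qed

lemma lowest_above:
  assumes "max_noncrossing E" "w0 \<in> cov E \<union> P" "u w0 = t" "y < v w0"
  shows "\<exists>w \<in> cov E \<union> P. u w = t \<and> y < v w \<and> v w \<le> v w0 \<and>
    (\<forall>w' \<in> cov E \<union> P. u w' = t \<longrightarrow> y < v w' \<longrightarrow> v w \<le> v w')"
  using sweep_frame.highest_below[OF mirror assms(1-3), of "- y"] assms(4)
  by (simp only: neg_less_iff_less neg_le_iff_le)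

lemma finite_arg_max_u:
  assumes "L \<subseteq> P" "l0 \<in> L" "\<And>q. q \<in> L \<Longrightarrow> s \<le> u q \<and> u q \<le> t"
  obtains l where "l \<in> L" "\<And>q. q \<in> L \<Longrightarrow> u q \<le> u l"
proof -
  have "finite L" by (rule finite_subset[OF _ P_fin[of s t]]) (use assms in blast)
  then have fin: "finite (u ` L)" "u ` L \<noteq> {}" using assms(2) by auto
  obtain l where "l \<in> L" "u l = Max (u ` L)" using Max_in[OF fin] by force
  then show ?thesis using that Max_ge[OF fin(1)] by (metis imageI)
qed

lemma finite_arg_min_u:
  assumes "L \<subseteq> P" "l0 \<in> L" "\<And>q. q \<in> L \<Longrightarrow> s \<le> u q \<and> u q \<le> t"
  obtains l where "l \<in> L" "\<And>q. q \<in> L \<Longrightarrow> u l \<le> u q"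
proof -
  have "finite L" by (rule finite_subset[OF _ P_fin[of s t]]) (use assms in blast)
  then have fin: "finite (u ` L)" "u ` L \<noteq> {}" using assms(2) by auto
  obtain l where "l \<in> L" "u l = Min (u ` L)" using Min_in[OF fin] by force
  then show ?thesis using that Min_le[OF fin(1)] by (metis imageI)
qed

text \<open>Suppose \<open>p\<close> is on no edge. Its column has a nearest edge \<open>a b\<close>
  above and possibly a nearest edge below. Let \<open>l\<close> be the rightmost vertex left of
  \<open>p\<close> between them. Then \<open>l p\<close> is admissible, so by maximality some edge
  \<open>e f\<close> crosses it. The right end of \<open>e f\<close> cannot come before
  \<open>p\<close> without beating \<open>l\<close>, so \<open>e f\<close> enters the column of
  \<open>p\<close> strictly between the two neighbours, which is absurd.\<close>

lemma covered_below:
  assumes E: "max_noncrossing E" and ab0: "(a0, b0) \<in> E" "u a0 < u p" "u p < u b0" "v p < line_ht a0 b0 (u p)"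
    and p: "p \<in> P"
  shows "p \<in> cov E"
proof (rule ccontr)
  assume np: "p \<notin> cov E"
  have col: "w = p \<or> (\<exists>a b. (a, b) \<in> E \<and> u a < u p \<and> u p < u b \<and> v w = line_ht a b (u p))"
    if w: "w \<in> cov E \<union> P" "u w = u p" for w
  proof (cases "w = p")
    case False
    then have "w \<in> cov E" using w P_eqI p by blast
    then obtain a b where *: "(a, b) \<in> E" "u a < u b" "u a \<le> u w" "u w \<le> u b" "v w = line_ht a b (u w)"
      using cov_edge[OF E] by metis
    have "a \<in> cov E" "b \<in> cov E" using *(1) by (auto intro!: covI)
    then have "u a \<noteq> u p" "u b \<noteq> u p" using np P_eqI p noncrossing_P[OF E *(1)] by metis+
    then show ?thesis using * w by (metis less_eq_real_def)
  qed auto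
  let ?x = "pt (u p) (line_ht a0 b0 (u p))"
  have x: "?x \<in> cov E \<union> P" "u ?x = u p" "v p < v ?x" using cov_pt[OF ab0(1)] ab0 by simp_all
  obtain w where w: "w \<in> cov E \<union> P" "u w = u p" "v p < v w"
    and wmin: "\<forall>w' \<in> cov E \<union> P. u w' = u p \<longrightarrow> v p < v w' \<longrightarrow> v w \<le> v w'"
    using lowest_above[OF E x] by blast
  obtain a b where ab: "(a, b) \<in> E" "u a < u p" "u p < u b" and vw: "v w = line_ht a b (u p)"
    using col[OF w(1,2)] w(3) by auto
  have uab: "u a < u b" using ab by simp
  have pab: "v p < line_ht a b (u p)" using w vw by simp
  \<comment> \<open>\<open>G\<close> holds the edge next below \<open>p\<close>, or is empty if no
    edge passes below \<open>p\<close>; both cases then run through the same argument.\<close>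
  obtain G where G: "\<And>c d. (c, d) \<in> G \<Longrightarrow> (c, d) \<in> E \<and> u c < u p \<and> u p < u d \<and> line_ht c d (u p) < v p"
    and Gmax: "\<And>w'. w' \<in> cov E \<Longrightarrow> u w' = u p \<Longrightarrow> v w' < v p \<Longrightarrow> \<exists>c d. (c, d) \<in> G \<and> v w' \<le> line_ht c d (u p)"
    and G1: "G = {} \<or> (\<exists>c d. G = {(c, d)})"
  proof (cases "\<exists>w'\<in>cov E. u w' = u p \<and> v w' < v p")
    case False then show ?thesis using that[of "{}"] by auto
  next
    case True
    then obtain x where x: "x \<in> cov E \<union> P" "u x = u p" "v x < v p"
      and xmax: "\<forall>w' \<in> cov E \<union> P. u w' = u p \<longrightarrow> v w' < v p \<longrightarrow> v w' \<le> v x"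
      using highest_below[OF E, of _ "u p" "v p"] by blast
    obtain c d where "(c, d) \<in> E" "u c < u p" "u p < u d" "v x = line_ht c d (u p)"
      using col[OF x(1,2)] x(3) by auto
    then show ?thesis using that[of "{(c, d)}"] x xmax by auto
  qed
  \<comment> \<open>The vertices left of \<open>p\<close> in the slab between the neighbouring
    edges; the rightmost of them can be joined to \<open>p\<close> inside the slab.\<close>
  define L where "L = {q \<in> P. u a \<le> u q \<and> u q < u p \<and> v q \<le> line_ht a b (u q) \<and>
      (\<forall>c d. (c, d) \<in> G \<longrightarrow> u c \<le> u q \<and> line_ht c d (u q) \<le> v q)}"
  have Gab: "line_ht c d t \<le> line_ht a b t" "u a < t \<or> u c < t \<Longrightarrow> line_ht c d t < line_ht a b t"
    if "(c, d) \<in> G" "u a \<le> t" "u c \<le> t" "t \<le> u p" for c d t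
    using edges_order[OF E ab(1) uab, of c d "u p" t] G[OF that(1)] that ab pab by auto
  have aP: "a \<in> P" "b \<in> P" "W a b" using noncrossing_P[OF E ab(1)] by auto
  have "\<exists>l0. l0 \<in> L"
    using G1
  proof
    assume "G = {}" then have "a \<in> L" using aP ab by (simp add: L_def)
    then show ?thesis ..
  next
    assume "\<exists>c d. G = {(c, d)}"
    then obtain c d where Gcd: "G = {(c, d)}" by blast
    then have cd: "(c, d) \<in> G" by simp
    show ?thesis
    proof (cases "u c \<le> u a")
      case True
      then have "a \<in> L" using aP ab Gab(1)[OF cd, of "u a"] Gcd by (simp add: L_def)
      then show ?thesis ..
    next
      case False
      have "c \<in> P" using noncrossing_P[OF E] G[OF cd] by blast
      then have "c \<in> L" using False ab Gab(1)[OF cd, of "u c"] G[OF cd] Gcd by (simp add: L_def)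
      then show ?thesis ..
    qed
  qed
  then obtain l0 where l0: "l0 \<in> L" ..
  have LP: "L \<subseteq> P" "\<And>q. q \<in> L \<Longrightarrow> u a \<le> u q \<and> u q \<le> u p" by (auto simp: L_def)
  obtain l where l: "l \<in> L" and lmax: "\<And>q. q \<in> L \<Longrightarrow> u q \<le> u l"
    using finite_arg_max_u[OF LP(1) l0 LP(2)] by blast
  have lP: "l \<in> P" and ul: "u a \<le> u l" "u l < u p" and lab: "v l \<le> line_ht a b (u l)"
    and lG: "\<And>c d. (c, d) \<in> G \<Longrightarrow> u c \<le> u l \<and> line_ht c d (u l) \<le> v l"
    using l unfolding L_def by blast+
  have on: "v z < line_ht a b (u z) \<and> (\<forall>c d. (c, d) \<in> G \<longrightarrow> line_ht c d (u z) < v z)"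
    if z: "z \<in> closed_segment l p" "z \<noteq> l" for z
  proof -
    have z': "u l \<le> u z" "u z \<le> u p" "v z = line_ht l p (u z)" using z in_seg_iff[OF ul(2)] by auto
    have "u z \<noteq> u l" using z' z(2) uv_eqI[of z l] by auto
    then have zl: "u l < u z" using z' by simp
    have "line_ht l p (u z) < line_ht a b (u z)"
      using line_ht_less[OF z'(1,2), of l p a b] lab pab zl ul by auto
    moreover have "line_ht c d (u z) < line_ht l p (u z)" if "(c, d) \<in> G" for c d
      using line_ht_less[OF z'(1,2), of c d l p] lG[OF that] G[OF that] zl ul by auto
    ultimately show ?thesis using z' by simp
  qed
  have "admissible l p"
  proof -
    have "W l p" using W_mono[OF aP(1,2) lP p aP(3)] ul ab by simp
    moreover have "q = l \<or> q = p" if q: "q \<in> closed_segment l p" "q \<in> P" for q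
    proof (rule ccontr)
      assume n: "\<not> ?thesis"
      have q': "u l \<le> u q" "u q \<le> u p" using q in_seg_iff[OF ul(2)] by auto
      moreover have "u q \<noteq> u l" "u q \<noteq> u p" using n P_eqI q lP p by auto
      ultimately have q'': "u l < u q" "u q < u p" by auto
      have "v q < line_ht a b (u q)" "\<forall>c d. (c, d) \<in> G \<longrightarrow> line_ht c d (u q) < v q"
        using on[OF q(1)] n by simp_all
      then have "q \<in> L" unfolding L_def using q(2) q'' ul lG by (simp add: less_imp_le) (meson less_imp_le order_trans)
      then show False using lmax[of q] q'' by simp
    qed
    ultimately show ?thesis unfolding admissible_def using lP p ul by auto
  qed
  moreover have "(l, p) \<notin> E" using np covI[of l p E p] by auto
  ultimately obtain e0 f0 z where "(e0, f0) \<in> E" and z: "z \<in> closed_segment l p" "z \<in> closed_segment e0 f0" "z \<notin> P"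
    using noncrossing_max[OF E, of l p] by blast
  then obtain e f where ef: "(e, f) \<in> E" "u e < u f" "z \<in> closed_segment e f"
    using oriented[OF E] by metis
  have efP: "e \<in> P" "f \<in> P" using noncrossing_P[OF E ef(1)] by auto
  have zn: "z \<noteq> l" "z \<noteq> p" using z lP p by auto
  have z': "u l \<le> u z" "u z \<le> u p" "v z = line_ht l p (u z)" using z in_seg_iff[OF ul(2)] by auto
  have "u l \<noteq> u z" "u p \<noteq> u z" using z' zn uv_eqI[of z l] uv_eqI[of z p] ul by auto
  then have uz: "u l < u z" "u z < u p" using z' by auto
  have ze: "u e \<le> u z" "u z \<le> u f" "v z = line_ht e f (u z)" using ef in_seg_iff by auto
  have zab: "line_ht e f (u z) < line_ht a b (u z)" and zG: "\<And>c d. (c, d) \<in> G \<Longrightarrow> line_ht c d (u z) < line_ht e f (u z)"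
    using on[OF z(1) zn(1)] ze(3) by auto
  have O1: "line_ht e f t \<le> line_ht a b t" "u a < t \<and> t < u b \<Longrightarrow> line_ht e f t < line_ht a b t"
    if "u z \<le> t" "t \<le> u f" "t \<le> u p" for t
    using edges_order[OF E ab(1) uab ef(1,2), of "u z" t] zab that ze uz ul ab by auto
  have O2: "line_ht c d t \<le> line_ht e f t" "u c < t \<and> t < u d \<Longrightarrow> line_ht c d t < line_ht e f t"
    if "u z \<le> t" "t \<le> u f" "t \<le> u p" "(c, d) \<in> G" for t c d
    using edges_order[OF E ef(1,2), of c d "u z" t] zG[OF that(4)] G[OF that(4)] lG[OF that(4)] that ze uz ul ab by auto
  \<comment> \<open>Otherwise \<open>f\<close> would belong to \<open>L\<close> and lie to the right
    of \<open>l\<close>.\<close>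
  have "u p < u f"
  proof (rule ccontr)
    assume "\<not> ?thesis"
    moreover have "u f \<noteq> u p" using P_eqI[OF efP(2) p] np covI[OF ef(1), of f] by auto
    ultimately have "u f < u p" by simp
    have "v f \<le> line_ht a b (u f)" using O1(1)[of "u f"] ze ef \<open>u f < u p\<close> by simp
    moreover have "u c \<le> u f \<and> line_ht c d (u f) \<le> v f" if "(c, d) \<in> G" for c d
      using O2(1)[of "u f" c d] that ze ef uz lG[OF that] \<open>u f < u p\<close> by simp
    ultimately have "f \<in> L" unfolding L_def using efP(2) ze uz ul \<open>u f < u p\<close> by simp
    then have "u f \<le> u l" by (rule lmax)
    then show False using ze uz by simp
  qed
  then have ufp: "u z \<le> u p" "u p \<le> u f" "u e < u p" using ze uz by auto
  have cw: "pt (u p) (line_ht e f (u p)) \<in> cov E" using cov_pt[OF ef(1,2)] ufp by simp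
  have lt: "line_ht e f (u p) < line_ht a b (u p)" using O1(2)[of "u p"] ufp ab by simp
  consider "line_ht e f (u p) = v p" | "line_ht e f (u p) > v p" | "line_ht e f (u p) < v p" by linarith
  then show False
  proof cases
    case 1
    then have "pt (u p) (line_ht e f (u p)) = p" by (auto intro: uv_eqI)
    then show False using cw np by simp
  next
    case 2
    then show False using bspec[OF wmin UnI1[OF cw]] lt vw by simp
  next
    case 3
    then obtain c d where cd: "(c, d) \<in> G" "line_ht e f (u p) \<le> line_ht c d (u p)"
      using Gmax[OF cw] by auto
    then show False using O2(2)[OF ufp(1,2) order_refl cd(1)] G[OF cd(1)] by auto
  qed
qed

text \<open>So an isolated vertex never shares its column with an inner point of an edge.\<close>

lemma covered_under_edge:
  assumes E: "max_noncrossing E" and ab: "(a, b) \<in> E" "u a < u p" "u p < u b" and p: "p \<in> P"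
  shows "p \<in> cov E"
proof -
  have "v p \<noteq> line_ht a b (u p)" using edge_P[OF E ab(1) _ p] ab by simp
  then show ?thesis
    using covered_below[OF E ab(1-3) _ p] sweep_frame.covered_below[OF mirror E ab _ p]
    unfolding mirror_line_ht by linarith
qed


text \<open>The vertical trapezoid between two adjacent edges has a point of P on each of its vertical
  walls; the segment joining them is admissible, so by maximality it is the floor or the ceiling.\<close>
lemma adjacent_edges:
  assumes E: "max_noncrossing E" and ab: "(a, b) \<in> E" "u a < t" "t < u b"
    and cd: "(c, d) \<in> E" "u c < t" "t < u d"
    and lt: "line_ht c d t < line_ht a b t"
    and clear: "\<And>w. w \<in> cov E \<union> P \<Longrightarrow> u w = t \<Longrightarrow> \<not> (line_ht c d t < v w \<and> v w < line_ht a b t)"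
  shows "(u c \<le> u a \<and> u b \<le> u d \<and>
      (\<forall>p\<in>P. u a < u p \<and> u p < u b \<longrightarrow> \<not> (line_ht c d (u p) \<le> v p \<and> v p \<le> line_ht a b (u p)))) \<or>
    (u a \<le> u c \<and> u d \<le> u b \<and>
      (\<forall>p\<in>P. u c < u p \<and> u p < u d \<longrightarrow> \<not> (line_ht c d (u p) \<le> v p \<and> v p \<le> line_ht a b (u p))))"
proof -
  have uab: "u a < u b" and ucd: "u c < u d" using ab cd by auto
  have aP: "a \<in> P" "b \<in> P" "W a b" and cP: "c \<in> P" "d \<in> P" using noncrossing_P[OF E ab(1)] noncrossing_P[OF E cd(1)] by auto
  have H: "line_ht c d s \<le> line_ht a b s"
    if "u a \<le> s" "s \<le> u b" "u c \<le> s" "s \<le> u d" for s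
    using edges_order[OF E ab(1) uab cd(1) ucd, of t s] that ab cd lt by auto
  let ?between = "\<lambda>p. line_ht c d (u p) \<le> v p \<and> v p \<le> line_ht a b (u p)"
  \<comment> \<open>\<open>L\<close> and \<open>R\<close> collect the vertices between the two edges
    to the left and to the right of the column; those nearest to the column, \<open>l\<close> and
    \<open>r\<close>, determine the walls.\<close>
  define L where "L = {p \<in> P. u a \<le> u p \<and> u c \<le> u p \<and> u p < t \<and> ?between p}"
  define R where "R = {p \<in> P. u p \<le> u b \<and> u p \<le> u d \<and> t < u p \<and> ?between p}"
  have "\<exists>l0. l0 \<in> L"
  proof (cases "u c \<le> u a")
    case True
    then have "a \<in> L" using aP ab cd H[of "u a"] by (simp add: L_def)
    then show ?thesis ..
  next
    case False
    then have "c \<in> L" using cP ab cd H[of "u c"] by (simp add: L_def)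
    then show ?thesis ..
  qed
  then obtain l0 where l0: "l0 \<in> L" ..
  have LP: "L \<subseteq> P" "\<And>q. q \<in> L \<Longrightarrow> u a \<le> u q \<and> u q \<le> t" by (auto simp: L_def)
  obtain l where l: "l \<in> L" and lmax: "\<And>q. q \<in> L \<Longrightarrow> u q \<le> u l"
    using finite_arg_max_u[OF LP(1) l0 LP(2)] by blast
  have "\<exists>r0. r0 \<in> R"
  proof (cases "u b \<le> u d")
    case True
    then have "b \<in> R" using aP ab cd uab H[of "u b"] by (simp add: R_def)
    then show ?thesis ..
  next
    case False
    then have "d \<in> R" using cP ab cd ucd H[of "u d"] by (simp add: R_def)
    then show ?thesis ..
  qed
  then obtain r0 where r0: "r0 \<in> R" ..
  have RP: "R \<subseteq> P" "\<And>q. q \<in> R \<Longrightarrow> t \<le> u q \<and> u q \<le> u b" by (auto simp: R_def)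
  obtain r where r: "r \<in> R" and rmin: "\<And>q. q \<in> R \<Longrightarrow> u r \<le> u q"
    using finite_arg_min_u[OF RP(1) r0 RP(2)] by blast
  have l': "l \<in> P" "u a \<le> u l" "u c \<le> u l" "u l < t" "?between l" using l by (auto simp: L_def)
  have r': "r \<in> P" "u r \<le> u b" "u r \<le> u d" "t < u r" "?between r" using r by (auto simp: R_def)
  have lr: "u l < u r" using l' r' by simp
  have wide: "u l < u b" "u l < u d" "u a < u r" "u c < u r" using l' r' ab cd by auto
  have noP: False if q: "q \<in> P" "u l < u q" "u q < u r" "?between q" for q
  proof -
    consider "u q < t" | "u q = t" | "t < u q" by linarith
    then show False
    proof cases
      case 1
      then have "q \<in> L" using q l' by (auto simp: L_def)
      then show False using lmax[of q] q by simp
    next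
      case 2
      then have "v q \<noteq> line_ht a b (u q)" "v q \<noteq> line_ht c d (u q)"
        using edge_P[OF E ab(1) uab q(1)] edge_P[OF E cd(1) ucd q(1)] ab cd by auto
      then show False using clear[of q] q 2 by auto
    next
      case 3
      then have "q \<in> R" using q r' by (auto simp: R_def)
      then show False using rmin[of q] q by simp
    qed
  qed
  \<comment> \<open>An edge entering the trapezoid strictly between floor and ceiling cannot end
    before the column at t: such an end would be nearer to the column than \<open>l\<close> or
    \<open>r\<close>. So it reaches the column, where \<open>clear\<close> excludes it.\<close>
  have claim: "(e = a \<and> f = b) \<or> (e = c \<and> f = d)"
    if ef: "(e, f) \<in> E" "u e < u f" "u e \<le> s" "s \<le> u f" "u l < s" "s < u r"
      and bt: "line_ht c d s \<le> line_ht e f s" "line_ht e f s \<le> line_ht a b s" for e f s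
  proof (rule ccontr)
    assume ne: "\<not> ?thesis"
    have "line_ht e f s \<noteq> line_ht a b s"
      using edges_meet[OF E ef(1,2) ab(1) uab, of s] ef ne l' r' by auto
    moreover have "line_ht e f s \<noteq> line_ht c d s"
      using edges_meet[OF E ef(1,2) cd(1) ucd, of s] ef ne l' r' by auto
    ultimately have st: "line_ht c d s < line_ht e f s" "line_ht e f s < line_ht a b s" using bt by auto
    have efP: "e \<in> P" "f \<in> P" using noncrossing_P[OF E ef(1)] by auto
    have s': "u a \<le> s" "s \<le> u b" "u c \<le> s" "s \<le> u d" using ef l' r' by auto
    have O1: "line_ht e f x \<le> line_ht a b x" "u a < x \<and> x < u b \<Longrightarrow> line_ht e f x < line_ht a b x"
      if "u a \<le> x" "x \<le> u b" "u e \<le> x" "x \<le> u f" for x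
      using edges_order[OF E ab(1) uab ef(1,2) s'(1,2) ef(3,4) that st(2)] by auto
    have O2: "line_ht c d x \<le> line_ht e f x" "u c < x \<and> x < u d \<Longrightarrow> line_ht c d x < line_ht e f x"
      if "u c \<le> x" "x \<le> u d" "u e \<le> x" "x \<le> u f" for x
      using edges_order[OF E ef(1,2) cd(1) ucd ef(3,4) s'(3,4) that(3,4,1,2) st(1)] by auto
    have "t \<le> u f"
    proof (rule ccontr)
      assume "\<not> ?thesis"
      then have "f \<in> L" using efP O1(1)[of "u f"] O2(1)[of "u f"] ef s' ab cd by (auto simp: L_def)
      then show False using lmax[of f] ef by simp
    qed
    moreover have "u e \<le> t"
    proof (rule ccontr)
      assume "\<not> ?thesis"
      then have "e \<in> R" using efP O1(1)[of "u e"] O2(1)[of "u e"] ef s' ab cd by (auto simp: R_def)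
      then show False using rmin[of e] ef by simp
    qed
    ultimately have "line_ht c d t < line_ht e f t" "line_ht e f t < line_ht a b t" "pt t (line_ht e f t) \<in> cov E"
      using O1(2)[of t] O2(2)[of t] ab cd cov_pt[OF ef(1,2), of t] by auto
    then show False using clear[of "pt t (line_ht e f t)"] by simp
  qed
  have on: "line_ht c d s \<le> line_ht l r s" "line_ht l r s \<le> line_ht a b s" if "u l \<le> s" "s \<le> u r" for s
    using line_ht_le[OF that, of c d l r] line_ht_le[OF that, of l r a b] l' r' lr by auto
  have "admissible l r"
  proof -
    have "W l r" using W_mono[OF aP(1,2) l'(1) r'(1) aP(3)] l' r' by simp
    moreover have "q = l \<or> q = r" if q: "q \<in> closed_segment l r" "q \<in> P" for q
    proof (rule ccontr)
      assume n: "\<not> ?thesis"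
      have q': "u l \<le> u q" "u q \<le> u r" "v q = line_ht l r (u q)" using q in_seg_iff[OF lr] by auto
      moreover have "u q \<noteq> u l" "u q \<noteq> u r" using n P_eqI q l' r' by auto
      ultimately show False using noP[OF q(2)] on[OF q'(1,2)] by auto
    qed
    ultimately show ?thesis unfolding admissible_def using l' r' lr by auto
  qed
  have "(l = a \<and> r = b) \<or> (l = c \<and> r = d)"
  proof (cases "(l, r) \<in> E")
    case True
    then show ?thesis using claim[OF True lr, of t] on[of t] l' r' by auto
  next
    case False
    from noncrossing_max[OF E \<open>admissible l r\<close> False] obtain e0 f0 z where "(e0, f0) \<in> E"
      and z: "z \<in> closed_segment l r" "z \<in> closed_segment e0 f0" "z \<notin> P"
      by blast
    then obtain e f where ef: "(e, f) \<in> E" "u e < u f" "z \<in> closed_segment e f"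
      using oriented[OF E] by metis
    have z': "u l \<le> u z" "u z \<le> u r" "v z = line_ht l r (u z)" using z in_seg_iff[OF lr] by auto
    have ze: "u e \<le> u z" "u z \<le> u f" "v z = line_ht e f (u z)" using ef in_seg_iff by auto
    have "z \<noteq> l" "z \<noteq> r" using z l' r' by auto
    then have "u l \<noteq> u z" "u r \<noteq> u z" using z' uv_eqI[of z l] uv_eqI[of z r] lr by auto
    then have uz: "u l < u z" "u z < u r" using z' by auto
    have "(e = a \<and> f = b) \<or> (e = c \<and> f = d)"
      using claim[OF ef(1,2) ze(1,2) uz] on[of "u z"] z' ze by simp
    then show ?thesis
    proof
      assume *: "e = a \<and> f = b"
      have eqz: "line_ht l r (u z) = line_ht a b (u z)" using z'(3) ze(3) * by simp
      \<comment> \<open>The segment \<open>l r\<close> stays below \<open>a b\<close> and touches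
        it, so both lie on one line; vertices on the edge \<open>a b\<close> can only be its
        ends.\<close>
      have "line_ht l r x = line_ht a b x" for x
        by (rule line_ht_lin_touch[OF uz _ _ eqz]) (use l' r' lr in auto)
      then have eq: "v l = line_ht a b (u l)" "v r = line_ht a b (u r)"
        using lr by (metis line_ht_ends(1), metis line_ht_ends(2) less_irrefl)
      have "\<not> u a < u l" using edge_P[OF E ab(1) uab l'(1)] eq wide by auto
      moreover have "\<not> u r < u b" using edge_P[OF E ab(1) uab r'(1)] eq wide by auto
      ultimately have "u l = u a" "u r = u b" using l' r' by auto
      then show ?thesis using P_eqI[of l a] P_eqI[of r b] l' r' aP by auto
    next
      assume *: "e = c \<and> f = d"
      have eqz: "line_ht c d (u z) = line_ht l r (u z)" using z'(3) ze(3) * by simp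
      have "line_ht c d x = line_ht l r x" for x
        by (rule line_ht_lin_touch[OF uz _ _ eqz]) (use l' r' lr in auto)
      then have eq: "v l = line_ht c d (u l)" "v r = line_ht c d (u r)"
        using lr by (metis line_ht_ends(1), metis line_ht_ends(2) less_irrefl)
      have "\<not> u c < u l" using edge_P[OF E cd(1) ucd l'(1)] eq wide by auto
      moreover have "\<not> u r < u d" using edge_P[OF E cd(1) ucd r'(1)] eq wide by auto
      ultimately have "u l = u c" "u r = u d" using l' r' by auto
      then show ?thesis using P_eqI[of l c] P_eqI[of r d] l' r' cP by auto
    qed
  qed
  then show ?thesis using l' r' noP by blast
qed


section \<open>Empty triangles\<close>

text \<open>Twice the signed area of the triangle \<open>a b z\<close> in the coordinates (u, v). If
  u a < u b, positive means that z is above the line through \<open>a\<close> and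
  \<open>b\<close>.\<close>

definition orient :: "complex \<Rightarrow> complex \<Rightarrow> complex \<Rightarrow> real" where
  "orient a b z = (u b - u a) * (v z - v a) - (u z - u a) * (v b - v a)"

lemma orient_rot: "orient b c a = orient a b c" "orient c a b = orient a b c" and orient_swap: "orient b a c = - orient a b c"
  unfolding orient_def by (simp_all add: algebra_simps)

lemma orient_ends [simp]: "orient a b a = 0" "orient a b b = 0" "orient a a z = 0"
  unfolding orient_def by (simp_all add: algebra_simps)

lemma orient_mix: "orient a b ((1 - x) *\<^sub>R y + x *\<^sub>R z) = (1 - x) * orient a b y + x * orient a b z"
  unfolding orient_def by (simp add: algebra_simps)

lemma orient_comb: "x + y + z = 1 \<Longrightarrow>
  orient a b (x *\<^sub>R p + y *\<^sub>R q + z *\<^sub>R r) = x * orient a b p + y * orient a b q + z * orient a b r"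
proof -
  assume "x + y + z = 1" then have x: "x = 1 - y - z" by simp
  show ?thesis unfolding orient_def x by (simp add: algebra_simps)
qed

lemma line_ht_orient:
  assumes "u a < u b"
  shows "v z - line_ht a b (u z) = orient a b z / (u b - u a)"
  unfolding line_ht_def orient_def using assms by (simp add: field_simps)

lemma line_ht_orient_iff:
  assumes "u a < u b"
  shows "v z < line_ht a b (u z) \<longleftrightarrow> orient a b z < 0" "v z > line_ht a b (u z) \<longleftrightarrow> orient a b z > 0"
    "v z = line_ht a b (u z) \<longleftrightarrow> orient a b z = 0"
proof -
  have "v z - line_ht a b (u z) < 0 \<longleftrightarrow> orient a b z < 0" "v z - line_ht a b (u z) > 0 \<longleftrightarrow> orient a b z > 0"
    unfolding line_ht_orient[OF assms] using assms by (auto simp: divide_less_0_iff zero_less_divide_iff)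
  then show "v z < line_ht a b (u z) \<longleftrightarrow> orient a b z < 0" "v z > line_ht a b (u z) \<longleftrightarrow> orient a b z > 0"
    "v z = line_ht a b (u z) \<longleftrightarrow> orient a b z = 0" by linarith+
qed

text \<open>Cramer's rule: the barycentric coordinates are quotients of signed areas.\<close>

lemma barycentric:
  assumes "orient a b c \<noteq> 0"
  shows "y = (orient b c y / orient a b c) *\<^sub>R a + (orient c a y / orient a b c) *\<^sub>R b + (orient a b y / orient a b c) *\<^sub>R c"
    and "orient b c y / orient a b c + orient c a y / orient a b c + orient a b y / orient a b c = 1"
proof -
  have 1: "orient b c y + orient c a y + orient a b y = orient a b c" unfolding orient_def by (simp add: algebra_simps)
  then show "orient b c y / orient a b c + orient c a y / orient a b c + orient a b y / orient a b c = 1"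
    using assms by (simp add: add_divide_distrib[symmetric])
  have 2: "u y * orient a b c = orient b c y * u a + orient c a y * u b + orient a b y * u c"
    "v y * orient a b c = orient b c y * v a + orient c a y * v b + orient a b y * v c"
    unfolding orient_def by (simp_all add: algebra_simps)
  show "y = (orient b c y / orient a b c) *\<^sub>R a + (orient c a y / orient a b c) *\<^sub>R b + (orient a b y / orient a b c) *\<^sub>R c"
  proof (rule uv_eqI)
    have "u y = (orient b c y * u a + orient c a y * u b + orient a b y * u c) / orient a b c"
      "v y = (orient b c y * v a + orient c a y * v b + orient a b y * v c) / orient a b c"
      using assms by (simp_all add: 2[symmetric])
    then show "u y = u ((orient b c y / orient a b c) *\<^sub>R a + (orient c a y / orient a b c) *\<^sub>R b + (orient a b y / orient a b c) *\<^sub>R c)"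
      "v y = v ((orient b c y / orient a b c) *\<^sub>R a + (orient c a y / orient a b c) *\<^sub>R b + (orient a b y / orient a b c) *\<^sub>R c)"
      by (simp_all add: add_divide_distrib)
  qed
qed

lemma orient_eq_0_iff: "collinear {a, b, c} \<longleftrightarrow> orient a b c = 0"
proof
  assume "collinear {a, b, c}"
  then consider "a = c" | s where "b = s *\<^sub>R a + (1 - s) *\<^sub>R c" unfolding collinear_3_expand by blast
  then show "orient a b c = 0"
  proof cases
    case 2
    then have "orient c a b = 0" using orient_mix[of c a "1 - s" a c] by (simp add: add.commute)
    then show ?thesis by (simp add: orient_rot)
  qed simp
next
  assume 0: "orient a b c = 0"
  show "collinear {a, b, c}"
  proof (cases "a = c")
    case False
    then have "u a \<noteq> u c \<or> v a \<noteq> v c" using uv_eqI by blast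
    then have "\<exists>s. b = s *\<^sub>R a + (1 - s) *\<^sub>R c"
    proof
      assume n: "u a \<noteq> u c"
      define s where "s = (u b - u c) / (u a - u c)"
      have s: "s * (u a - u c) = u b - u c" using n by (simp add: s_def)
      have "(v b - v c) * (u a - u c) = (u b - u c) * (v a - v c)"
        using 0 unfolding orient_def by (simp add: algebra_simps)
      also have "\<dots> = (s * (v a - v c)) * (u a - u c)" unfolding s[symmetric] by simp
      finally have "v b - v c = s * (v a - v c)" using n by simp
      then have "b = s *\<^sub>R a + (1 - s) *\<^sub>R c" using s by (intro uv_eqI) (simp_all add: algebra_simps)
      then show ?thesis ..
    next
      assume n: "v a \<noteq> v c"
      define s where "s = (v b - v c) / (v a - v c)"
      have s: "s * (v a - v c) = v b - v c" using n by (simp add: s_def)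
      have "(u b - u c) * (v a - v c) = (v b - v c) * (u a - u c)"
        using 0 unfolding orient_def by (simp add: algebra_simps)
      also have "\<dots> = (s * (u a - u c)) * (v a - v c)" unfolding s[symmetric] by simp
      finally have "u b - u c = s * (u a - u c)" using n by simp
      then have "b = s *\<^sub>R a + (1 - s) *\<^sub>R c" using s by (intro uv_eqI) (simp_all add: algebra_simps)
      then show ?thesis ..
    qed
    then show ?thesis unfolding collinear_3_expand by blast
  qed (simp add: collinear_3_expand)
qed

lemma orient_comb_coords:
  assumes "x + y + z = 1"
  shows "orient a b (x *\<^sub>R a + y *\<^sub>R b + z *\<^sub>R c) = z * orient a b c"
    "orient b c (x *\<^sub>R a + y *\<^sub>R b + z *\<^sub>R c) = x * orient a b c"
    "orient c a (x *\<^sub>R a + y *\<^sub>R b + z *\<^sub>R c) = y * orient a b c"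
  unfolding orient_comb[OF assms] by (simp_all add: orient_rot)

text \<open>The quotients are the barycentric coordinates of \<open>w\<close>; dividing by
  \<open>orient a b c\<close> treats both orientations of the triangle at once.\<close>

lemma interior_triangle_iff:
  assumes "orient a b c \<noteq> 0"
  shows "w \<in> interior (convex hull {a, b, c}) \<longleftrightarrow>
    0 < orient a b w / orient a b c \<and> 0 < orient b c w / orient a b c \<and> 0 < orient c a w / orient a b c"
proof -
  have eq: "interior (convex hull {a, b, c}) =
      {w. \<exists>x y z. 0 < x \<and> 0 < y \<and> 0 < z \<and> x + y + z = 1 \<and> x *\<^sub>R a + y *\<^sub>R b + z *\<^sub>R c = w}"
    using interior_convex_hull_3_minimal[of a b c] assms orient_eq_0_iff by simp
  show ?thesis unfolding eq
  proof safe
    fix x y z :: real assume *: "0 < x" "0 < y" "0 < z" "x + y + z = 1"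
    note C = orient_comb_coords[OF *(4)]
    show "0 < orient a b (x *\<^sub>R a + y *\<^sub>R b + z *\<^sub>R c) / orient a b c"
      "0 < orient b c (x *\<^sub>R a + y *\<^sub>R b + z *\<^sub>R c) / orient a b c"
      "0 < orient c a (x *\<^sub>R a + y *\<^sub>R b + z *\<^sub>R c) / orient a b c"
      unfolding C using * assms by simp_all
  next
    assume *: "0 < orient a b w / orient a b c" "0 < orient b c w / orient a b c" "0 < orient c a w / orient a b c"
    show "\<exists>x y z. 0 < x \<and> 0 < y \<and> 0 < z \<and> x + y + z = 1 \<and> x *\<^sub>R a + y *\<^sub>R b + z *\<^sub>R c = w"
      using * barycentric[OF assms, of w]
      by (intro exI[of _ "orient b c w / orient a b c"] exI[of _ "orient c a w / orient a b c"] exI[of _ "orient a b w / orient a b c"]) simp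
  qed
qed

lemma triangle_iff:
  assumes "orient a b c \<noteq> 0"
  shows "w \<in> convex hull {a, b, c} \<longleftrightarrow>
    0 \<le> orient a b w / orient a b c \<and> 0 \<le> orient b c w / orient a b c \<and> 0 \<le> orient c a w / orient a b c"
proof
  assume "w \<in> convex hull {a, b, c}"
  then obtain x y z where *: "0 \<le> x" "0 \<le> y" "0 \<le> z" "x + y + z = 1" "w = x *\<^sub>R a + y *\<^sub>R b + z *\<^sub>R c"
    unfolding convex_hull_3 by auto
  show "0 \<le> orient a b w / orient a b c \<and> 0 \<le> orient b c w / orient a b c \<and> 0 \<le> orient c a w / orient a b c"
    unfolding *(5) orient_comb_coords[OF *(4)] using * assms by simp
next
  assume *: "0 \<le> orient a b w / orient a b c \<and> 0 \<le> orient b c w / orient a b c \<and> 0 \<le> orient c a w / orient a b c"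
  show "w \<in> convex hull {a, b, c}" unfolding convex_hull_3 mem_Collect_eq
    using * barycentric[OF assms, of w]
    by (intro exI[of _ "orient b c w / orient a b c"] exI[of _ "orient c a w / orient a b c"] exI[of _ "orient a b w / orient a b c"]) blast
qed

section \<open>The empty triangle on a side of an edge\<close>

definition visible_below :: "edge_set \<Rightarrow> complex \<Rightarrow> complex \<Rightarrow> complex \<Rightarrow> bool" where
  "visible_below E a b m \<longleftrightarrow> m \<in> P \<and> u a < u m \<and> u m < u b \<and> v m < line_ht a b (u m) \<and>
     (\<forall>w\<in>cov E \<union> P. u w = u m \<longrightarrow> \<not> (v m < v w \<and> v w < line_ht a b (u m)))"

definition visible_above :: "edge_set \<Rightarrow> complex \<Rightarrow> complex \<Rightarrow> complex \<Rightarrow> bool" where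
  "visible_above E a b m \<longleftrightarrow> m \<in> P \<and> u a < u m \<and> u m < u b \<and> v m > line_ht a b (u m) \<and>
     (\<forall>w\<in>cov E \<union> P. u w = u m \<longrightarrow> \<not> (v m > v w \<and> v w > line_ht a b (u m)))"

lemma mirror_visible_below: "sweep_frame.visible_below u (\<lambda>z. - v z) P E a b m \<longleftrightarrow> visible_above E a b m"
  unfolding sweep_frame.visible_below_def[OF mirror] visible_above_def mirror_line_ht neg_less_iff_less by blast

text \<open>Anything hiding \<open>m\<close> from \<open>a b\<close> would lie on an edge
  \<open>g h\<close> between \<open>e f\<close> and \<open>a b\<close>. By \<open>free\<close> no
  vertex lies between those two edges over the inside of the span of \<open>e f\<close>, so
  \<open>g h\<close> would continue to the column at t and contradict \<open>clear\<close>.\<close>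

lemma visible_end:
  assumes E: "max_noncrossing E" and ab: "(a, b) \<in> E" "u a < t" "t < u b"
    and ef: "(e, f) \<in> E" "u e < t" "t < u f"
    and lt: "line_ht e f t < line_ht a b t"
    and clear: "\<And>w. w \<in> cov E \<union> P \<Longrightarrow> u w = t \<Longrightarrow> \<not> (line_ht e f t < v w \<and> v w < line_ht a b t)"
    and short: "u a \<le> u e" "u f \<le> u b"
    and free: "\<And>p. p \<in> P \<Longrightarrow> u e < u p \<Longrightarrow> u p < u f \<Longrightarrow> \<not> (line_ht e f (u p) \<le> v p \<and> v p \<le> line_ht a b (u p))"
    and m: "m = e \<or> m = f" "m \<noteq> a" "m \<noteq> b"
  shows "visible_below E a b m"
proof -
  have uab: "u a < u b" and uef: "u e < u f" using ab ef by auto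
  have aP: "a \<in> P" "b \<in> P" and eP: "e \<in> P" "f \<in> P" using noncrossing_P[OF E ab(1)] noncrossing_P[OF E ef(1)] by auto
  have mP: "m \<in> P" using m eP by auto
  have um: "u a < u m" "u m < u b" "u e \<le> u m" "u m \<le> u f"
    using m short uef P_eqI[OF mP aP(1)] P_eqI[OF mP aP(2)] by auto (metis less_eq_real_def order_less_le_trans)+
  have vm: "v m = line_ht e f (u m)" using m uef by auto
  have "line_ht e f (u m) \<le> line_ht a b (u m)"
    using edges_order(1)[OF E ab(1) uab ef(1) uef _ _ _ _ _ _ um(3,4) lt] ab ef um by simp
  then have lm: "v m < line_ht a b (u m)" using edge_P[OF E ab(1) uab mP um(1,2)] vm by simp
  have False if w: "w \<in> cov E \<union> P" "u w = u m" "v m < v w" "v w < line_ht a b (u m)" for w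
  proof -
    have "w \<in> cov E" using w P_eqI[OF _ mP] by auto
    then obtain g h where gh: "(g, h) \<in> E" "u g < u h" "u g \<le> u w" "u w \<le> u h" "v w = line_ht g h (u w)"
      using cov_edge[OF E] by metis
    have gP: "g \<in> P" "h \<in> P" using noncrossing_P[OF E gh(1)] by auto
    have "u g \<noteq> u m" using P_eqI[OF gP(1) mP] gh w by auto
    moreover have "u h \<noteq> u m" using P_eqI[OF gP(2) mP] gh w by auto
    ultimately have um': "u g < u m" "u m < u h" using gh w by auto
    have l1: "line_ht e f (u m) < line_ht g h (u m)" and l2: "line_ht g h (u m) < line_ht a b (u m)"
      using gh(5) w vm by auto
    have O1: "line_ht e f s \<le> line_ht g h s" "u e < s \<and> s < u f \<Longrightarrow> line_ht e f s < line_ht g h s"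
      if "u g \<le> s" "s \<le> u h" "u e \<le> s" "s \<le> u f" for s
      using edges_order[OF E gh(1,2) ef(1) uef _ _ um(3,4) that l1] um' by auto
    have O2: "line_ht g h s \<le> line_ht a b s" "u a < s \<and> s < u b \<Longrightarrow> line_ht g h s < line_ht a b s"
      if "u g \<le> s" "s \<le> u h" "u a \<le> s" "s \<le> u b" for s
      using edges_order[OF E ab(1) uab gh(1,2) _ _ _ _ that(3,4,1,2) l2] um' um by auto
    have notin: False if q: "q = g \<or> q = h" "u e < u q" "u q < u f" for q
    proof -
      have "v q = line_ht g h (u q)" "u g \<le> u q" "u q \<le> u h" "q \<in> P" using q gh(2) gP by auto
      then show False using free[of q] q O1(1)[of "u q"] O2(1)[of "u q"] short by auto
    qed
    have "u g < t \<and> t < u h"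
      using m(1)
    proof
      assume "m = e"
      then have "\<not> u h < u f" using notin[of h] um' by auto
      then show ?thesis using ef um' \<open>m = e\<close> by auto
    next
      assume "m = f"
      then have "\<not> u e < u g" using notin[of g] um' by auto
      then show ?thesis using ef um' \<open>m = f\<close> by auto
    qed
    then have "line_ht e f t < line_ht g h t" "line_ht g h t < line_ht a b t" "pt t (line_ht g h t) \<in> cov E"
      using O1(2)[of t] O2(2)[of t] ab ef cov_pt[OF gh(1,2), of t] by auto
    then show False using clear[of "pt t (line_ht g h t)"] by simp
  qed
  then show ?thesis unfolding visible_below_def using mP um lm by blast
qed


lemma line_ht_mult: "u e \<noteq> u f \<Longrightarrow> line_ht e f s * (u f - u e) = v e * (u f - s) + v f * (s - u e)"
  unfolding line_ht_def by (simp add: field_simps)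

lemma gap_lin:
  assumes "u e \<noteq> u f"
  shows "(line_ht a b s - line_ht e f s) * (u f - u e) =
    (line_ht a b (u e) - v e) * (u f - s) + (line_ht a b (u f) - v f) * (s - u e)"
proof -
  obtain m k where 1: "\<And>t. line_ht a b t = m * t + k" using line_ht_affine by blast
  show ?thesis using line_ht_mult[OF assms, of s] unfolding 1 by (simp add: algebra_simps)
qed

lemma interior_u_range:
  assumes "orient a m b \<noteq> 0" "u a < u m" "u m < u b" "y \<in> interior (convex hull {a, m, b})"
  shows "u a < u y \<and> u y < u b"
proof -
  have "y \<in> {w. \<exists>r s t. 0 < r \<and> 0 < s \<and> 0 < t \<and> r + s + t = 1 \<and> r *\<^sub>R a + s *\<^sub>R m + t *\<^sub>R b = w}"
    using assms(4) interior_convex_hull_3_minimal[of a m b] assms(1) orient_eq_0_iff by simp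
  then obtain r s t where *: "0 < r" "0 < s" "0 < t" "r + s + t = 1" "y = r *\<^sub>R a + s *\<^sub>R m + t *\<^sub>R b"
    by blast
  have r: "r = 1 - s - t" and t: "t = 1 - r - s" using *(4) by auto
  have "u y - u a = s * (u m - u a) + t * (u b - u a)" unfolding *(5) r by (simp add: algebra_simps)
  moreover have "u b - u y = r * (u b - u a) + s * (u b - u m)" unfolding *(5) t by (simp add: algebra_simps)
  moreover have "s * (u m - u a) > 0" "t * (u b - u a) > 0" "r * (u b - u a) > 0" "s * (u b - u m) > 0"
    using * assms(2,3) by (auto intro!: mult_pos_pos)
  ultimately show ?thesis by linarith
qed

text \<open>The apex is the visible point with the smallest vertical gap to a b.\<close>
lemma long_edge:
  assumes E: "max_noncrossing E" and ab: "(a, b) \<in> E" and uab: "u a < u b" and ex: "visible_below E a b m0"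
  shows "\<exists>m. u a < u m \<and> u m < u b \<and> v m < line_ht a b (u m) \<and> empty_triangle E a m b"
proof -
  define gap where "gap q = line_ht a b (u q) - v q" for q
  let ?B = "{m. visible_below E a b m}"
  have "finite ?B"
    by (rule finite_subset[OF _ P_fin[of "u a" "u b"]]) (auto simp: visible_below_def)
  then have fin: "finite (gap ` ?B)" "gap ` ?B \<noteq> {}" using ex by auto
  obtain m where mB: "visible_below E a b m" and "gap m = Min (gap ` ?B)" using Min_in[OF fin] by force
  then have mmin: "gap m \<le> gap q" if "visible_below E a b q" for q using Min_le[OF fin(1)] that by auto
  have m: "m \<in> P" "u a < u m" "u m < u b" "v m < line_ht a b (u m)"
    and mclear: "\<And>w. w \<in> cov E \<union> P \<Longrightarrow> u w = u m \<Longrightarrow> \<not> (v m < v w \<and> v w < line_ht a b (u m))"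
    using mB unfolding visible_below_def by blast+
  have aP: "a \<in> P" "b \<in> P" "W a b" using noncrossing_P[OF E ab] by auto
  have g0: "gap a = 0" "gap b = 0" "gap m > 0" using uab m by (auto simp: gap_def)
  have glin: "(line_ht a b s - line_ht e f s) * (u f - u e) = gap e * (u f - s) + gap f * (s - u e)"
    if "u e \<noteq> u f" for e f s
    using gap_lin[OF that] unfolding gap_def .
  \<comment> \<open>Apart from \<open>m\<close>, the part of the triangle \<open>a m b\<close> below
    \<open>a b\<close> meets \<open>cov E\<close> only in the sides \<open>a m\<close> and
    \<open>m b\<close>. Let w be the highest point below \<open>a b\<close> in the column of y. Its
    gap is smaller than that of \<open>m\<close>, so it is no vertex but lies on an edge
    \<open>e f\<close>, each of whose ends is visible or one of \<open>a\<close>, \<open>b\<close>.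
    The gap is affine along \<open>e f\<close>, so two visible ends would make it too large at w;
    with one end at \<open>a\<close> or \<open>b\<close>, comparing slopes leaves only
    \<open>a m\<close> or \<open>m b\<close>.\<close>
  have claim: "((a, m) \<in> E \<and> y \<in> closed_segment a m) \<or> ((m, b) \<in> E \<and> y \<in> closed_segment m b)"
    if y: "y \<in> cov E" "u a < u y" "u y < u b" "v y < line_ht a b (u y)" "y \<noteq> m"
      and ya: "u y \<le> u m \<Longrightarrow> line_ht a m (u y) \<le> v y" and yb: "u m \<le> u y \<Longrightarrow> line_ht m b (u y) \<le> v y" for y
  proof -
    define t where "t = u y"
    obtain w where w: "w \<in> cov E \<union> P" "u w = t" "v w < line_ht a b t" "v y \<le> v w"
      and wmax: "\<forall>w' \<in> cov E \<union> P. u w' = t \<longrightarrow> v w' < line_ht a b t \<longrightarrow> v w' \<le> v w"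
      using highest_below[OF E, of y t "line_ht a b t"] y t_def by blast
    have t: "u a < t" "t < u b" using y t_def by auto
    have wa: "line_ht a m t \<le> v w" if "t \<le> u m" using ya that w t_def by auto
    have wb: "line_ht m b t \<le> v w" if "u m \<le> t" using yb that w t_def by auto
    have wclear: "\<not> (v w < v w' \<and> v w' < line_ht a b t)" if "w' \<in> cov E \<union> P" "u w' = t" for w'
      using wmax that by force
    have ga: "(line_ht a b t - line_ht a m t) * (u m - u a) = gap m * (t - u a)" using glin[of a m t] g0 m by simp
    have gb: "(line_ht a b t - line_ht m b t) * (u b - u m) = gap m * (u b - t)" using glin[of m b t] g0 m by simp
    have wm: "w \<noteq> m"
    proof
      assume "w = m"
      then have "u y = u m" and "v y \<le> v m" using w t_def by auto
      moreover have "line_ht a m (u y) = v m" using \<open>u y = u m\<close> m by simp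
      ultimately have "v y = v m" using ya by linarith
      then show False using y(5) uv_eqI[OF \<open>u y = u m\<close>] by blast
    qed
    have small: "gap w < gap m"
    proof -
      consider "t < u m" | "t = u m" | "t > u m" by linarith
      then show ?thesis
      proof cases
        case 1
        then have "(line_ht a b t - line_ht a m t) * (u m - u a) < gap m * (u m - u a)"
          unfolding ga using g0 by simp
        then have "line_ht a b t - line_ht a m t < gap m" using m(2) by (simp add: mult_less_cancel_right_pos)
        then show ?thesis using wa 1 w(2) unfolding gap_def by simp
      next
        case 2
        then have "v m \<le> v w" using wa m by simp
        moreover have "v w \<noteq> v m" using wm uv_eqI[of w m] 2 w(2) by auto
        ultimately have "v m < v w" by simp
        then show ?thesis using 2 w(2) unfolding gap_def by simp
      next
        case 3
        then have "(line_ht a b t - line_ht m b t) * (u b - u m) < gap m * (u b - u m)"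
          unfolding gb using g0 by simp
        then have "line_ht a b t - line_ht m b t < gap m" using m(3) by (simp add: mult_less_cancel_right_pos)
        then show ?thesis using wb 3 w(2) unfolding gap_def by simp
      qed
    qed
    have wP: "w \<notin> P"
    proof
      assume "w \<in> P"
      then have "visible_below E a b w" unfolding visible_below_def using w wclear t by auto
      then show False using mmin small by fastforce
    qed
    then have "w \<in> cov E" using w by blast
    then obtain e f where ef: "(e, f) \<in> E" "u e < u f" "u e \<le> t" "t \<le> u f" "v w = line_ht e f t"
      using cov_edge[OF E] w(2) by metis
    have eP: "e \<in> P" "f \<in> P" using noncrossing_P[OF E ef(1)] by auto
    have "u e \<noteq> t"
    proof
      assume "u e = t"
      then have "v w = v e" using ef(5) by (metis line_ht_ends(1))
      then show False using wP eP uv_eqI[of w e] w(2) \<open>u e = t\<close> by metis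
    qed
    moreover have "u f \<noteq> t"
    proof
      assume "u f = t"
      then have "v w = v f" using ef(2,5) by (metis line_ht_ends(2) less_irrefl)
      then show False using wP eP uv_eqI[of w f] w(2) \<open>u f = t\<close> by metis
    qed
    ultimately have t': "u e < t" "t < u f" using ef by auto
    have lt: "line_ht e f t < line_ht a b t" using w ef by simp
    have clear: "\<not> (line_ht e f t < v w' \<and> v w' < line_ht a b t)" if "w' \<in> cov E \<union> P" "u w' = t" for w'
      using wclear[OF that] ef by simp
    \<comment> \<open>By \<open>free\<close> the edge would run above \<open>m\<close> in the column
      of \<open>m\<close>, and so hide \<open>m\<close> from \<open>a b\<close>.\<close>
    have passes: False if "u e < u m" "u m < u f"
      and free: "\<not> (line_ht e f (u m) \<le> v m \<and> v m \<le> line_ht a b (u m))"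
    proof -
      have "line_ht e f (u m) < line_ht a b (u m)"
        using edges_order(2)[OF E ab uab ef(1,2) _ _ _ _ _ _ _ _ lt, of "u m"] that t t' m by simp
      then show False using mclear[of "pt (u m) (line_ht e f (u m))"] free m that cov_pt[OF ef(1,2), of "u m"] by simp
    qed
    show ?thesis
      using adjacent_edges[OF E ab t ef(1) t' lt clear]
    proof
      assume *: "u e \<le> u a \<and> u b \<le> u f \<and>
        (\<forall>p\<in>P. u a < u p \<and> u p < u b \<longrightarrow> \<not> (line_ht e f (u p) \<le> v p \<and> v p \<le> line_ht a b (u p)))"
      then show ?thesis using passes m by force
    next
      assume "u a \<le> u e \<and> u f \<le> u b \<and>
        (\<forall>p\<in>P. u e < u p \<and> u p < u f \<longrightarrow> \<not> (line_ht e f (u p) \<le> v p \<and> v p \<le> line_ht a b (u p)))"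
      then have short: "u a \<le> u e" "u f \<le> u b"
        and free: "\<And>p. p \<in> P \<Longrightarrow> u e < u p \<Longrightarrow> u p < u f \<Longrightarrow> \<not> (line_ht e f (u p) \<le> v p \<and> v p \<le> line_ht a b (u p))"
        by blast+
      note vis = visible_end[OF E ab t ef(1) t' lt clear short free]
      have nab: "e \<noteq> b" "f \<noteq> a" using short ef t t' by auto
      have ge: "gap m \<le> gap e" if "e \<noteq> a" using vis[of e] mmin[of e] that nab by auto
      have gf: "gap m \<le> gap f" if "f \<noteq> b" using vis[of f] mmin[of f] that nab by auto
      have gw: "gap w * (u f - u e) = gap e * (u f - t) + gap f * (t - u e)"
        using glin[of e f t] ef w(2) unfolding gap_def by simp
      consider "e \<noteq> a" "f \<noteq> b" | "e = a" "f = b" | "e = a" "f \<noteq> b" | "e \<noteq> a" "f = b" by blast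
      then show ?thesis
      proof cases
        case 1
        have "gap m * (u f - t) \<le> gap e * (u f - t)" "gap m * (t - u e) \<le> gap f * (t - u e)"
          using ge gf 1 t' by (auto intro!: mult_right_mono)
        then have "gap m * (u f - u e) \<le> gap w * (u f - u e)" unfolding gw by (simp add: algebra_simps)
        then show ?thesis using small ef(2) by (simp add: mult_le_cancel_right)
      next
        case 2
        then show ?thesis using lt by simp
      next
        case 3
        have "\<not> u m < u f" using passes free[OF m(1)] m 3 by blast
        then have fm: "u f \<le> u m" by simp
        have tm: "t \<le> u m" using fm t' by simp
        \<comment> \<open>Along \<open>a f\<close> the gap grows from 0 to at least
          \<open>gap m\<close>. Since w is not below \<open>a m\<close>, the gap at w is at most the
          one along \<open>a m\<close>. With u f \<le> u m this is possible only for f = m.\<close>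
        have "gap w * (u m - u a) \<le> gap m * (t - u a)"
          unfolding ga[symmetric] using wa[OF tm] w(2) m(2) unfolding gap_def by (intro mult_right_mono) auto
        moreover have "gap w * (u f - u a) \<ge> gap m * (t - u a)"
          using gw 3 g0 gf t by (simp add: mult_right_mono)
        ultimately have "gap w * (u m - u a) \<le> gap w * (u f - u a)" by simp
        moreover have "gap w > 0" using w unfolding gap_def by simp
        ultimately have "u m = u f" using fm by (simp add: mult_le_cancel_left)
        then have "f = m" using P_eqI eP m by metis
        moreover have "y = w"
        proof (rule uv_eqI)
          show "u y = u w" using w(2) t_def by simp
          have "line_ht a m t = v w" using ef 3 \<open>f = m\<close> by simp
          then show "v y = v w" using ya[unfolded t_def[symmetric], OF tm] w(4) by simp
        qed
        ultimately show ?thesis using ef 3 w(2) in_seg_iff[OF ef(2), of w] by auto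
      next
        case 4
        have "\<not> u e < u m" using passes free[OF m(1)] m 4 by blast
        then have em: "u m \<le> u e" by simp
        have tm: "u m \<le> t" using em t' by simp
        have "gap w * (u b - u m) \<le> gap m * (u b - t)"
          unfolding gb[symmetric] using wb[OF tm] w(2) m(3) unfolding gap_def by (intro mult_right_mono) auto
        moreover have "gap w * (u b - u e) \<ge> gap m * (u b - t)"
          using gw 4 g0 ge t by (simp add: mult_right_mono)
        ultimately have "gap w * (u b - u m) \<le> gap w * (u b - u e)" by simp
        moreover have "gap w > 0" using w unfolding gap_def by simp
        ultimately have "u m = u e" using em by (simp add: mult_le_cancel_left)
        then have "e = m" using P_eqI eP m by metis
        moreover have "y = w"
        proof (rule uv_eqI)
          show "u y = u w" using w(2) t_def by simp
          have "line_ht m b t = v w" using ef 4 \<open>e = m\<close> by simp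
          then show "v y = v w" using yb[unfolded t_def[symmetric], OF tm] w(4) by simp
        qed
        ultimately show ?thesis using ef 4 w(2) in_seg_iff[OF ef(2), of w] by auto
      qed
    qed
  qed
  have under: "line_ht a m s < line_ht a b s" if "u a < s" "s \<le> u m" for s
    using line_ht_less[of "u a" s "u m" a m a b] that m by auto
  have under': "line_ht m b s < line_ht a b s" if "u m \<le> s" "s < u b" for s
    using line_ht_less[of "u m" s "u b" m b a b] that m by auto
  have am: "(a, m) \<in> E"
  proof (rule ccontr)
    assume n: "(a, m) \<notin> E"
    have no: "y = a \<or> y = m" if y: "y \<in> cov E" "y \<in> closed_segment a m" for y
    proof (rule ccontr)
      assume ne: "\<not> ?thesis"
      have y': "u a \<le> u y" "u y \<le> u m" "v y = line_ht a m (u y)" using y in_seg_iff[OF m(2)] by auto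
      have "u y \<noteq> u a" "u y \<noteq> u m" using y' ne uv_eqI[of y a] uv_eqI[of y m] m by auto
      then have y'': "u a < u y" "u y < u m" using y' by auto
      have "y \<in> closed_segment m b"
        using claim[of y] y(1) y' y'' under[of "u y"] m ne n by auto
      then show False using y'' in_seg_iff[OF m(3)] by auto
    qed
    have "y = a \<or> y = m" if y: "y \<in> closed_segment a m" "y \<in> P" for y
    proof (cases "u a < u y")
      case True
      moreover have "u y < u b" using y in_seg_iff[OF m(2)] m by auto
      \<comment> \<open>\<open>no\<close> speaks of points on edges; a vertex on \<open>a m\<close>
        comes under it because a vertex below an edge is never isolated.\<close>
      ultimately have "y \<in> cov E" using covered_under_edge[OF E ab _ _ y(2)] by blast
      then show ?thesis using no[OF _ y(1)] by blast
    next
      case False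
      then show ?thesis using P_eqI[OF y(2) aP(1)] y in_seg_iff[OF m(2)] by auto
    qed
    then have "admissible a m" unfolding admissible_def using aP m W_mono[OF aP(1,2) aP(1) m(1) aP(3)] by auto
    from noncrossing_max[OF E this n] obtain c d z where
      "(c, d) \<in> E" "z \<in> closed_segment a m" "z \<in> closed_segment c d" "z \<notin> P" by blast
    then show False using no[of z] covI[of c d E z] aP m by auto
  qed
  have mb: "(m, b) \<in> E"
  proof (rule ccontr)
    assume n: "(m, b) \<notin> E"
    have no: "y = b \<or> y = m" if y: "y \<in> cov E" "y \<in> closed_segment m b" for y
    proof (rule ccontr)
      assume ne: "\<not> ?thesis"
      have y': "u m \<le> u y" "u y \<le> u b" "v y = line_ht m b (u y)" using y in_seg_iff[OF m(3)] by auto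
      have "u y \<noteq> u b" "u y \<noteq> u m" using y' ne uv_eqI[of y b] uv_eqI[of y m] m by auto
      then have y'': "u m < u y" "u y < u b" using y' by auto
      have "y \<in> closed_segment a m"
        using claim[of y] y(1) y' y'' under'[of "u y"] m ne n by auto
      then show False using y'' in_seg_iff[OF m(2)] by auto
    qed
    have "y = m \<or> y = b" if y: "y \<in> closed_segment m b" "y \<in> P" for y
    proof (cases "u y < u b")
      case True
      moreover have "u a < u y" using y in_seg_iff[OF m(3)] m by auto
      ultimately have "y \<in> cov E" using covered_under_edge[OF E ab _ _ y(2)] by blast
      then show ?thesis using no[OF _ y(1)] by blast
    next
      case False
      then show ?thesis using P_eqI[OF y(2) aP(2)] y in_seg_iff[OF m(3)] by auto
    qed
    then have "admissible m b" unfolding admissible_def using aP m W_mono[OF aP(1,2) m(1) aP(2) aP(3)] by auto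
    from noncrossing_max[OF E this n] obtain c d z where
      "(c, d) \<in> E" "z \<in> closed_segment m b" "z \<in> closed_segment c d" "z \<notin> P" by blast
    then show False using no[of z] covI[of c d E z] aP m by auto
  qed
  have neg: "orient a b m < 0" using line_ht_orient_iff(1)[OF uab] m by blast
  then have pos: "orient a m b > 0" unfolding orient_def by (simp add: algebra_simps)
  have "interior (convex hull {a, m, b}) \<inter> cov E = {}"
  proof (rule ccontr)
    assume "\<not> ?thesis"
    then obtain y where y: "y \<in> interior (convex hull {a, m, b})" "y \<in> cov E" by blast
    then have c: "0 < orient a m y" "0 < orient m b y" "0 < orient b a y"
      using interior_triangle_iff[of a m b y] pos by (auto simp: zero_less_divide_iff)
    then have 1: "v y > line_ht a m (u y)" "v y > line_ht m b (u y)" "v y < line_ht a b (u y)"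
      using line_ht_orient_iff m uab orient_swap[of b a y] by auto
    have "u a < u y \<and> u y < u b" using interior_u_range[OF _ m(2,3) y(1)] pos by simp
    moreover have "y \<noteq> m" using c by auto
    ultimately have "y \<in> closed_segment a m \<or> y \<in> closed_segment m b"
      using claim[of y] y 1 by auto
    then show False using 1 in_seg_iff m by fastforce
  qed
  moreover have "\<not> collinear {a, m, b}" using orient_eq_0_iff pos by auto
  ultimately have "empty_triangle E a m b" unfolding empty_triangle_def using am mb ab by blast
  then show ?thesis using m by blast
qed


lemma empty_triangle_perm:
  assumes "max_noncrossing E" "empty_triangle E p q r"
  shows "empty_triangle E q p r" "empty_triangle E q r p" "empty_triangle E p r q"
  using assms(2) noncrossing_sym[OF assms(1)] unfolding empty_triangle_def
  by (auto simp: insert_commute)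

lemma mirror_below: "sweep_frame.below u (\<lambda>z. - v z) P E a b \<longleftrightarrow> above E a b"
  unfolding sweep_frame.below_def[OF mirror] above_def mirror_line_ht neg_less_iff_less ..

lemma long_edge_above:
  assumes E: "max_noncrossing E" and ef: "(e, f) \<in> E" "u e < u f" and vis: "visible_above E e f m0"
  shows "\<exists>m. u e < u m \<and> u m < u f \<and> v m > line_ht e f (u m) \<and> empty_triangle E e m f"
  using sweep_frame.long_edge[OF mirror E ef, unfolded mirror_visible_below, OF vis] unfolding mirror_line_ht by simp

text \<open>Let w be the highest point of \<open>cov E\<close> or \<open>P\<close> below
  \<open>a b\<close> in some column. If w is a vertex, it is visible and \<open>long_edge\<close>
  applies. Otherwise w is on an edge \<open>e f\<close>, and by \<open>adjacent_edges\<close> one of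
  the two edges spans the other. If \<open>e f\<close> is the shorter one, one of its ends is
  visible from \<open>a b\<close>. If \<open>a b\<close> is, one of its ends is visible from
  \<open>e f\<close>; the triangle then found above \<open>e f\<close> must have \<open>a b\<close>
  as a side, because nothing separates the two edges in this column.\<close>

lemma empty_triangle_below:
  assumes E: "max_noncrossing E" and ab: "(a, b) \<in> E" and uab: "u a < u b" and bel: "below E a b"
  shows "\<exists>c. v c < line_ht a b (u c) \<and> empty_triangle E a b c"
proof -
  have long: ?thesis if "visible_below E a b m" for m
    using long_edge[OF E ab uab that] empty_triangle_perm(3)[OF E] by blast
  obtain w0 where w0: "w0 \<in> cov E \<union> P" "u a < u w0" "u w0 < u b" "v w0 < line_ht a b (u w0)"
    using bel unfolding below_def by blast
  define t where "t = u w0"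
  have t: "u a < t" "t < u b" using w0 t_def by auto
  obtain w where w: "w \<in> cov E \<union> P" "u w = t" "v w < line_ht a b t"
    and wmax: "\<forall>w' \<in> cov E \<union> P. u w' = t \<longrightarrow> v w' < line_ht a b t \<longrightarrow> v w' \<le> v w"
    using highest_below[OF E w0(1), of t "line_ht a b t"] w0(4) t_def by blast
  have wclear: "\<not> (v w < v w' \<and> v w' < line_ht a b t)" if "w' \<in> cov E \<union> P" "u w' = t" for w'
    using wmax that by force
  show ?thesis
  proof (cases "w \<in> P")
    case True
    then have "visible_below E a b w" unfolding visible_below_def using w wclear t by auto
    then show ?thesis by (rule long)
  next
    case False
    then have "w \<in> cov E" using w by blast
    then obtain e f where ef: "(e, f) \<in> E" "u e < u f" "u e \<le> t" "t \<le> u f" "v w = line_ht e f t"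
      using cov_edge[OF E] w(2) by metis
    have eP: "e \<in> P" "f \<in> P" using noncrossing_P[OF E ef(1)] by auto
    have aP: "a \<in> P" "b \<in> P" using noncrossing_P[OF E ab] by auto
    have "u e \<noteq> t"
    proof
      assume "u e = t"
      then have "v w = v e" using ef(5) by (metis line_ht_ends(1))
      then show False using False eP uv_eqI[of w e] w(2) \<open>u e = t\<close> by metis
    qed
    moreover have "u f \<noteq> t"
    proof
      assume "u f = t"
      then have "v w = v f" using ef(2,5) by (metis line_ht_ends(2) less_irrefl)
      then show False using False eP uv_eqI[of w f] w(2) \<open>u f = t\<close> by metis
    qed
    ultimately have t': "u e < t" "t < u f" using ef by auto
    have lt: "line_ht e f t < line_ht a b t" using w ef by simp
    have clear: "\<not> (line_ht e f t < v w' \<and> v w' < line_ht a b t)" if "w' \<in> cov E \<union> P" "u w' = t" for w'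
      using wclear[OF that] ef by simp
    have ne: "\<not> (e = a \<and> f = b)" using lt by auto
    show ?thesis
      using adjacent_edges[OF E ab t ef(1) t' lt clear]
    proof
      assume "u a \<le> u e \<and> u f \<le> u b \<and>
        (\<forall>p\<in>P. u e < u p \<and> u p < u f \<longrightarrow> \<not> (line_ht e f (u p) \<le> v p \<and> v p \<le> line_ht a b (u p)))"
      then have short: "u a \<le> u e" "u f \<le> u b"
        and free: "\<And>p. p \<in> P \<Longrightarrow> u e < u p \<Longrightarrow> u p < u f \<Longrightarrow> \<not> (line_ht e f (u p) \<le> v p \<and> v p \<le> line_ht a b (u p))"
        by blast+
      note vis = visible_end[OF E ab t ef(1) t' lt clear short free]
      have "e \<noteq> b" "f \<noteq> a" using short ef t t' by auto
      then have "visible_below E a b e \<or> visible_below E a b f" using vis[of e] vis[of f] ne by blast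
      then show ?thesis using long by blast
    next
      assume "u e \<le> u a \<and> u b \<le> u f \<and>
        (\<forall>p\<in>P. u a < u p \<and> u p < u b \<longrightarrow> \<not> (line_ht e f (u p) \<le> v p \<and> v p \<le> line_ht a b (u p)))"
      then have short: "u e \<le> u a" "u b \<le> u f"
        and free: "\<And>p. p \<in> P \<Longrightarrow> u a < u p \<Longrightarrow> u p < u b \<Longrightarrow> \<not> (- line_ht a b (u p) \<le> - v p \<and> - v p \<le> - line_ht e f (u p))"
        by auto
      have mlt: "- line_ht a b t < - line_ht e f t" using lt by simp
      have mclear: "\<not> (- line_ht a b t < - v w' \<and> - v w' < - line_ht e f t)" if "w' \<in> cov E \<union> P" "u w' = t" for w'
        using clear[OF that] by auto
      note vis = sweep_frame.visible_end[OF mirror E ef(1) t' ab t, unfolded mirror_line_ht mirror_visible_below,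
          OF mlt mclear short free]
      have "a \<noteq> f" "b \<noteq> e" using short ef t t' by auto
      then have "visible_above E e f a \<or> visible_above E e f b" using vis[of a] vis[of b] ne by blast
      then obtain m where m: "u e < u m" "u m < u f" "v m > line_ht e f (u m)" and T: "empty_triangle E e m f"
        using long_edge_above[OF E ef(1,2)] by blast
      have em: "(e, m) \<in> E" "(m, f) \<in> E" using T unfolding empty_triangle_def by auto
      have pos: "orient e f m > 0" using line_ht_orient_iff(2)[OF ef(2)] m by blast
      have neg: "orient e m f < 0" using pos unfolding orient_def by (simp add: algebra_simps)
      define y where "y = pt t (line_ht a b t)"
      have y: "y \<in> cov E" "u y = t" "v y = line_ht a b t" using cov_pt[OF ab uab] t by (simp_all add: y_def)
      have fe: "orient f e y < 0" using line_ht_orient_iff(2)[OF ef(2), of y] y lt orient_swap[of f e y] by simp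
      have ynot: "\<not> (orient e m y < 0 \<and> orient m f y < 0)"
      proof
        assume "orient e m y < 0 \<and> orient m f y < 0"
        then have "y \<in> interior (convex hull {e, m, f})"
          using interior_triangle_iff[of e m f y] neg fe by (simp add: divide_neg_neg)
        then show False using T y unfolding empty_triangle_def by blast
      qed
      \<comment> \<open>The u-coordinate of the barycentric formula, taken relative to
        \<open>m\<close>. It shows that left of \<open>m\<close> a point below \<open>e m\<close> is
        also below the line \<open>m f\<close>, and hence inside the triangle; right of
        \<open>m\<close> the roles are exchanged.\<close>
      have ident: "orient e m f * (u y - u m) = orient m f y * (u e - u m) + orient e m y * (u f - u m)"
        unfolding orient_def by (simp add: algebra_simps)
      have "(a, b) = (e, m) \<or> (a, b) = (m, f)"
      proof (cases "t \<le> u m")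
        case True
        have "line_ht e f t < line_ht e m t" using line_ht_less[of "u e" t "u m" e f e m] True t' m by auto
        then have "line_ht a b t \<le> line_ht e m t"
          using clear[of "pt t (line_ht e m t)"] cov_pt[OF em(1) m(1), of t] True t' by simp
        moreover have "\<not> line_ht a b t < line_ht e m t"
        proof
          assume "line_ht a b t < line_ht e m t"
          then have c1: "orient e m y < 0" using line_ht_orient_iff(1)[OF m(1), of y] y by simp
          then have "orient m f y \<ge> 0" using ynot by auto
          then have "orient m f y * (u e - u m) \<le> 0" "orient e m y * (u f - u m) < 0"
            using m c1 by (auto simp: mult_nonneg_nonpos mult_neg_pos)
          moreover have "orient e m f * (u y - u m) \<ge> 0" using neg y True by (simp add: mult_nonpos_nonpos)
          ultimately show False using ident by simp
        qed
        ultimately show ?thesis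
          using edges_meet[OF E ab uab em(1) m(1), of t] t t' True by auto
      next
        case False
        have "line_ht e f t < line_ht m f t" using line_ht_less[of "u m" t "u f" e f m f] False t' m by auto
        then have "line_ht a b t \<le> line_ht m f t"
          using clear[of "pt t (line_ht m f t)"] cov_pt[OF em(2) m(2), of t] False t' by simp
        moreover have "\<not> line_ht a b t < line_ht m f t"
        proof
          assume "line_ht a b t < line_ht m f t"
          then have c1: "orient m f y < 0" using line_ht_orient_iff(1)[OF m(2), of y] y by simp
          then have "orient e m y \<ge> 0" using ynot by auto
          then have "orient m f y * (u e - u m) > 0" "orient e m y * (u f - u m) \<ge> 0"
            using m c1 by (auto simp: mult_neg_neg)
          moreover have "orient e m f * (u y - u m) \<le> 0" using neg y False by (simp add: mult_nonpos_nonneg)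
          ultimately show False using ident by simp
        qed
        ultimately show ?thesis
          using edges_meet[OF E ab uab em(2) m(2), of t] t t' False by auto
      qed
      then show ?thesis
      proof
        assume "(a, b) = (e, m)"
        then show ?thesis using T line_ht_orient_iff(1)[OF m(1), of f] neg by auto
      next
        assume "(a, b) = (m, f)"
        then show ?thesis
          using empty_triangle_perm(2)[OF E T] line_ht_orient_iff(1)[OF m(2), of e] neg orient_rot(1)[of m f e] by auto
      qed
    qed
  qed
qed

lemma empty_triangle_above:
  assumes "max_noncrossing E" "(a, b) \<in> E" "u a < u b" "above E a b"
  shows "\<exists>c. v c > line_ht a b (u c) \<and> empty_triangle E a b c"
  using sweep_frame.empty_triangle_below[OF mirror assms(1-3)] assms(4) unfolding mirror_below mirror_line_ht by simp

text \<open>The apex \<open>c\<close> may lie outside the strip between \<open>a\<close> and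
  \<open>b\<close>; whichever side of t it is on, the side of the triangle joining it to
  \<open>a\<close> or to \<open>b\<close> crosses the column below \<open>a b\<close>.\<close>

lemma column_exit:
  assumes "u a < u b" "v c < line_ht a b (u c)" "u a < t" "t < u b"
  shows "\<exists>w. (w \<in> closed_segment a c \<or> w \<in> closed_segment b c) \<and> u w = t \<and> v w < line_ht a b t"
proof (cases "t \<le> u c")
  case True
  then have "line_ht a c t < line_ht a b t" using line_ht_less[of "u a" t "u c" a c a b] assms by auto
  moreover have "pt t (line_ht a c t) \<in> closed_segment a c" using True assms by (intro pt_in_seg) auto
  ultimately show ?thesis by (metis uv_pt)
next
  case False
  then have "line_ht c b t < line_ht a b t" using line_ht_less[of "u c" t "u b" c b a b] assms by auto
  moreover have "pt t (line_ht c b t) \<in> closed_segment c b" using False assms by (intro pt_in_seg) auto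
  ultimately show ?thesis by (metis uv_pt closed_segment_commute)
qed

text \<open>Improves "somewhere below \<open>a b\<close>" to "below \<open>a b\<close> in every
  column", and an isolated vertex as witness to a point on an edge.\<close>

lemma below_column:
  assumes "max_noncrossing E" "(a, b) \<in> E" "u a < u b" "below E a b" "u a < t" "t < u b"
  shows "\<exists>w\<in>cov E. u w = t \<and> v w < line_ht a b t"
proof -
  obtain c where c: "v c < line_ht a b (u c)" "empty_triangle E a b c"
    using empty_triangle_below[OF assms(1-4)] by blast
  obtain w where "w \<in> closed_segment a c \<or> w \<in> closed_segment b c" "u w = t" "v w < line_ht a b t"
    using column_exit[OF assms(3) c(1) assms(5,6)] by blast
  then show ?thesis using c(2) unfolding empty_triangle_def by (blast intro: covI)
qed

lemma above_column:
  assumes "max_noncrossing E" "(a, b) \<in> E" "u a < u b" "above E a b" "u a < t" "t < u b"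
  shows "\<exists>w\<in>cov E. u w = t \<and> v w > line_ht a b t"
  using sweep_frame.below_column[OF mirror assms(1-3) _ assms(5,6)] assms(4) unfolding mirror_below mirror_line_ht by simp

lemma closed_triangle: "closed (convex hull {a, b, c :: complex})"
  by (simp add: compact_imp_closed finite_imp_compact_convex_hull)

lemma triangle_split:
  assumes "x \<in> convex hull {a, b, c :: complex}"
  shows "x \<in> interior (convex hull {a, b, c}) \<or> x \<in> closed_segment a b \<or> x \<in> closed_segment b c \<or> x \<in> closed_segment c a"
  using assms frontier_of_triangle[of a b c] closed_triangle[of a b c]
  unfolding frontier_def by auto

text \<open>A vertex in the interior would have corners on both sides of it in u, so an edge of the
  triangle spans its column, and \<open>covered_under_edge\<close> would put it on an edge, contrary
  to emptiness. On the boundary there are no vertices but the corners, since edges are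
  admissible.\<close>

lemma empty_triangle_P:
  assumes E: "max_noncrossing E" and T: "empty_triangle E p q r" and x: "x \<in> P" "x \<in> convex hull {p, q, r}"
  shows "x = p \<or> x = q \<or> x = r"
proof -
  have ed: "(p, q) \<in> E" "(q, r) \<in> E" "(r, p) \<in> E" using T noncrossing_sym[OF E] unfolding empty_triangle_def by auto
  have "x \<notin> interior (convex hull {p, q, r})"
  proof
    assume int: "x \<in> interior (convex hull {p, q, r})"
    have "\<not> collinear {p, q, r}" using T unfolding empty_triangle_def by blast
    then have "x \<in> {w. \<exists>l s t. 0 < l \<and> 0 < s \<and> 0 < t \<and> l + s + t = 1 \<and> l *\<^sub>R p + s *\<^sub>R q + t *\<^sub>R r = w}"
      using int interior_convex_hull_3_minimal[of p q r] by simp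
    then obtain l s t where *: "0 < l" "0 < s" "0 < t" "l + s + t = 1" "x = l *\<^sub>R p + s *\<^sub>R q + t *\<^sub>R r"
      by blast
    have ux: "u x = l * u p + s * u q + t * u r" using *(5) by simp
    have "l * (u p - u x) + s * (u q - u x) + t * (u r - u x) =
        (l * u p + s * u q + t * u r) - (l + s + t) * u x" by (simp add: algebra_simps)
    then have sum: "l * (u p - u x) + s * (u q - u x) + t * (u r - u x) = 0"
      unfolding *(4) ux[symmetric] by simp
    have ne: "u p \<noteq> u q" "u q \<noteq> u r" using noncrossing_P[OF E] ed by auto
    have "\<exists>c\<in>{p, q, r}. u c < u x"
    proof (rule ccontr)
      assume "\<not> ?thesis"
      then have "l * (u p - u x) \<ge> 0" "s * (u q - u x) \<ge> 0" "t * (u r - u x) \<ge> 0" using * by auto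
      then have "l * (u p - u x) = 0" "s * (u q - u x) = 0" using sum by linarith+
      then show False using * ne by auto
    qed
    then obtain c where c: "c \<in> {p, q, r}" "u c < u x" by blast
    have "\<exists>d\<in>{p, q, r}. u x < u d"
    proof (rule ccontr)
      assume "\<not> ?thesis"
      then have "l * (u p - u x) \<le> 0" "s * (u q - u x) \<le> 0" "t * (u r - u x) \<le> 0"
        using * by (auto simp: mult_le_0_iff)
      then have "l * (u p - u x) = 0" "s * (u q - u x) = 0" using sum by linarith+
      then show False using * ne by auto
    qed
    then obtain d where d: "d \<in> {p, q, r}" "u x < u d" by blast
    have "(c, d) \<in> E" using c d ed noncrossing_sym[OF E] by auto
    then have "x \<in> cov E" using covered_under_edge[OF E _ c(2) d(2) x(1)] by blast
    then show False using int T unfolding empty_triangle_def by blast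
  qed
  then have "x \<in> closed_segment p q \<or> x \<in> closed_segment q r \<or> x \<in> closed_segment r p"
    using triangle_split[OF x(2)] by blast
  then show ?thesis using seg_P[OF noncrossing_seg[OF E ed(1)]] seg_P[OF noncrossing_seg[OF E ed(2)]] seg_P[OF noncrossing_seg[OF E ed(3)]] x(1)
    by blast
qed

text \<open>Along the segment from z to \<open>a\<close> the barycentric coordinate at
  \<open>r\<close> stays nonnegative, while those at \<open>p\<close> and \<open>q\<close> start
  positive and are not both positive at \<open>a\<close>. Where their minimum vanishes, the point is
  on \<open>p r\<close> or \<open>q r\<close>.\<close>

lemma exit_triangle:
  assumes T: "orient p q r \<noteq> 0" and z: "z \<in> open_segment p q"
    and a: "orient p q a / orient p q r > 0" "a \<notin> interior (convex hull {p, q, r})"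
  shows "\<exists>x. 0 < x \<and> x \<le> 1 \<and> (1 - x) *\<^sub>R z + x *\<^sub>R a \<in> closed_segment p r \<union> closed_segment q r"
proof -
  let ?T = "orient p q r" and ?y = "\<lambda>x. (1 - x) *\<^sub>R z + x *\<^sub>R a"
  obtain l where l: "0 < l" "l < 1" "z = (1 - l) *\<^sub>R p + l *\<^sub>R q" using z unfolding in_segment by blast
  have cz: "orient q r z = (1 - l) * ?T" "orient r p z = l * ?T" "orient p q z = 0"
    unfolding l(3) orient_mix by (simp_all add: orient_rot)
  define f where "f x = orient q r (?y x) / ?T" for x
  define g where "g x = orient r p (?y x) / ?T" for x
  have f: "f x = (1 - x) * (1 - l) + x * (orient q r a / ?T)" and g: "g x = (1 - x) * l + x * (orient r p a / ?T)" for x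
    unfolding f_def g_def orient_mix cz using T by (simp_all add: add_divide_distrib)
  have "f 1 \<le> 0 \<or> g 1 \<le> 0"
    using interior_triangle_iff[OF T, of a] a unfolding f g by auto
  then have m1: "min (f 1) (g 1) \<le> 0" by auto
  have m0: "min (f 0) (g 0) > 0" unfolding f g using l by auto
  have "continuous_on {0..1} (\<lambda>x. min (f x) (g x))"
    unfolding f g by (intro continuous_intros)
  then obtain x where x: "0 \<le> x" "x \<le> 1" "min (f x) (g x) = 0"
    using IVT2'[of "\<lambda>x. min (f x) (g x)" 1 0 0] m0 m1 by auto
  have x0: "x \<noteq> 0" using x m0 by auto
  let ?h = "orient p q (?y x) / ?T"
  have h: "?h = x * (orient p q a / ?T)" unfolding orient_mix cz by simp
  have hp: "?h \<ge> 0" unfolding h using x(1) a(1) by (intro mult_nonneg_nonneg) auto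
  have y: "?y x = f x *\<^sub>R p + g x *\<^sub>R q + ?h *\<^sub>R r" "f x + g x + ?h = 1"
    using barycentric[OF T, of "?y x"] unfolding f_def g_def by blast+
  have "?y x \<in> closed_segment p r \<union> closed_segment q r"
  proof (cases "f x = 0")
    case True
    then have g0: "g x \<ge> 0" "g x = 1 - ?h" using x(3) y(2) by (auto simp: min_def split: if_splits)
    have "?y x = (1 - ?h) *\<^sub>R q + ?h *\<^sub>R r" "?h \<le> 1"
      using y(1) g0(1) unfolding True g0(2) by simp_all
    then have "?y x \<in> closed_segment q r" unfolding in_segment(1) using hp by blast
    then show ?thesis by blast
  next
    case False
    then have g0: "g x = 0" "f x \<ge> 0" using x(3) by (auto simp: min_def split: if_splits)
    then have f1: "f x = 1 - ?h" using y(2) by simp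
    have "?y x = (1 - ?h) *\<^sub>R p + ?h *\<^sub>R r" "?h \<le> 1" using y(1) g0(2) unfolding g0(1) f1 by simp_all
    then have "?y x \<in> closed_segment p r" unfolding in_segment(1) using hp by blast
    then show ?thesis by blast
  qed
  then show ?thesis using x x0 by (intro exI[of _ x]) auto
qed


section \<open>Improving flips\<close>

abbreviation sh :: "int \<Rightarrow> complex \<Rightarrow> complex" where
  "sh k z \<equiv> z + of_int k * tau"

definition quad :: "edge_set \<Rightarrow> complex \<Rightarrow> complex \<Rightarrow> complex \<Rightarrow> complex \<Rightarrow> bool" where
  "quad E p q r s \<longleftrightarrow> empty_triangle E p q r \<and> empty_triangle E p q s \<and> u p < u q \<and>
     v r < line_ht p q (u r) \<and> v s > line_ht p q (u s)"

definition orbit_pairs :: "complex \<Rightarrow> complex \<Rightarrow> edge_set" where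
  "orbit_pairs p q = {(sh k p, sh k q) | k. True} \<union> {(sh k q, sh k p) | k. True}"

text \<open>A flip on the cylinder acts on all translates of the diagonal simultaneously, so whole
  orbits of pairs are exchanged.\<close>

definition flip_edges :: "edge_set \<Rightarrow> complex \<Rightarrow> complex \<Rightarrow> complex \<Rightarrow> complex \<Rightarrow>
    edge_set" where
  "flip_edges E p q r s = (E - orbit_pairs p q) \<union> orbit_pairs r s"

text \<open>Vertices are lifted to the parabola u^2; this is the height of the chord over a b. The number
  excess is its distance from the parabola, which is invariant under translations by tau.\<close>

definition chord :: "complex \<Rightarrow> complex \<Rightarrow> complex \<Rightarrow> real" where
  "chord a b y = (u a + u b) * u y - u a * u b"

definition affine_fn :: "(complex \<Rightarrow> real) \<Rightarrow> bool" where
  "affine_fn A \<longleftrightarrow> (\<forall>t y z. A ((1 - t) *\<^sub>R y + t *\<^sub>R z) = (1 - t) * A y + t * A z)"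

lemma excess_chord: "excess a b y = chord a b y - (u y)\<^sup>2"
  unfolding excess_def chord_def by (simp add: algebra_simps power2_eq_square)

lemma chord_sym: "chord a b y = chord b a y"
  unfolding chord_def by (simp add: algebra_simps)

lemma chord_set: "{a, b} = {c, d} \<Longrightarrow> chord a b y = chord c d y"
  using chord_sym by (auto simp: doubleton_eq_iff)

lemma affine_chord: "affine_fn (chord a b)"
  unfolding affine_fn_def chord_def by (simp add: algebra_simps)

lemma affine_fnD: "affine_fn A \<Longrightarrow> A ((1 - t) *\<^sub>R y + t *\<^sub>R z) = (1 - t) * A y + t * A z"
  unfolding affine_fn_def by blast

lemma chord_ends [simp]: "chord a b a = (u a)\<^sup>2" "chord a b b = (u b)\<^sup>2"
  unfolding chord_def by (simp_all add: algebra_simps power2_eq_square)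

lemma affine_eq_chord:
  assumes "affine_fn A" "A c = (u c)\<^sup>2" "A d = (u d)\<^sup>2" "y \<in> closed_segment c d"
  shows "A y = chord c d y"
proof -
  obtain t where y: "y = (1 - t) *\<^sub>R c + t *\<^sub>R d" using assms(4) unfolding in_segment by blast
  show ?thesis unfolding y affine_fnD[OF assms(1)] affine_fnD[OF affine_chord] using assms by simp
qed

lemma affine_interpolation:
  assumes "orient p q r \<noteq> 0"
  shows "\<exists>A. affine_fn A \<and> A p = x \<and> A q = y \<and> A r = z"
proof -
  define A where "A w = x * (orient q r w / orient p q r) + y * (orient r p w / orient p q r) + z * (orient p q w / orient p q r)" for w
  have "affine_fn A" unfolding affine_fn_def A_def orient_mix
    by (simp add: algebra_simps add_divide_distrib diff_divide_distrib)
  moreover have "A p = x" "A q = y" "A r = z" using assms unfolding A_def by (simp_all add: orient_rot)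
  ultimately show ?thesis by blast
qed

lemma quad_sign:
  assumes "quad E p q r s"
  shows "orient p q r < 0" "orient p q s > 0"
  using assms line_ht_orient_iff unfolding quad_def by auto

lemma quadD:
  assumes "max_noncrossing E" "quad E p q r s"
  shows "(p, q) \<in> E" "(p, r) \<in> E" "(q, r) \<in> E" "(p, s) \<in> E" "(q, s) \<in> E"
    "p \<in> P" "q \<in> P" "r \<in> P" "s \<in> P" "u p < u q"
  using assms(2) noncrossing_P[OF assms(1)] unfolding quad_def empty_triangle_def by blast+

lemma sh_segment: "z \<in> closed_segment a b \<longleftrightarrow> sh k z \<in> closed_segment (sh k a) (sh k b)"
  using closed_segment_translation_eq[of "of_int k * tau" z a b] by (simp add: add.commute)

lemma sh_sh [simp]: "sh k (sh l z) = sh (l + k) z"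
  by (simp add: algebra_simps)

lemma sh_segment': "z \<in> closed_segment (sh k a) (sh k b) \<longleftrightarrow> sh (- k) z \<in> closed_segment a b"
  using sh_segment[of "sh (- k) z" a b k] by simp

lemma sh_P [simp]: "sh k p \<in> P \<longleftrightarrow> p \<in> P"
proof
  assume "sh k p \<in> P"
  then have "sh (- k) (sh k p) \<in> P" by (rule P_shift)
  then show "p \<in> P" by simp
qed (rule P_shift)

lemma excess_sh: "excess (sh k a) (sh k b) (sh k z) = excess a b z"
  unfolding excess_def by simp

lemma seg_sh: "admissible a b \<Longrightarrow> admissible (sh k a) (sh k b)"
  unfolding admissible_def
proof (intro conjI; (elim conjE)?)
  assume s: "closed_segment a b \<inter> P \<subseteq> {a, b}"
  show "closed_segment (sh k a) (sh k b) \<inter> P \<subseteq> {sh k a, sh k b}"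
  proof
    fix z assume "z \<in> closed_segment (sh k a) (sh k b) \<inter> P"
    then have "sh (- k) z \<in> closed_segment a b" "sh (- k) z \<in> P"
      using sh_segment'[of z a k b] P_shift[of z "- k"] by blast+
    then have "sh (- k) z = a \<or> sh (- k) z = b" using s by blast
    then show "z \<in> {sh k a, sh k b}" by auto
  qed
qed (auto intro: W_shift)

lemma orbit_pairs_sym: "(a, b) \<in> orbit_pairs p q \<Longrightarrow> (b, a) \<in> orbit_pairs p q"
  unfolding orbit_pairs_def by auto

lemma orbit_pairs_sh: "(a, b) \<in> orbit_pairs p q \<Longrightarrow> (sh k a, sh k b) \<in> orbit_pairs p q"
  unfolding orbit_pairs_def by (auto simp del: of_int_add)

lemma orbit_pairs_sh_iff: "(sh k a, sh k b) \<in> orbit_pairs p q \<longleftrightarrow> (a, b) \<in> orbit_pairs p q"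
  using orbit_pairs_sh[of a b p q k] orbit_pairs_sh[of "sh k a" "sh k b" p q "- k"] by (auto simp del: of_int_minus)

lemma orbit_pairsE:
  assumes "(a, b) \<in> orbit_pairs p q"
  obtains k where "{a, b} = {sh k p, sh k q}" "closed_segment a b = closed_segment (sh k p) (sh k q)"
  using assms unfolding orbit_pairs_def by (auto simp: closed_segment_commute insert_commute)

lemma orbit_pairs_base: "(p, q) \<in> orbit_pairs p q" "(q, p) \<in> orbit_pairs p q"
  unfolding orbit_pairs_def by (auto intro!: exI[of _ 0])

text \<open>The ends of \<open>a b\<close> are vertices, hence not inside the empty triangles, and
  they lie on opposite sides of \<open>p q\<close>. So in either direction from z the segment leaves
  the adjacent triangle through one of its other two sides. This serves maximality after a flip and,
  with z as a convex combination of the exits, the comparison of heights along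
  \<open>a b\<close>.\<close>

lemma two_exits:
  assumes E: "max_noncrossing E" and Q: "quad E p q r s" and ab: "admissible a b"
    and z: "z \<in> closed_segment a b" "z \<in> closed_segment p q" "z \<notin> P" and ne: "{a, b} \<noteq> {p, q}"
  shows "\<exists>w1 w2 t. w1 \<in> closed_segment a b \<and> w2 \<in> closed_segment a b \<and>
    w1 \<in> closed_segment p r \<union> closed_segment q r \<and> w2 \<in> closed_segment p s \<union> closed_segment q s \<and>
    0 < t \<and> t < 1 \<and> z = (1 - t) *\<^sub>R w1 + t *\<^sub>R w2 \<and> orient p q w1 < 0 \<and> orient p q w2 > 0"
proof -
  note D = quadD[OF E Q] and S = quad_sign[OF Q]
  let ?concl = "\<lambda>a b. \<exists>w1 w2 t. w1 \<in> closed_segment a b \<and> w2 \<in> closed_segment a b \<and>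
    w1 \<in> closed_segment p r \<union> closed_segment q r \<and> w2 \<in> closed_segment p s \<union> closed_segment q s \<and>
    0 < t \<and> t < 1 \<and> z = (1 - t) *\<^sub>R w1 + t *\<^sub>R w2 \<and> orient p q w1 < 0 \<and> orient p q w2 > 0"
  have main: "?concl a b" if ab: "admissible a b" and z: "z \<in> closed_segment a b" and neg: "orient p q a < 0" "orient p q b > 0" for a b
  proof -
    have P: "a \<in> P" "b \<in> P" using ab unfolding admissible_def by auto
    then have zab: "z \<in> open_segment a b" using z assms(6) unfolding open_segment_def by auto
    then obtain l where l: "0 < l" "l < 1" "z = (1 - l) *\<^sub>R a + l *\<^sub>R b" unfolding in_segment by blast
    have zpq: "z \<in> open_segment p q" using assms(5,6) D unfolding open_segment_def by auto
    have zline: "orient p q z = 0" using assms(5) in_seg_iff[OF D(10)] line_ht_orient_iff(3)[OF D(10)] by blast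
    have T: "empty_triangle E p q r" "empty_triangle E p q s" using Q unfolding quad_def by auto
    have "a \<notin> interior (convex hull {p, q, r})"
    proof
      assume i: "a \<in> interior (convex hull {p, q, r})"
      then have "a = p \<or> a = q \<or> a = r" using empty_triangle_P[OF E T(1) P(1)] interior_subset by blast
      moreover have "p \<in> cov E" "q \<in> cov E" "r \<in> cov E" using D by (auto intro: covI)
      ultimately show False using i T(1) unfolding empty_triangle_def by blast
    qed
    then obtain x where x: "0 < x" "x \<le> 1" "(1 - x) *\<^sub>R z + x *\<^sub>R a \<in> closed_segment p r \<union> closed_segment q r"
      using exit_triangle[OF _ zpq, of r a] S neg by (auto simp: divide_neg_neg)
    have "b \<notin> interior (convex hull {p, q, s})"
    proof
      assume i: "b \<in> interior (convex hull {p, q, s})"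
      then have "b = p \<or> b = q \<or> b = s" using empty_triangle_P[OF E T(2) P(2)] interior_subset by blast
      moreover have "p \<in> cov E" "q \<in> cov E" "s \<in> cov E" using D by (auto intro: covI)
      ultimately show False using i T(2) unfolding empty_triangle_def by blast
    qed
    then obtain y where y: "0 < y" "y \<le> 1" "(1 - y) *\<^sub>R z + y *\<^sub>R b \<in> closed_segment p s \<union> closed_segment q s"
      using exit_triangle[OF _ zpq, of s b] S neg by auto
    define w1 where "w1 = (1 - x) *\<^sub>R z + x *\<^sub>R a"
    define w2 where "w2 = (1 - y) *\<^sub>R z + y *\<^sub>R b"
    have "w1 \<in> closed_segment z a" "w2 \<in> closed_segment z b"
      unfolding w1_def w2_def in_segment using x y by (metis less_imp_le)+
    moreover have "closed_segment z a \<subseteq> closed_segment a b" "closed_segment z b \<subseteq> closed_segment a b"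
      using z by (simp_all add: subset_closed_segment)
    ultimately have w: "w1 \<in> closed_segment a b" "w2 \<in> closed_segment a b" by blast+
    have "orient p q w1 = x * orient p q a" "orient p q w2 = y * orient p q b" unfolding w1_def w2_def orient_mix zline by simp_all
    then have c: "orient p q w1 < 0" "orient p q w2 > 0" using x y neg by (simp_all add: mult_pos_neg)
    \<comment> \<open>In units of b - a the exits are at distances x l and y (1 - l) from z, in
      opposite directions; t is the ratio in which z divides the segment between them.\<close>
    define d where "d = x * l + y * (1 - l)"
    have d: "d > 0" unfolding d_def using x y l by (simp add: add_pos_pos)
    define t where "t = x * l / d"
    have t1: "1 - t = y * (1 - l) / d" unfolding t_def using d by (simp add: field_simps d_def)
    have t: "0 < t" "t < 1"
      using x y l d t1 by (simp add: t_def) (smt (verit) t1 divide_pos_pos mult_pos_pos x y l d)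
    have e1: "w1 = z - (x * l) *\<^sub>R (b - a)" and e2: "w2 = z + (y * (1 - l)) *\<^sub>R (b - a)"
      unfolding w1_def w2_def l(3) by (simp_all add: algebra_simps)
    have "(1 - t) *\<^sub>R w1 + t *\<^sub>R w2 = z + (t * (y * (1 - l)) - (1 - t) * (x * l)) *\<^sub>R (b - a)"
      unfolding e1 e2 by (simp add: algebra_simps)
    moreover have "t * (y * (1 - l)) - (1 - t) * (x * l) = 0" unfolding t1 unfolding t_def by simp
    ultimately have "z = (1 - t) *\<^sub>R w1 + t *\<^sub>R w2" by simp
    moreover note xy = x(3)[folded w1_def] y(3)[folded w2_def]
    ultimately show "?concl a b" using w c t
      by - (rule exI[of _ w1], rule exI[of _ w2], rule exI[of _ t], intro conjI, assumption+)
  qed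
  have P: "a \<in> P" "b \<in> P" and anb: "u a \<noteq> u b" using ab seg_ne unfolding admissible_def by auto
  then have zab: "z \<in> open_segment a b" using z unfolding open_segment_def by auto
  then obtain l where l: "0 < l" "l < 1" "z = (1 - l) *\<^sub>R a + l *\<^sub>R b" unfolding in_segment by blast
  have zpq: "z \<in> open_segment p q" using z D unfolding open_segment_def by auto
  have zline: "orient p q z = 0" using z in_seg_iff[OF D(10)] line_ht_orient_iff(3)[OF D(10)] by blast
  then have bal: "(1 - l) * orient p q a + l * orient p q b = 0" using orient_mix[of p q l a b] l(3) by simp
  \<comment> \<open>If \<open>a b\<close> lay on the line of \<open>p q\<close>, the two segments
    would overlap around z. Neither has an endpoint of the other in its inside, so they would
    coincide.\<close>
  have "orient p q a \<noteq> 0"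
  proof
    assume a0: "orient p q a = 0"
    then have b0: "orient p q b = 0" using bal l by simp
    have pqs: "admissible p q" using noncrossing_seg[OF E] D by blast
    have on: "x \<in> closed_segment p q \<longleftrightarrow> u p \<le> u x \<and> u x \<le> u q" if "x = a \<or> x = b" for x
      using in_seg_iff[OF D(10)] line_ht_orient_iff(3)[OF D(10)] a0 b0 that by blast
    obtain a' b' where ab': "a' = a \<and> b' = b \<or> a' = b \<and> b' = a" "u a' < u b'" using anb by (metis linorder_neqE)
    have z': "z \<in> open_segment a' b'" using zab ab' by (auto simp: open_segment_commute)
    have uz: "u a' < u z" "u z < u b'" "u p < u z" "u z < u q"
      using z' zpq in_open_seg_iff ab' D by auto
    have cab: "orient a' b' p = 0" "orient a' b' q = 0"
    proof -
      have h: "(u q - u p) * (v x - v p) = (u x - u p) * (v q - v p)" if "x = a' \<or> x = b'" for x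
        using a0 b0 ab' that unfolding orient_def by auto
      have "(u q - u p) * orient a' b' p = 0"
        using h[of a'] h[of b'] unfolding orient_def by (simp add: algebra_simps) algebra
      moreover have "(u q - u p) * orient a' b' q = 0"
        using h[of a'] h[of b'] unfolding orient_def by (simp add: algebra_simps) algebra
      ultimately show "orient a' b' p = 0" "orient a' b' q = 0" using D(10) by auto
    qed
    have on': "x \<in> closed_segment a b \<longleftrightarrow> u a' \<le> u x \<and> u x \<le> u b'" if "x = p \<or> x = q" for x
      using in_seg_iff[OF ab'(2), of x] line_ht_orient_iff(3)[OF ab'(2), of x] cab that ab'(1)
      by (auto simp: closed_segment_commute)
    have "a' = p"
    proof (cases "u a' \<le> u p")
      case True
      then have "p = a \<or> p = b" using on'[of p] uz seg_P[OF ab] D by auto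
      then show ?thesis using ab' uz by auto
    next
      case False
      then have "a' = p \<or> a' = q" using on[of a'] ab' uz seg_P[OF pqs] P by auto
      then show ?thesis using uz by auto
    qed
    moreover have "b' = q"
    proof (cases "u q \<le> u b'")
      case True
      then have "q = a \<or> q = b" using on'[of q] uz seg_P[OF ab] D by auto
      then show ?thesis using ab' uz by auto
    next
      case False
      then have "b' = p \<or> b' = q" using on[of b'] ab' uz seg_P[OF pqs] P by auto
      then show ?thesis using uz by auto
    qed
    ultimately show False using ne ab'(1) by auto
  qed
  moreover have "orient p q b > 0" if "orient p q a < 0"
  proof -
    have "(1 - l) * orient p q a < 0" using that l by (simp add: mult_pos_neg)
    then have "l * orient p q b > 0" using bal by linarith
    then show ?thesis using l by (simp add: zero_less_mult_iff)
  qed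
  moreover have "orient p q b < 0" if "orient p q a > 0"
  proof -
    have "(1 - l) * orient p q a > 0" using that l by simp
    then have "l * orient p q b < 0" using bal by linarith
    then show ?thesis using l by (simp add: mult_less_0_iff)
  qed
  ultimately consider "orient p q a < 0" "orient p q b > 0" | "orient p q a > 0" "orient p q b < 0"
    by linarith
  then show ?thesis
  proof cases
    case 1 then show ?thesis using main[OF ab z(1)] by blast
  next
    case 2
    then show ?thesis using main[OF seg_sym[OF ab]] z(1) by (simp add: closed_segment_commute)
  qed
qed


text \<open>\<open>orient p q z = 0\<close> only puts z on the line of \<open>p q\<close>; that z is
  inside the segment is a consequence. The inequality is weak so that its failure yields strict
  convexity; when it holds it is strict by general position.\<close>

definition improving :: "edge_set \<Rightarrow> complex \<Rightarrow> complex \<Rightarrow> complex \<Rightarrow> complex \<Rightarrow> complex \<Rightarrow> bool" where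
  "improving E p q r s z \<longleftrightarrow> quad E p q r s \<and> z \<in> open_segment r s \<and> orient p q z = 0 \<and> chord r s z \<le> chord p q z"

text \<open>A dead segment lies somewhere above the lifted surface of E. Improving flips lower that
  surface, so a flipped edge is dead for ever; this makes sequences of improving flips finite.\<close>

definition dead :: "edge_set \<Rightarrow> complex \<Rightarrow> complex \<Rightarrow> bool" where
  "dead E a b \<longleftrightarrow> admissible a b \<and> (\<exists>c d z. (c, d) \<in> E \<and> z \<in> closed_segment a b \<and> z \<in> closed_segment c d \<and>
     z \<notin> P \<and> excess c d z < excess a b z)"

lemma quad_diagonals_meet:
  assumes "quad E p q r s"
  shows "\<exists>z. z \<in> open_segment r s \<and> orient p q z = 0"
proof -
  note S = quad_sign[OF assms]
  define x where "x = - orient p q r / (orient p q s - orient p q r)"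
  have x: "0 < x" "x < 1" using S by (simp_all add: x_def field_simps)
  have "(1 - x) * orient p q r + x * orient p q s = orient p q r + x * (orient p q s - orient p q r)" by (simp add: algebra_simps)
  also have "\<dots> = 0" using S by (simp add: x_def)
  finally have "orient p q ((1 - x) *\<^sub>R r + x *\<^sub>R s) = 0" unfolding orient_mix .
  moreover have "r \<noteq> s" using S by auto
  ultimately show ?thesis using x unfolding in_segment by blast
qed

lemma excess_pos:
  assumes "u a \<noteq> u b" "z \<in> open_segment a b"
  shows "excess a b z > 0"
proof (cases "u a < u b")
  case True
  then show ?thesis using assms in_open_seg_iff[OF True, of z] unfolding excess_def by simp
next
  case False
  then have "u b < u a" using assms by simp
  then show ?thesis using assms in_open_seg_iff[of b a z] unfolding excess_def
    by (simp add: open_segment_commute mult_neg_neg)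
qed

lemma interior_cone:
  assumes "orient p q r \<noteq> 0" "z \<in> open_segment p q" "0 < t" "t < 1"
  shows "(1 - t) *\<^sub>R r + t *\<^sub>R z \<in> interior (convex hull {p, q, r})"
proof -
  obtain l where l: "0 < l" "l < 1" "z = (1 - l) *\<^sub>R p + l *\<^sub>R q" using assms(2) unfolding in_segment by blast
  show ?thesis unfolding interior_triangle_iff[OF assms(1)] unfolding l(3) orient_mix
    using assms l by (simp add: orient_rot)
qed

text \<open>At z the excess of \<open>r s\<close> is positive, so that of \<open>p q\<close> is too,
  and this puts z between \<open>p\<close> and \<open>q\<close>. The chords differ at z by
  \<open>generic\<close>, since the two diagonals are not parallel.\<close>

lemma improving_flip:
  assumes E: "max_noncrossing E" and I: "improving E p q r s z"
  shows "z \<in> open_segment p q" "W r s" "chord r s z < chord p q z" "u r \<noteq> u s"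
proof -
  have Q: "quad E p q r s" and z: "z \<in> open_segment r s" "orient p q z = 0" "chord r s z \<le> chord p q z"
    using I unfolding improving_def by auto
  note D = quadD[OF E Q] and S = quad_sign[OF Q]
  have "r \<noteq> s" using S by auto
  then show rs: "u r \<noteq> u s" using P_eqI D by blast
  have ex: "0 < excess r s z" "excess r s z \<le> excess p q z" using excess_pos[OF rs z(1)] z(3) by (simp_all add: excess_chord)
  then have "0 < (u z - u p) * (u q - u z)" unfolding excess_def by simp
  then have uz: "u p < u z" "u z < u q" using D(10) by (auto simp: zero_less_mult_iff)
  then show zpq: "z \<in> open_segment p q"
    using in_open_seg_iff[OF D(10)] line_ht_orient_iff(3)[OF D(10)] z(2) by blast
  have Ws: "W p r" "W p s" "W q r" "W q s" "W p q" using noncrossing_P[OF E] D by blast+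
  have wide: "W a b" if ab: "{a, b} = {r, s}" "u a < u b" for a b
  proof (rule ccontr)
    assume n: "\<not> W a b"
    have abP: "a \<in> P" "b \<in> P" using ab(1) D by (auto simp: doubleton_eq_iff)
    have W': "W p b" "W a q" using ab(1) Ws W_sym by (auto simp: doubleton_eq_iff)
    have zab: "z \<in> open_segment a b" using ab(1) z(1) by (auto simp: doubleton_eq_iff open_segment_commute)
    then have uab: "u a < u z" "u z < u b" using in_open_seg_iff[OF ab(2)] by auto
    \<comment> \<open>If u p \<le> u a, then \<open>a\<close> and \<open>b\<close> would both be
      between the ends of the short segment \<open>p b\<close>, and \<open>W_mono\<close> would give
      \<open>W a b\<close>; likewise at \<open>q\<close>. So \<open>a b\<close> overhangs
      \<open>p q\<close> at both ends and has the larger excess at z.\<close>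
    have "u a < u p" using W_mono[OF D(6) abP(2) abP W'(1)] n ab(2) by fastforce
    moreover have "u q < u b" using W_mono[OF abP(1) D(7) abP W'(2)] n ab(2) by fastforce
    ultimately have "(u z - u p) * (u q - u z) < (u z - u a) * (u b - u z)"
      using uz uab by (intro mult_strict_mono) auto
    moreover have "excess r s z = excess a b z" using chord_set[OF ab(1)] by (simp add: excess_chord)
    ultimately show False using ex(2) unfolding excess_def by simp
  qed
  show W: "W r s"
  proof (cases "u r < u s")
    case True then show ?thesis using wide[of r s] by simp
  next
    case False then show ?thesis using wide[of s r] rs W_sym by (auto simp: insert_commute)
  qed
  have "(u q - u p) * (v s - v r) \<noteq> (u s - u r) * (v q - v p)"
    using S unfolding orient_def by (simp add: algebra_simps)
  from generic[OF D(6,7,8,9) Ws(5) W zpq z(1) this] show "chord r s z < chord p q z"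
    using ex(2) unfolding excess_def[symmetric] excess_chord by simp
qed

lemma diagonal_points:
  assumes E: "max_noncrossing E" and I: "improving E p q r s z" and y: "y \<in> closed_segment r s"
  shows "y = r \<or> y = s \<or> y = z \<or> y \<in> interior (convex hull {p, q, r}) \<or> y \<in> interior (convex hull {p, q, s})"
proof -
  have Q: "quad E p q r s" and z: "z \<in> open_segment r s" using I unfolding improving_def by auto
  note S = quad_sign[OF Q] and zpq = improving_flip(1)[OF E I]
  have "closed_segment r s = closed_segment r z \<union> closed_segment z s"
    using z by (intro Un_closed_segment[symmetric]) (auto simp: open_segment_def)
  then have "y \<in> closed_segment r z \<or> y \<in> closed_segment s z" using y by (simp add: closed_segment_commute)
  then show ?thesis
  proof
    assume "y \<in> closed_segment r z"
    then obtain t where t: "0 \<le> t" "t \<le> 1" "y = (1 - t) *\<^sub>R r + t *\<^sub>R z" unfolding in_segment by blast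
    show ?thesis
    proof (cases "t = 0 \<or> t = 1")
      case True then show ?thesis using t(3) by auto
    next
      case False then show ?thesis using interior_cone[OF _ zpq, of r t] t S by auto
    qed
  next
    assume "y \<in> closed_segment s z"
    then obtain t where t: "0 \<le> t" "t \<le> 1" "y = (1 - t) *\<^sub>R s + t *\<^sub>R z" unfolding in_segment by blast
    show ?thesis
    proof (cases "t = 0 \<or> t = 1")
      case True then show ?thesis using t(3) by auto
    next
      case False then show ?thesis using interior_cone[OF _ zpq, of s t] t S by auto
    qed
  qed
qed

lemma open_seg_notP: "max_noncrossing E \<Longrightarrow> (a, b) \<in> E \<Longrightarrow> z \<in> open_segment a b \<Longrightarrow> z \<notin> P"
  using seg_P[OF noncrossing_seg] unfolding open_segment_def by blast

lemma diagonal_subset: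
  assumes E: "max_noncrossing E" and I: "improving E p q r s z"
  shows "closed_segment r s \<subseteq> convex hull {p, q, r} \<union> convex hull {p, q, s}"
proof
  fix y assume "y \<in> closed_segment r s"
  moreover have "z \<in> convex hull {p, q}"
    using improving_flip(1)[OF E I] segment_convex_hull[of p q] by (auto simp: open_segment_def)
  then have "z \<in> convex hull {p, q, r}" using hull_mono[of "{p, q}" "{p, q, r}"] by blast
  moreover have "r \<in> convex hull {p, q, r}" "s \<in> convex hull {p, q, s}" by (auto intro: hull_inc)
  ultimately show "y \<in> convex hull {p, q, r} \<union> convex hull {p, q, s}"
    using diagonal_points[OF E I] interior_subset by blast
qed

lemma diagonal_seg:
  assumes E: "max_noncrossing E" and I: "improving E p q r s z"
  shows "admissible r s"
proof -
  have Q: "quad E p q r s" and z: "z \<in> open_segment r s" using I unfolding improving_def by auto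
  note D = quadD[OF E Q] and F = improving_flip[OF E I]
  have T: "empty_triangle E p q r" "empty_triangle E p q s" using Q unfolding quad_def by auto
  have cov: "p \<in> cov E" "q \<in> cov E" "r \<in> cov E" "s \<in> cov E" using D by (auto intro: covI)
  have "y = r \<or> y = s" if y: "y \<in> closed_segment r s" "y \<in> P" for y
    using diagonal_points[OF E I y(1)]
  proof (elim disjE)
    assume "y = z" then show ?thesis using open_seg_notP[OF E D(1) F(1)] y(2) by blast
  next
    assume i: "y \<in> interior (convex hull {p, q, r})"
    then have "y \<in> cov E" using empty_triangle_P[OF E T(1) y(2)] interior_subset cov by blast
    then show ?thesis using i T(1) unfolding empty_triangle_def by blast
  next
    assume i: "y \<in> interior (convex hull {p, q, s})"
    then have "y \<in> cov E" using empty_triangle_P[OF E T(2) y(2)] interior_subset cov by blast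
    then show ?thesis using i T(2) unfolding empty_triangle_def by blast
  qed auto
  then show ?thesis unfolding admissible_def using D F by auto
qed

lemma diagonal_crosses:
  assumes E: "max_noncrossing E" and I: "improving E p q r s z"
    and y: "y \<in> closed_segment r s" "y \<notin> P" and ab: "(a, b) \<in> E" "y \<in> closed_segment a b"
  shows "{a, b} = {p, q}"
proof -
  have Q: "quad E p q r s" using I unfolding improving_def by auto
  note D = quadD[OF E Q]
  have T: "empty_triangle E p q r" "empty_triangle E p q s" using Q unfolding quad_def by auto
  have "y \<in> cov E" using covI[OF ab] .
  then have "y = z" using diagonal_points[OF E I y(1)] y(2) D T unfolding empty_triangle_def by blast
  then have "y \<in> closed_segment p q" using improving_flip(1)[OF E I] unfolding open_segment_def by blast
  then show ?thesis using noncrossing_nc[OF E ab(1) D(1) ab(2) _ y(2)] by blast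
qed

text \<open>A side of the quadrilateral must not be a translate of the removed diagonal. Since
  \<open>p q\<close> is narrower than 1, a translate sharing an endpoint with \<open>p q\<close> is
  \<open>p q\<close> itself.\<close>

lemma flip_edges_edges:
  assumes E: "max_noncrossing E" and I: "improving E p q r s z"
  shows "(r, s) \<in> flip_edges E p q r s" "(p, r) \<in> flip_edges E p q r s" "(q, r) \<in> flip_edges E p q r s"
    "(p, s) \<in> flip_edges E p q r s" "(q, s) \<in> flip_edges E p q r s"
proof -
  have Q: "quad E p q r s" using I unfolding improving_def by auto
  note D = quadD[OF E Q] and S = quad_sign[OF Q]
  show "(r, s) \<in> flip_edges E p q r s" unfolding flip_edges_def using orbit_pairs_base by auto
  have no: "(a, b) \<notin> orbit_pairs p q" if ab: "(a, b) \<in> E" "a = p \<or> a = q" "b \<noteq> p" "b \<noteq> q" for a b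
  proof
    assume "(a, b) \<in> orbit_pairs p q"
    then obtain k where k: "{a, b} = {sh k p, sh k q}" by (rule orbit_pairsE)
    have w: "\<bar>u p - u q\<bar> < 1" using W_width D noncrossing_P[OF E D(1)] by blast
    have "u a = u p + k \<or> u a = u q + k" using k by (auto simp: doubleton_eq_iff)
    then have "\<bar>real_of_int k\<bar> < 1 \<or> (a = p \<and> u p = u q + k) \<or> (a = q \<and> u q = u p + k)"
      using ab(2) by auto
    then have "\<bar>real_of_int k\<bar> < 1" using w by auto
    then have "k = 0" by linarith
    then show False using k ab by (auto simp: doubleton_eq_iff)
  qed
  have "r \<noteq> p" "r \<noteq> q" "s \<noteq> p" "s \<noteq> q" using S by auto
  then show "(p, r) \<in> flip_edges E p q r s" "(q, r) \<in> flip_edges E p q r s"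
    "(p, s) \<in> flip_edges E p q r s" "(q, s) \<in> flip_edges E p q r s"
    unfolding flip_edges_def using D no by auto
qed

lemma flip_edges_shift:
  assumes "max_noncrossing E" "(a, b) \<in> flip_edges E p q r s"
  shows "(sh k a, sh k b) \<in> flip_edges E p q r s"
  using assms(2) noncrossing_shift[OF assms(1)] orbit_pairs_sh orbit_pairs_sh_iff unfolding flip_edges_def by blast

text \<open>The point is maximality: a segment that met \<open>E\<close> in a translate of
  \<open>p q\<close> leaves the quadrilateral on both sides of it through edges that survive the
  flip. If both exits are vertices, they are the opposite corners, and the segment is a translate of
  the new diagonal.\<close>

lemma flip_edges_noncrossing:
  assumes E: "max_noncrossing E" and I: "improving E p q r s z"
  shows "max_noncrossing (flip_edges E p q r s)"
proof -
  let ?E = "flip_edges E p q r s"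
  have Q: "quad E p q r s" and z: "z \<in> open_segment r s" using I unfolding improving_def by auto
  note D = quadD[OF E Q] and F = improving_flip[OF E I] and rs = diagonal_seg[OF E I]
  have zP: "z \<notin> P" using open_seg_notP[OF E D(1) F(1)] .
  have edge: "admissible a b \<and> (b, a) \<in> ?E \<and> (\<forall>k. (sh k a, sh k b) \<in> ?E)" if ab: "(a, b) \<in> ?E" for a b
  proof (intro conjI allI)
    show "(sh k a, sh k b) \<in> ?E" for k by (rule flip_edges_shift[OF E ab])
    show "(b, a) \<in> ?E" using ab noncrossing_sym[OF E] orbit_pairs_sym unfolding flip_edges_def by blast
    show "admissible a b"
    proof (cases "(a, b) \<in> E")
      case True then show ?thesis by (rule noncrossing_seg[OF E])
    next
      case False
      then have "(a, b) \<in> orbit_pairs r s" using ab unfolding flip_edges_def by blast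
      then show ?thesis using seg_sh[OF rs] seg_sh[OF seg_sym[OF rs]] unfolding orbit_pairs_def by auto
    qed
  qed
  have mixed: False if ab: "(a, b) \<in> E" "(a, b) \<notin> orbit_pairs p q" and cd: "(c, d) \<in> orbit_pairs r s"
    and y: "y \<in> closed_segment a b" "y \<in> closed_segment c d" "y \<notin> P" for a b c d y
  proof -
    obtain k where k: "closed_segment c d = closed_segment (sh k r) (sh k s)" using orbit_pairsE[OF cd] by metis
    have "sh (- k) y \<in> closed_segment r s" using y(2) unfolding k sh_segment' .
    moreover have "sh (- k) y \<in> closed_segment (sh (- k) a) (sh (- k) b)"
      using y(1) sh_segment by blast
    moreover have "sh (- k) y \<notin> P" using y(3) sh_P by blast
    ultimately have "{sh (- k) a, sh (- k) b} = {p, q}"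
      using diagonal_crosses[OF E I _ _ noncrossing_shift[OF E ab(1)]] by blast
    then have "(sh (- k) a, sh (- k) b) \<in> orbit_pairs p q" using orbit_pairs_base by (auto simp: doubleton_eq_iff simp del: of_int_minus)
    then show False using ab(2) orbit_pairs_sh_iff by blast
  qed
  have wrs: "\<bar>u r - u s\<bar> < 1" using W_width D F by blast
  \<comment> \<open>The width of \<open>r s\<close> is below 1, so its distinct translates lie over
    disjoint u-intervals.\<close>
  have both: "{a, b} = {c, d}" if ab: "(a, b) \<in> orbit_pairs r s" and cd: "(c, d) \<in> orbit_pairs r s"
    and y: "y \<in> closed_segment a b" "y \<in> closed_segment c d" for a b c d y
  proof -
    obtain k where k: "{a, b} = {sh k r, sh k s}" "closed_segment a b = closed_segment (sh k r) (sh k s)"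
      using orbit_pairsE[OF ab] by metis
    obtain l where l: "{c, d} = {sh l r, sh l s}" "closed_segment c d = closed_segment (sh l r) (sh l s)"
      using orbit_pairsE[OF cd] by metis
    have r1: "min (u r) (u s) \<le> u x \<and> u x \<le> max (u r) (u s)" if "x \<in> closed_segment r s" for x
      using in_seg_iff[of r s x] in_seg_iff[of s r x] that F(4)
      by (cases "u r < u s") (auto simp: closed_segment_commute)
    have "sh (- k) y \<in> closed_segment r s" "sh (- l) y \<in> closed_segment r s"
      using y unfolding k l sh_segment' by auto
    then have "min (u r) (u s) \<le> u y - k" "u y - k \<le> max (u r) (u s)"
      "min (u r) (u s) \<le> u y - l" "u y - l \<le> max (u r) (u s)"
      using r1[of "sh (- k) y"] r1[of "sh (- l) y"] by auto
    then have "\<bar>real_of_int (k - l)\<bar> < 1" using wrs by auto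
    then have "k = l" by linarith
    then show ?thesis using k l by simp
  qed
  have nc: "{a, b} = {c, d}" if ab: "(a, b) \<in> ?E" and cd: "(c, d) \<in> ?E"
    and y: "y \<in> closed_segment a b" "y \<in> closed_segment c d" "y \<notin> P" for a b c d y
  proof -
    have A: "(a, b) \<in> orbit_pairs r s \<or> (a, b) \<in> E \<and> (a, b) \<notin> orbit_pairs p q"
      and C: "(c, d) \<in> orbit_pairs r s \<or> (c, d) \<in> E \<and> (c, d) \<notin> orbit_pairs p q"
      using ab cd unfolding flip_edges_def by blast+
    show ?thesis
      using A
    proof
      assume a: "(a, b) \<in> orbit_pairs r s"
      show ?thesis using C both[OF a _ y(1,2)] mixed[OF _ _ a y(2,1,3)] by blast
    next
      assume a: "(a, b) \<in> E \<and> (a, b) \<notin> orbit_pairs p q"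
      show ?thesis using C mixed[OF _ _ _ y(1,2,3)] a noncrossing_nc[OF E _ _ y] by blast
    qed
  qed
  have max: "\<exists>c d y. (c, d) \<in> ?E \<and> y \<in> closed_segment a b \<and> y \<in> closed_segment c d \<and> y \<notin> P"
    if ab: "admissible a b" "(a, b) \<notin> ?E" for a b
  proof (cases "(a, b) \<in> orbit_pairs p q")
    case True
    then obtain k where k: "closed_segment a b = closed_segment (sh k p) (sh k q)" by (rule orbit_pairsE)
    have "z \<in> closed_segment p q" "z \<in> closed_segment r s" using F(1) z unfolding open_segment_def by auto
    then have "sh k z \<in> closed_segment a b" "sh k z \<in> closed_segment (sh k r) (sh k s)"
      unfolding k using sh_segment by blast+
    moreover have "(sh k r, sh k s) \<in> ?E" by (rule flip_edges_shift[OF E flip_edges_edges(1)[OF E I]])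
    moreover have "sh k z \<notin> P" using zP by simp
    ultimately show ?thesis by blast
  next
    case False
    then have "(a, b) \<notin> E" using ab(2) unfolding flip_edges_def by blast
    from noncrossing_max[OF E ab(1) this] obtain c d y
      where cd: "(c, d) \<in> E" "y \<in> closed_segment a b" "y \<in> closed_segment c d" "y \<notin> P" by blast
    show ?thesis
    proof (cases "(c, d) \<in> orbit_pairs p q")
      case False
      then show ?thesis using cd unfolding flip_edges_def by blast
    next
      case True
      then obtain k where k: "closed_segment c d = closed_segment (sh k p) (sh k q)" by (rule orbit_pairsE)
      let ?a = "sh (- k) a" and ?b = "sh (- k) b" and ?y = "sh (- k) y"
      have y: "?y \<in> closed_segment ?a ?b" "?y \<in> closed_segment p q" "?y \<notin> P"
        using cd(2-4) k sh_segment sh_segment' sh_P by blast+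
      have sab: "admissible ?a ?b" by (rule seg_sh[OF ab(1)])
      have ne: "{?a, ?b} \<noteq> {p, q}"
      proof
        assume "{?a, ?b} = {p, q}"
        then have "(?a, ?b) \<in> orbit_pairs p q" using orbit_pairs_base by (auto simp: doubleton_eq_iff simp del: of_int_minus)
        then show False using \<open>(a, b) \<notin> orbit_pairs p q\<close> orbit_pairs_sh_iff by blast
      qed
      obtain w1 w2 where w: "w1 \<in> closed_segment ?a ?b" "w2 \<in> closed_segment ?a ?b"
        "w1 \<in> closed_segment p r \<union> closed_segment q r" "w2 \<in> closed_segment p s \<union> closed_segment q s"
        "orient p q w1 < 0" "orient p q w2 > 0"
        using two_exits[OF E Q sab y ne] by blast
      have "\<exists>w c d. (c, d) \<in> ?E \<and> w \<in> closed_segment ?a ?b \<and> w \<in> closed_segment c d \<and> w \<notin> P"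
      proof (rule ccontr)
        assume n: "\<not> ?thesis"
        then have wP: "w1 \<in> P" "w2 \<in> P" using w flip_edges_edges[OF E I] by blast+
        have "w1 = p \<or> w1 = q \<or> w1 = r" "w2 = p \<or> w2 = q \<or> w2 = s"
          using w(3,4) wP seg_P[OF noncrossing_seg[OF E]] D by blast+
        then have "w1 = r" "w2 = s" using w(5,6) by auto
        moreover have "w1 = ?a \<or> w1 = ?b" "w2 = ?a \<or> w2 = ?b"
          using w(1,2) wP seg_P[OF sab] by blast+
        ultimately have "(?a, ?b) = (r, s) \<or> (?a, ?b) = (s, r)" using w(5,6) by auto
        then have "(?a, ?b) \<in> orbit_pairs r s" using orbit_pairs_base by metis
        then have "(a, b) \<in> orbit_pairs r s" using orbit_pairs_sh_iff by blast
        then show False using ab(2) unfolding flip_edges_def by blast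
      qed
      then obtain w c' d' where "(c', d') \<in> ?E" "w \<in> closed_segment ?a ?b" "w \<in> closed_segment c' d'" "w \<notin> P"
        by blast
      then have "(sh k c', sh k d') \<in> ?E" "sh k w \<in> closed_segment a b"
        "sh k w \<in> closed_segment (sh k c') (sh k d')" "sh k w \<notin> P"
        using flip_edges_shift[OF E] sh_segment[of w ?a ?b k] sh_segment sh_P by auto
      then show ?thesis by blast
    qed
  qed
  show ?thesis unfolding max_noncrossing_def
  proof (rule conjI[OF _ conjI]; intro allI impI)
    fix a b assume "(a, b) \<in> ?E"
    then show "admissible a b \<and> (b, a) \<in> ?E \<and> (\<forall>k. (sh k a, sh k b) \<in> ?E)" by (rule edge)
  next
    fix a b c d y
    assume "(a, b) \<in> ?E \<and> (c, d) \<in> ?E \<and> y \<in> closed_segment a b \<and> y \<in> closed_segment c d \<and> y \<notin> P"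
    then show "{a, b} = {c, d}" by (elim conjE) (rule nc)
  next
    fix a b assume "admissible a b \<and> (a, b) \<notin> ?E"
    then show "\<exists>c d y. (c, d) \<in> ?E \<and> y \<in> closed_segment a b \<and> y \<in> closed_segment c d \<and> y \<notin> P"
      by (elim conjE) (rule max)
  qed
qed


section \<open>Termination of improving flips\<close>

lemma diagonal_signs:
  assumes E: "max_noncrossing E" and I: "improving E p q r s z"
  shows "orient r s p > 0" "orient r s q < 0"
proof -
  have Q: "quad E p q r s" and z: "z \<in> open_segment r s" using I unfolding improving_def by auto
  note S = quad_sign[OF Q] and zpq = improving_flip(1)[OF E I]
  obtain l where l: "0 < l" "l < 1" "z = (1 - l) *\<^sub>R p + l *\<^sub>R q" using zpq unfolding in_segment by blast
  obtain x where x: "z = (1 - x) *\<^sub>R r + x *\<^sub>R s" using z unfolding in_segment by blast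
  have "orient r s z = 0" unfolding x orient_mix by simp
  then have b: "(1 - l) * orient r s p + l * orient r s q = 0" unfolding l(3) orient_mix .
  have d: "orient r s p - orient r s q = orient p q s - orient p q r" unfolding orient_def by (simp add: algebra_simps)
  have "orient r s p = l * (orient r s p - orient r s q)" "orient r s q = (l - 1) * (orient r s p - orient r s q)"
    using b by (simp_all add: algebra_simps)
  moreover have "orient p q s - orient p q r > 0" using S by simp
  ultimately show "orient r s p > 0" "orient r s q < 0"
    unfolding d using l by (metis mult_pos_pos, metis diff_less_0_iff_less mult_neg_pos)
qed

text \<open>A point of the triangle \<open>r s x\<close> is on a segment from x to a point of
  \<open>r s\<close>. The latter lies in one of the two old triangles, and each of them is convex
  and contains x. So only the four corners of the quadrilateral could occur, and none of them is
  interior.\<close>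

lemma diagonal_triangle_P:
  assumes E: "max_noncrossing E" and I: "improving E p q r s z" and x: "x = p \<or> x = q" and w: "w \<in> P"
  shows "w \<notin> interior (convex hull {r, s, x})"
proof
  assume i: "w \<in> interior (convex hull {r, s, x})"
  have Q: "quad E p q r s" using I unfolding improving_def by auto
  have T: "empty_triangle E p q r" "empty_triangle E p q s" using Q unfolding quad_def by auto
  note S = diagonal_signs[OF E I]
  have xn: "orient r s x \<noteq> 0" using S x by auto
  have "w \<in> convex hull {r, s, x}" using i interior_subset by blast
  then have "w \<in> convex hull (insert x {r, s})" by (simp add: insert_commute)
  then obtain a b y where ab: "0 \<le> a" "0 \<le> b" "a + b = 1" "y \<in> convex hull {r, s}" "w = a *\<^sub>R x + b *\<^sub>R y"
    by (subst (asm) convex_hull_insert) auto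
  have "y \<in> closed_segment r s" using ab(4) by (simp add: segment_convex_hull)
  then have y: "y \<in> convex hull {p, q, r} \<or> y \<in> convex hull {p, q, s}" using diagonal_subset[OF E I] by blast
  have xx: "x \<in> convex hull {p, q, r}" "x \<in> convex hull {p, q, s}" using x by (auto intro: hull_inc)
  have "w \<in> convex hull {p, q, r} \<or> w \<in> convex hull {p, q, s}"
    using y
  proof
    assume "y \<in> convex hull {p, q, r}"
    then show ?thesis using convexD[OF convex_convex_hull xx(1) _ ab(1-3)] ab(5) by blast
  next
    assume "y \<in> convex hull {p, q, s}"
    then show ?thesis using convexD[OF convex_convex_hull xx(2) _ ab(1-3)] ab(5) by blast
  qed
  then have "w = p \<or> w = q \<or> w = r \<or> w = s"
    using empty_triangle_P[OF E T(1) w] empty_triangle_P[OF E T(2) w] by blast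
  moreover have "0 < orient r s w / orient r s x" "0 < orient s x w / orient r s x" "0 < orient x r w / orient r s x"
    using i unfolding interior_triangle_iff[OF xn] by auto
  ultimately show False using x S by (auto simp: zero_less_divide_iff)
qed

lemma segment_exit:
  assumes y: "y \<in> interior (convex hull {r, s, x :: complex})" and a: "a \<notin> interior (convex hull {r, s, x})"
  shows "\<exists>w \<in> closed_segment y a. w \<in> closed_segment r s \<or> w \<in> closed_segment s x \<or> w \<in> closed_segment x r"
proof -
  have "closed_segment y a \<inter> frontier (interior (convex hull {r, s, x})) \<noteq> {}"
    by (rule connected_Int_frontier) (use y a in auto)
  moreover have "frontier (interior (convex hull {r, s, x})) \<subseteq> frontier (convex hull {r, s, x})"
    by (rule frontier_interior_subset)
  moreover have "frontier (convex hull {r, s, x}) = closed_segment r s \<union> closed_segment s x \<union> closed_segment x r"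
    by (rule frontier_of_triangle) simp
  ultimately show ?thesis by blast
qed

text \<open>Let D be the affine interpolation over the triangle minus the chord over
  \<open>a b\<close>; it is negative at y. From y towards either end of \<open>a b\<close> one meets
  an edge of the triangle. If \<open>a b\<close> were not dead, D would be nonnegative there, and by
  affinity also at the end beyond. Then D would be nonnegative on all of \<open>a b\<close>,
  including y.\<close>

lemma dead_in_triangle:
  assumes E: "max_noncrossing E'" and ed: "(x, r) \<in> E'" "(r, s) \<in> E'" "(s, x) \<in> E'" and c: "orient r s x \<noteq> 0"
    and noP: "\<And>w. w \<in> P \<Longrightarrow> w \<notin> interior (convex hull {r, s, x})"
    and z: "z \<in> open_segment r s" and t: "0 < t" "t < 1"
    and y: "y = (1 - t) *\<^sub>R x + t *\<^sub>R z" and ab: "admissible a b" "y \<in> closed_segment a b"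
    and lt: "(1 - t) * (u x)\<^sup>2 + t * chord r s z < chord a b y"
  shows "dead E' a b"
proof (rule ccontr)
  assume nd: "\<not> dead E' a b"
  have yi: "y \<in> interior (convex hull {r, s, x})" unfolding y by (rule interior_cone[OF c z t])
  obtain A where A: "affine_fn A" "A r = (u r)\<^sup>2" "A s = (u s)\<^sup>2" "A x = (u x)\<^sup>2"
    using affine_interpolation[OF c] by metis
  define D where "D w = A w - chord a b w" for w
  have Dmix: "D ((1 - k) *\<^sub>R w + k *\<^sub>R w') = (1 - k) * D w + k * D w'" for k w w'
    unfolding D_def affine_fnD[OF A(1)] affine_fnD[OF affine_chord] by (simp add: algebra_simps)
  have "A z = chord r s z" using affine_eq_chord[OF A(1-3)] z unfolding open_segment_def by blast
  then have Dy: "D y < 0" unfolding D_def using lt unfolding y affine_fnD[OF A(1)] A(4) by simp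
  have P: "a \<in> P" "b \<in> P" using ab unfolding admissible_def by auto
  have side: "D w \<ge> 0" if w: "w \<in> closed_segment a b" "w \<in> closed_segment c d" "(c, d) \<in> E'"
    and Ac: "A c = (u c)\<^sup>2" "A d = (u d)\<^sup>2" for w c d
  proof (cases "w \<in> P")
    case True
    then have "w = a \<or> w = b" "w = c \<or> w = d"
      using seg_P[OF ab(1) w(1)] seg_P[OF noncrossing_seg[OF E w(3)] w(2)] by blast+
    then show ?thesis unfolding D_def using Ac by auto
  next
    case False
    then have "\<not> excess c d w < excess a b w" using nd w ab(1) unfolding dead_def by blast
    then show ?thesis unfolding D_def excess_chord affine_eq_chord[OF A(1) Ac w(2)] by simp
  qed
  have out: "D e \<ge> 0" if e: "e = a \<or> e = b" for e
  proof -
    have "e \<notin> interior (convex hull {r, s, x})" using noP P e by blast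
    then obtain w where w: "w \<in> closed_segment y e"
      "w \<in> closed_segment r s \<or> w \<in> closed_segment s x \<or> w \<in> closed_segment x r"
      using segment_exit[OF yi] by blast
    have "closed_segment y e \<subseteq> closed_segment a b" using ab(2) e by (auto simp: subset_closed_segment)
    then have wab: "w \<in> closed_segment a b" using w(1) by blast
    have Dw: "D w \<ge> 0" using side[OF wab] w(2) ed A by blast
    obtain k where k: "0 \<le> k" "k \<le> 1" "w = (1 - k) *\<^sub>R y + k *\<^sub>R e" using w(1) unfolding in_segment by blast
    have "(1 - k) * D y + k * D e \<ge> 0" using Dw unfolding k(3) Dmix .
    moreover have "(1 - k) * D y \<le> 0" using k Dy by (simp add: mult_nonneg_nonpos)
    ultimately have "k * D e \<ge> 0" by linarith
    moreover have "k \<noteq> 0" using Dw Dy k(3) by auto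
    ultimately show ?thesis using k by (simp add: zero_le_mult_iff)
  qed
  obtain l where l: "0 \<le> l" "l \<le> 1" "y = (1 - l) *\<^sub>R a + l *\<^sub>R b" using ab(2) unfolding in_segment by blast
  have "D y \<ge> 0" unfolding l(3) Dmix using out[of a] out[of b] l by simp
  then show False using Dy by simp
qed

lemma dead_sh:
  assumes E: "max_noncrossing E" and d: "dead E a b"
  shows "dead E (sh k a) (sh k b)"
proof -
  obtain c e z where "admissible a b" "(c, e) \<in> E" "z \<in> closed_segment a b" "z \<in> closed_segment c e" "z \<notin> P"
    "excess c e z < excess a b z" using d unfolding dead_def by blast
  then have "admissible (sh k a) (sh k b)" "(sh k c, sh k e) \<in> E" "sh k z \<in> closed_segment (sh k a) (sh k b)"
    "sh k z \<in> closed_segment (sh k c) (sh k e)" "sh k z \<notin> P"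
    "excess (sh k c) (sh k e) (sh k z) < excess (sh k a) (sh k b) (sh k z)"
    using seg_sh noncrossing_shift[OF E] sh_segment sh_P excess_sh by auto
  then show ?thesis unfolding dead_def by blast
qed

text \<open>A witness survives unless it is on a translate of \<open>p q\<close>. In that case, the
  new surface is below the old chord along \<open>p q\<close>, because it is lower at z and agrees
  at \<open>p\<close> and \<open>q\<close>; \<open>dead_in_triangle\<close> then moves the witness
  to an edge of one of the new triangles.\<close>

lemma dead_flip_edges:
  assumes E: "max_noncrossing E" and I: "improving E p q r s z" and d: "dead E a b"
  shows "dead (flip_edges E p q r s) a b"
proof -
  let ?E = "flip_edges E p q r s"
  have Q: "quad E p q r s" and z: "z \<in> open_segment r s" using I unfolding improving_def by auto
  note D = quadD[OF E Q] and F = improving_flip[OF E I] and E' = flip_edges_noncrossing[OF E I] and ed = flip_edges_edges[OF E I]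
  obtain c e y where w: "admissible a b" "(c, e) \<in> E" "y \<in> closed_segment a b" "y \<in> closed_segment c e" "y \<notin> P"
    "excess c e y < excess a b y" using d unfolding dead_def by blast
  show ?thesis
  proof (cases "(c, e) \<in> orbit_pairs p q")
    case False
    then show ?thesis using w unfolding dead_def flip_edges_def by blast
  next
    case True
    then obtain k where k: "{c, e} = {sh k p, sh k q}" "closed_segment c e = closed_segment (sh k p) (sh k q)"
      by (rule orbit_pairsE)
    define a' where "a' = sh (- k) a" define b' where "b' = sh (- k) b" define y' where "y' = sh (- k) y"
    have sab: "admissible a' b'" unfolding a'_def b'_def by (rule seg_sh[OF w(1)])
    have y': "y' \<in> closed_segment a' b'" "y' \<in> closed_segment p q" "y' \<notin> P"
      unfolding a'_def b'_def y'_def using w(3-5) k(2) sh_segment sh_segment' sh_P by blast+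
    have "excess c e y = excess (sh k p) (sh k q) (sh k y')" unfolding y'_def using chord_set[OF k(1)] by (simp add: excess_chord)
    then have "excess c e y = excess p q y'" unfolding excess_sh .
    moreover have "excess a b y = excess a' b' y'" unfolding a'_def b'_def y'_def excess_sh ..
    ultimately have lt: "chord p q y' < chord a' b' y'" using w(6) by (simp add: excess_chord)
    have yo: "y' \<in> open_segment p q" using y' D unfolding open_segment_def by auto
    have "dead ?E a' b'"
    proof (cases "y' = z")
      case True
      have "z \<in> closed_segment r s" using z unfolding open_segment_def by blast
      moreover have "excess r s z < excess a' b' z" using F(3) lt True by (simp add: excess_chord)
      ultimately show ?thesis unfolding dead_def using sab ed(1) y' True by blast
    next
      case False
      have tri: "dead ?E a' b'" if x: "x = p \<or> x = q" and yx: "y' \<in> closed_segment x z" for x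
      proof -
        obtain t where t: "0 \<le> t" "t \<le> 1" "y' = (1 - t) *\<^sub>R x + t *\<^sub>R z" using yx unfolding in_segment by blast
        have "x \<in> P" using x D by auto
        then have t': "0 < t" "t < 1" using t False y'(3) by (auto simp: less_le)
        have "chord p q y' = (1 - t) * chord p q x + t * chord p q z" unfolding t(3) affine_fnD[OF affine_chord] ..
        also have "chord p q x = (u x)\<^sup>2" using x by auto
        finally have "(1 - t) * (u x)\<^sup>2 + t * chord r s z < chord a' b' y'"
          using lt F(3) t' by (smt (verit) mult_strict_left_mono)
        moreover have "orient r s x \<noteq> 0" using diagonal_signs[OF E I] x by auto
        moreover have "(x, r) \<in> ?E" "(s, x) \<in> ?E" using ed x noncrossing_sym[OF E'] by auto
        ultimately show ?thesis
          using dead_in_triangle[OF E' _ ed(1) _ _ diagonal_triangle_P[OF E I x] z t' t(3) sab y'(1)] by blast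
      qed
      have "closed_segment p q = closed_segment p z \<union> closed_segment z q"
        using F(1) by (intro Un_closed_segment[symmetric]) (auto simp: open_segment_def)
      then have "y' \<in> closed_segment p z \<or> y' \<in> closed_segment q z" using y'(2) by (simp add: closed_segment_commute)
      then show ?thesis using tri by blast
    qed
    then have "dead ?E (sh k a') (sh k b')" by (rule dead_sh[OF E'])
    then show ?thesis unfolding a'_def b'_def by simp
  qed
qed

text \<open>The termination measure counts all admissible pairs that may still occur, not only
  current edges. The strip picks one translate of each ordered pair, which makes the count
  finite.\<close>

definition alive :: "edge_set \<Rightarrow> edge_set" where
  "alive E = {(a, b). admissible a b \<and> 0 \<le> u a \<and> u a < 1 \<and> \<not> dead E a b}"

lemma finite_alive: "finite (alive E)"
proof (rule finite_subset)
  show "alive E \<subseteq> {p \<in> P. - 1 \<le> u p \<and> u p \<le> 2} \<times> {p \<in> P. - 1 \<le> u p \<and> u p \<le> 2}"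
    unfolding alive_def admissible_def using W_width by fastforce
qed (use P_fin in auto)

text \<open>The pair that is lost is \<open>p q\<close>. An edge of \<open>E\<close> is never dead
  for \<open>E\<close>, since no other edge meets it outside \<open>P\<close>; after the flip the
  lower chord over \<open>r s\<close> makes \<open>p q\<close> dead at z.\<close>

lemma alive_flip_edges:
  assumes E: "max_noncrossing E" and I: "improving E p q r s z"
  shows "card (alive (flip_edges E p q r s)) < card (alive E)"
proof (rule psubset_card_mono[OF finite_alive])
  have Q: "quad E p q r s" and z: "z \<in> open_segment r s" using I unfolding improving_def by auto
  note D = quadD[OF E Q] and F = improving_flip[OF E I] and E' = flip_edges_noncrossing[OF E I] and ed = flip_edges_edges[OF E I]
  have sub: "alive (flip_edges E p q r s) \<subseteq> alive E" unfolding alive_def using dead_flip_edges[OF E I] by blast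
  have zs: "z \<in> closed_segment p q" "z \<in> closed_segment r s" using z F(1) unfolding open_segment_def by auto
  have "dead (flip_edges E p q r s) p q"
    unfolding dead_def using noncrossing_seg[OF E D(1)] ed(1) zs open_seg_notP[OF E D(1) F(1)] F(3) by (auto simp: excess_chord)
  then have 1: "dead (flip_edges E p q r s) (sh k p) (sh k q)" for k by (rule dead_sh[OF E'])
  have 2: "\<not> dead E (sh k p) (sh k q)" for k
  proof
    assume "dead E (sh k p) (sh k q)"
    then obtain c d y where *: "(c, d) \<in> E" "y \<in> closed_segment (sh k p) (sh k q)" "y \<in> closed_segment c d" "y \<notin> P"
      "excess c d y < excess (sh k p) (sh k q) y" unfolding dead_def by blast
    have eq: "{sh k p, sh k q} = {c, d}" using noncrossing_nc[OF E noncrossing_shift[OF E D(1)] *(1-4)] .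
    show False using *(5) unfolding excess_chord chord_set[OF eq] by simp
  qed
  define k where "k = - \<lfloor>u p\<rfloor>"
  have "0 \<le> u (sh k p)" "u (sh k p) < 1" unfolding k_def by (simp_all, linarith+)
  then have "(sh k p, sh k q) \<in> alive E - alive (flip_edges E p q r s)"
    unfolding alive_def using 1[of k] 2[of k] seg_sh[OF noncrossing_seg[OF E D(1)], of k] by auto
  then show "alive (flip_edges E p q r s) \<subset> alive E" using sub by blast
qed


section \<open>Locally optimal triangulations\<close>

definition loc_optimal :: "edge_set \<Rightarrow> bool" where
  "loc_optimal E \<longleftrightarrow> (\<forall>p q r s z. \<not> improving E p q r s z)"

text \<open>The combinatorial form of the boundary edges.\<close>

definition onesided :: "edge_set \<Rightarrow> edge_set" where
  "onesided E = {(a, b) \<in> E. u a < u b \<and> (below E a b \<longleftrightarrow> \<not> above E a b)}"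

lemma line_ht_sh: "line_ht (sh k a) (sh k b) (t + of_int k) = line_ht a b t"
  unfolding line_ht_def by simp

text \<open>Without improving flips the chord over \<open>r s\<close> is above the lifted line of
  \<open>p q\<close> where \<open>r s\<close> meets that line, even if this happens outside the
  segment \<open>p q\<close>. So the surface bends upwards across \<open>p q\<close> also when the
  quadrilateral is not convex.\<close>

lemma loc_optimal_bend:
  assumes "loc_optimal E" and Q: "quad E p q r s" and A: "affine_fn A" "A p = (u p)\<^sup>2" "A q = (u q)\<^sup>2" "A r = (u r)\<^sup>2"
    and upq: "u p < u q"
  shows "A s < (u s)\<^sup>2"
proof -
  obtain z where z: "z \<in> open_segment r s" "orient p q z = 0" using quad_diagonals_meet[OF Q] by blast
  then have lt: "chord p q z < chord r s z" using assms(1) Q unfolding loc_optimal_def improving_def by force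
  obtain x where x: "0 < x" "x < 1" "z = (1 - x) *\<^sub>R r + x *\<^sub>R s" using z(1) unfolding in_segment by blast
  \<comment> \<open>\<open>l\<close> may lie outside the unit interval; only affinity along the line
    through \<open>p\<close> and \<open>q\<close> matters.\<close>
  define l where "l = (u z - u p) / (u q - u p)"
  have lu: "l * (u q - u p) = u z - u p" using upq unfolding l_def by simp
  have "(u q - u p) * (v z - v p) = (u z - u p) * (v q - v p)" using z(2) unfolding orient_def by simp
  also have "\<dots> = (u q - u p) * (l * (v q - v p))" unfolding lu[symmetric] by simp
  finally have lv: "v z - v p = l * (v q - v p)" using upq by simp
  have zl: "z = (1 - l) *\<^sub>R p + l *\<^sub>R q"
    by (rule uv_eqI) (use lu lv in \<open>simp_all add: algebra_simps\<close>)
  have "A z = chord p q z" unfolding zl affine_fnD[OF A(1)] affine_fnD[OF affine_chord] A by simp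
  moreover have "A z = (1 - x) * (u r)\<^sup>2 + x * A s" unfolding x(3) affine_fnD[OF A(1)] A ..
  moreover have "chord r s z = (1 - x) * (u r)\<^sup>2 + x * (u s)\<^sup>2" unfolding x(3) affine_fnD[OF affine_chord] by simp
  ultimately have "x * A s < x * (u s)\<^sup>2" using lt by simp
  then show ?thesis using x by simp
qed

text \<open>The lifted surface of E is strictly convex along c d: look at a crossing where its height over
  the chord is maximal.\<close>
lemma crossing_below_chord:
  assumes E: "max_noncrossing E" and L: "loc_optimal E" and cd: "admissible c d" "(c, d) \<notin> E"
    and two: "\<And>a b y. \<lbrakk>(a, b) \<in> E; u a < u b; y \<in> closed_segment a b; y \<in> closed_segment c d; y \<notin> P\<rbrakk>
      \<Longrightarrow> below E a b \<and> above E a b"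
    and ab: "(a, b) \<in> E" "z \<in> closed_segment a b" "z \<in> closed_segment c d" "z \<notin> P"
  shows "excess a b z < excess c d z"
proof -
  define X where "X = {(y, a, b). (a, b) \<in> E \<and> u a < u b \<and> y \<in> closed_segment a b \<and> y \<in> closed_segment c d \<and> y \<notin> P}"
  have XQ: "\<exists>r s. quad E a b r s" if "(y, a, b) \<in> X" for y a b
  proof -
    have *: "(a, b) \<in> E" "u a < u b" "below E a b" "above E a b" using that two unfolding X_def by blast+
    show ?thesis using empty_triangle_below[OF E *(1-3)] empty_triangle_above[OF E *(1,2,4)] *(2)
      unfolding quad_def by blast
  qed
  have Xne: "{c, d} \<noteq> {a, b}" if "(y, a, b) \<in> X" for y a b
    using that cd noncrossing_sym[OF E] unfolding X_def by (auto simp: doubleton_eq_iff)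
  \<comment> \<open>The segment \<open>c d\<close> has points strictly off the line of
    \<open>a b\<close>, so it meets that line only once. Hence there are no more crossings than
    edges in a bounded strip, that is, finitely many.\<close>
  have Xuniq: "y = y'" if y: "(y, a, b) \<in> X" and y': "(y', a, b) \<in> X" for y y' a b
  proof -
    obtain r s where Q: "quad E a b r s" using XQ[OF y] by blast
    obtain w where w: "w \<in> closed_segment c d" "orient a b w < 0"
      using two_exits[OF E Q cd(1)] y Xne[OF y] unfolding X_def by blast
    have on: "orient a b x = 0" if "(x, a, b) \<in> X" for x
      using that in_seg_iff line_ht_orient_iff(3) unfolding X_def by blast
    obtain l where l: "y = (1 - l) *\<^sub>R c + l *\<^sub>R d" using y unfolding X_def in_segment by blast
    obtain l' where l': "y' = (1 - l') *\<^sub>R c + l' *\<^sub>R d" using y' unfolding X_def in_segment by blast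
    obtain k where k: "w = (1 - k) *\<^sub>R c + k *\<^sub>R d" using w unfolding in_segment by blast
    have e: "(1 - l) * orient a b c + l * orient a b d = 0" "(1 - l') * orient a b c + l' * orient a b d = 0"
      using on[OF y] on[OF y'] unfolding l l' orient_mix by simp_all
    have "(l - l') * (orient a b d - orient a b c) = 0" using e by (simp add: algebra_simps)
    moreover have "orient a b d \<noteq> orient a b c"
    proof
      assume eq: "orient a b d = orient a b c"
      then have "orient a b c = 0" using e(1) by (simp add: algebra_simps)
      then have "orient a b w = 0" unfolding k orient_mix eq by simp
      then show False using w(2) by simp
    qed
    ultimately have "l = l'" by simp
    then show ?thesis unfolding l l' by simp
  qed
  have Xfin: "finite X"
  proof (rule finite_imageD)
    show "inj_on (\<lambda>(y, a, b). (a, b)) X" using Xuniq by (auto simp: inj_on_def)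
    let ?Q = "{p \<in> P. min (u c) (u d) - 1 \<le> u p \<and> u p \<le> max (u c) (u d) + 1}"
    have "(a, b) \<in> ?Q \<times> ?Q" if "(y, a, b) \<in> X" for y a b
    proof -
      have y: "(a, b) \<in> E" "u a < u b" "y \<in> closed_segment a b" "y \<in> closed_segment c d" using that unfolding X_def by blast+
      have "u a \<le> u y" "u y \<le> u b" using y in_seg_iff by auto
      moreover have "min (u c) (u d) \<le> u y \<and> u y \<le> max (u c) (u d)"
        using y(4) in_seg_iff[of c d y] in_seg_iff[of d c y] seg_ne[OF cd(1)]
        by (cases "u c < u d") (auto simp: closed_segment_commute)
      moreover have "a \<in> P" "b \<in> P" "\<bar>u a - u b\<bar> < 1" using noncrossing_P[OF E y(1)] W_width by auto
      ultimately show ?thesis by auto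
    qed
    then have "(\<lambda>(y, a, b). (a, b)) ` X \<subseteq> ?Q \<times> ?Q" by auto
    then show "finite ((\<lambda>(y, a, b). (a, b)) ` X)" by (rule finite_subset) (use P_fin in auto)
  qed
  define D where "D = (\<lambda>(y, a, b). chord a b y - chord c d y)"
  \<comment> \<open>Suppose D is maximal at x with value at least 0, and continue the plane over the
    triangle \<open>p q r\<close> as A. At both exits the surface minus the chord is at most D x: at
    a crossing by maximality, at a vertex because it is 0. At \<open>w2\<close> the plane is
    strictly below the surface by \<open>loc_optimal_bend\<close>. Since A minus the chord is affine
    and equals D x between the exits, D x < D x follows.\<close>
  have Dmax_neg: "D x < 0" if x: "x \<in> X" and max: "\<And>x'. x' \<in> X \<Longrightarrow> D x' \<le> D x" for x
  proof (rule ccontr)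
    assume neg: "\<not> D x < 0"
    obtain y p q where xy: "x = (y, p, q)" by (cases x)
    have X: "(y, p, q) \<in> X" using x xy by simp
    have y: "(p, q) \<in> E" "u p < u q" "y \<in> closed_segment p q" "y \<in> closed_segment c d" "y \<notin> P"
      using X unfolding X_def by blast+
    obtain r s where Q: "quad E p q r s" using XQ[OF X] by blast
    note QD = quadD[OF E Q] and S = quad_sign[OF Q]
    obtain w1 w2 t where w: "w1 \<in> closed_segment c d" "w2 \<in> closed_segment c d"
      "w1 \<in> closed_segment p r \<union> closed_segment q r" "w2 \<in> closed_segment p s \<union> closed_segment q s"
      "0 < t" "t < 1" "y = (1 - t) *\<^sub>R w1 + t *\<^sub>R w2" "orient p q w1 < 0" "orient p q w2 > 0"
      using two_exits[OF E Q cd(1) y(4,3,5) Xne[OF X]] by blast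
    have bound: "chord g h e - chord c d e \<le> D x"
      if gh: "(g, h) \<in> E" "e \<in> closed_segment g h" "e \<in> closed_segment c d" for g h e
    proof (cases "e \<in> P")
      case True
      then have "e = g \<or> e = h" "e = c \<or> e = d"
        using seg_P[OF noncrossing_seg[OF E gh(1)] gh(2)] seg_P[OF cd(1) gh(3)] by blast+
      then have "chord g h e - chord c d e = 0" by auto
      then show ?thesis using neg by simp
    next
      case False
      obtain g' h' where g: "(g', h') \<in> E" "u g' < u h'" "e \<in> closed_segment g' h'" "{g, h} = {g', h'}"
        using oriented[OF E gh(1,2)] by metis
      have "(e, g', h') \<in> X" unfolding X_def using g gh False by blast
      then have "chord g' h' e - chord c d e \<le> D x" using max[of "(e, g', h')"] unfolding D_def by simp
      then show ?thesis unfolding chord_set[OF g(4)] .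
    qed
    have "orient p q r \<noteq> 0" using S by simp
    from affine_interpolation[OF this] obtain A
      where A: "affine_fn A" "A p = (u p)\<^sup>2" "A q = (u q)\<^sup>2" "A r = (u r)\<^sup>2" by metis
    have As: "A s < (u s)\<^sup>2" by (rule loc_optimal_bend[OF L Q A y(2)])
    have 1: "A w1 - chord c d w1 \<le> D x"
      using w(3)
    proof
      assume i: "w1 \<in> closed_segment p r"
      show ?thesis unfolding affine_eq_chord[OF A(1,2,4) i] by (rule bound[OF QD(2) i w(1)])
    next
      assume i: "w1 \<in> closed_segment q r"
      show ?thesis unfolding affine_eq_chord[OF A(1,3,4) i] by (rule bound[OF QD(3) i w(1)])
    qed
    have 2: "A w2 < chord g s w2" if i: "w2 \<in> closed_segment g s" and g: "g = p \<or> g = q" for g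
    proof -
      obtain k where k: "0 \<le> k" "w2 = (1 - k) *\<^sub>R g + k *\<^sub>R s" using i unfolding in_segment by blast
      have "k \<noteq> 0" using k w(9) g by auto
      then have "k * A s < k * (u s)\<^sup>2" using As k by simp
      moreover have "A g = (u g)\<^sup>2" using g A by auto
      ultimately show ?thesis unfolding k(2) affine_fnD[OF A(1)] affine_fnD[OF affine_chord] by simp
    qed
    have 3: "A w2 - chord c d w2 < D x"
      using w(4)
    proof
      assume i: "w2 \<in> closed_segment p s"
      then show ?thesis using 2[OF i] bound[OF QD(4) i w(2)] by simp
    next
      assume i: "w2 \<in> closed_segment q s"
      then show ?thesis using 2[OF i] bound[OF QD(5) i w(2)] by simp
    qed
    have "D x = A y - chord c d y" unfolding xy D_def using affine_eq_chord[OF A(1-3) y(3)] by simp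
    also have "\<dots> = (1 - t) * (A w1 - chord c d w1) + t * (A w2 - chord c d w2)"
      unfolding w(7) affine_fnD[OF A(1)] affine_fnD[OF affine_chord] by (simp add: algebra_simps)
    also have "\<dots> < (1 - t) * D x + t * D x"
      using 1 3 w(5,6) by (intro add_le_less_mono mult_left_mono mult_strict_left_mono) auto
    also have "\<dots> = D x" by (simp add: algebra_simps)
    finally show False by simp
  qed
  obtain a' b' where ab': "(a', b') \<in> E" "u a' < u b'" "z \<in> closed_segment a' b'" "{a, b} = {a', b'}"
    using oriented[OF E ab(1,2)] by metis
  have zX: "(z, a', b') \<in> X" unfolding X_def using ab' ab by blast
  then have fin: "finite (D ` X)" "D ` X \<noteq> {}" using Xfin by auto
  then obtain x where x: "x \<in> X" "D x = Max (D ` X)" using Max_in[OF fin] by force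
  then have max: "D x' \<le> D x" if "x' \<in> X" for x' using Max_ge[OF fin(1)] that by simp
  have "D x < 0" by (rule Dmax_neg[OF x(1) max])
  then have "D (z, a', b') < 0" using max[OF zX] by linarith
  then have "chord a' b' z < chord c d z" unfolding D_def by simp
  then show ?thesis unfolding excess_chord chord_set[OF ab'(4)] by simp
qed

text \<open>A onesided edge of E1 is also in E2 and cannot be crossed there, so the case to exclude
  is that nothing of E1 is above or below \<open>a b\<close>. Then no vertex lies over the inside of
  \<open>a b\<close>, so the crossing edge \<open>e f\<close> spans it, and \<open>a\<close> or
  \<open>b\<close> is above \<open>e f\<close>. Hence E2 has edges above the crossing point. The
  highest of them in this column is onesided in E2, so it belongs to E1 and lies above
  \<open>a b\<close>, a contradiction.\<close>

lemma two_sided_crossing: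
  assumes E1: "max_noncrossing E1" and E2: "max_noncrossing E2" and O1: "onesided E1 \<subseteq> E2" and O2: "onesided E2 \<subseteq> E1"
    and ab: "(a, b) \<in> E1" "u a < u b" "z \<in> closed_segment a b" and cd: "(c, d) \<in> E2" "z \<in> closed_segment c d"
    and z: "z \<notin> P" and ne: "{a, b} \<noteq> {c, d}"
  shows "below E1 a b \<and> above E1 a b"
proof (rule ccontr)
  assume n: "\<not> ?thesis"
  have "(a, b) \<notin> E2" using noncrossing_nc[OF E2 _ cd(1) ab(3) cd(2) z] ne by blast
  then have "(a, b) \<notin> onesided E1" using O1 by blast
  then have nb: "\<not> below E1 a b" "\<not> above E1 a b" using n ab unfolding onesided_def by auto
  obtain e f where ef: "(e, f) \<in> E2" "u e < u f" "z \<in> closed_segment e f" "{c, d} = {e, f}"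
    using oriented[OF E2 cd] by metis
  have P: "a \<in> P" "b \<in> P" "e \<in> P" "f \<in> P" using noncrossing_P[OF E1 ab(1)] noncrossing_P[OF E2 ef(1)] by auto
  have noP: False if "p \<in> P" "u a < u p" "u p < u b" for p
  proof -
    have "v p \<noteq> line_ht a b (u p)" by (rule edge_P[OF E1 ab(1,2) that])
    then show False using nb that unfolding below_def above_def by (metis UnI2 linorder_neqE)
  qed
  have nocov: "v w = line_ht a b (u w)" if "w \<in> cov E1" "u a < u w" "u w < u b" for w
    using nb that unfolding below_def above_def by (metis UnI1 linorder_neqE)
  have zab: "z \<in> open_segment a b" "z \<in> open_segment e f" using ab ef z P unfolding open_segment_def by auto
  define t where "t = u z"
  have t: "u a < t" "t < u b" "u e < t" "t < u f" and vz: "v z = line_ht a b t" "v z = line_ht e f t"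
    using zab in_open_seg_iff ab(2) ef(2) unfolding t_def by auto
  have ue: "u e \<le> u a" "u b \<le> u f" using noP[OF P(3)] noP[OF P(4)] t by fastforce+
  have neq: "\<not> (v a = line_ht e f (u a) \<and> v b = line_ht e f (u b))"
  proof
    assume "v a = line_ht e f (u a) \<and> v b = line_ht e f (u b)"
    then have "a \<in> closed_segment e f" "b \<in> closed_segment e f" using in_seg_iff[OF ef(2)] ue ab(2) t by auto
    then have "a = e \<or> a = f" "b = e \<or> b = f" using seg_P[OF noncrossing_seg[OF E2 ef(1)]] P by blast+
    then show False using ne ef(2,4) ab(2) by auto
  qed
  have eqt: "line_ht a b t = line_ht e f t" using vz by simp
  have "v a > line_ht e f (u a) \<or> v b > line_ht e f (u b)"
  proof (rule ccontr)
    assume "\<not> ?thesis"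
    then have "line_ht a b x = line_ht e f x" for x
      by (intro line_ht_lin_touch[OF t(1,2) _ _ eqt]) (use ab(2) in auto)
    then show False using neq by (metis line_ht_ends ab(2) less_irrefl)
  qed
  moreover have "u a \<noteq> u e" if "v a > line_ht e f (u a)"
  proof
    assume "u a = u e"
    then have "a = e" using P_eqI P by blast
    then show False using that by simp
  qed
  moreover have "u b \<noteq> u f" if "v b > line_ht e f (u b)"
  proof
    assume "u b = u f"
    then have "b = f" using P_eqI P by blast
    then show False using that ef(2) by simp
  qed
  ultimately have "(v a > line_ht e f (u a) \<and> u e < u a) \<or> (v b > line_ht e f (u b) \<and> u b < u f)"
    using ue by (metis less_eq_real_def)
  moreover have "u a < u f" "u e < u b" using ue t by linarith+
  ultimately have "\<exists>w\<in>P. u e < u w \<and> u w < u f \<and> v w > line_ht e f (u w)"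
    using P by blast
  then have "above E2 e f" unfolding above_def by blast
  then obtain w where w: "w \<in> cov E2" "u w = t" "v w > line_ht e f t"
    using above_column[OF E2 ef(1,2) _ t(3,4)] by blast
  \<comment> \<open>The highest edge of E2 in the column has z below it and nothing above it, so it
    is onesided.\<close>
  let ?H = "{v w |w. w \<in> cov E2 \<union> P \<and> u w = t}"
  have fin: "finite ?H" by (rule finite_column[OF E2])
  have wH: "v w \<in> ?H" using w by blast
  have "Max ?H \<in> ?H" using Max_in[OF fin] wH by blast
  then obtain x where x: "x \<in> cov E2 \<union> P" "u x = t" "Max ?H = v x" by blast
  have max: "v x' \<le> v x" if "x' \<in> cov E2 \<union> P" "u x' = t" for x'
    unfolding x(3)[symmetric] using that by (intro Max_ge[OF fin]) blast
  have xP: "x \<notin> P" using noP[of x] x t by auto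
  then have "x \<in> cov E2" using x by blast
  then obtain g h where gh: "(g, h) \<in> E2" "u g < u h" "u g \<le> u x" "u x \<le> u h" "v x = line_ht g h (u x)" "x \<in> closed_segment g h"
    using cov_edge[OF E2] by metis
  have "g \<in> P" "h \<in> P" using noncrossing_P[OF E2 gh(1)] by auto
  then have "x \<in> open_segment g h" using gh(6) xP unfolding open_segment_def by auto
  then have tgh: "u g < t" "t < u h" using in_open_seg_iff[OF gh(2)] x(2) by auto
  have zx: "v z < v x" using max[of w] w vz by auto
  have "z \<in> cov E2" using covI[OF ef(1,3)] .
  then have "below E2 g h" unfolding below_def using zx gh(5) tgh x(2) t_def by (intro bexI[of _ z]) auto
  moreover have "\<not> above E2 g h"
  proof
    assume "above E2 g h"
    then obtain y where "y \<in> cov E2" "u y = t" "v y > line_ht g h t"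
      using above_column[OF E2 gh(1,2) _ tgh] by blast
    then show False using max[of y] gh(5) x(2) by auto
  qed
  ultimately have "(g, h) \<in> onesided E2" unfolding onesided_def using gh by blast
  then have "x \<in> cov E1" using O2 covI[OF _ gh(6)] by blast
  then show False using nocov[of x] x(2) t zx vz by auto
qed

lemma loc_optimal_subset:
  assumes E1: "max_noncrossing E1" "loc_optimal E1" and E2: "max_noncrossing E2" "loc_optimal E2"
    and O: "onesided E1 \<subseteq> E2" "onesided E2 \<subseteq> E1"
  shows "E2 \<subseteq> E1"
proof (rule ccontr)
  assume "\<not> ?thesis"
  then obtain c d where cd: "(c, d) \<in> E2" "(c, d) \<notin> E1" by auto
  have scd: "admissible c d" by (rule noncrossing_seg[OF E2(1) cd(1)])
  from noncrossing_max[OF E1(1) scd cd(2)] obtain a b z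
    where z: "(a, b) \<in> E1" "z \<in> closed_segment c d" "z \<in> closed_segment a b" "z \<notin> P" by blast
  have ne1: "{a', b'} \<noteq> {c, d}" if "(a', b') \<in> E1" for a' b'
    using that cd(2) noncrossing_sym[OF E1(1)] by (auto simp: doubleton_eq_iff)
  have nab: "(a, b) \<notin> E2" using noncrossing_nc[OF E2(1) _ cd(1) z(3,2,4)] ne1[OF z(1)] by blast
  have ne2: "{c', d'} \<noteq> {a, b}" if "(c', d') \<in> E2" for c' d'
    using that nab noncrossing_sym[OF E2(1)] by (auto simp: doubleton_eq_iff)
  have "excess a b z < excess c d z"
    using crossing_below_chord[OF E1 scd cd(2) _ z(1,3,2,4)]
      two_sided_crossing[OF E1(1) E2(1) O _ _ _ cd(1) _ _ ne1] by blast
  moreover have "excess c d z < excess a b z"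
    using crossing_below_chord[OF E2 noncrossing_seg[OF E1(1) z(1)] nab _ cd(1) z(2,3,4)]
      two_sided_crossing[OF E2(1) E1(1) O(2,1) _ _ _ z(1) _ _ ne2] by blast
  ultimately show False by simp
qed


section \<open>Onesided edges and triangles under a flip\<close>

lemma orbit_pairs_oriented:
  assumes "(a, b) \<in> orbit_pairs p q" "u a < u b" "u p < u q"
  obtains k where "a = sh k p" "b = sh k q"
  using assms unfolding orbit_pairs_def by auto

lemma orbit_pairs_commute: "orbit_pairs p q = orbit_pairs q p"
  unfolding orbit_pairs_def by auto

lemma below_sh_edge:
  assumes E: "max_noncrossing E" and r: "(p, r) \<in> E" "(q, r) \<in> E" and pq: "u p < u q" "v r < line_ht p q (u r)"
  shows "below E (sh k p) (sh k q)"
proof -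
  let ?t = "(u p + u q) / 2"
  obtain w where w: "w \<in> closed_segment p r \<or> w \<in> closed_segment q r" "u w = ?t" "v w < line_ht p q ?t"
    using column_exit[OF pq, of ?t] pq(1) by auto
  have "sh k w \<in> closed_segment (sh k p) (sh k r) \<or> sh k w \<in> closed_segment (sh k q) (sh k r)"
    using w(1) sh_segment by blast
  then have "sh k w \<in> cov E" using noncrossing_shift[OF E r(1), of k] noncrossing_shift[OF E r(2), of k] covI by blast
  moreover have "line_ht (sh k p) (sh k q) (u (sh k w)) = line_ht p q ?t"
    by (simp only: u_simps uv_shift line_ht_sh w(2))
  then have "v (sh k w) < line_ht (sh k p) (sh k q) (u (sh k w))" using w(3) by simp
  moreover have "u (sh k p) < u (sh k w)" "u (sh k w) < u (sh k q)" using w(2) pq(1) by auto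
  ultimately show ?thesis unfolding below_def by blast
qed

lemma above_sh_edge:
  assumes "max_noncrossing E" "(p, r) \<in> E" "(q, r) \<in> E" "u p < u q" "v r > line_ht p q (u r)"
  shows "above E (sh k p) (sh k q)"
  using sweep_frame.below_sh_edge[OF mirror assms(1-4)] assms(5) unfolding mirror_line_ht mirror_below by simp

text \<open>The witness is taken on a side of the triangle below \<open>a b\<close>. If that side is
  a removed translate of \<open>p q\<close>, the same translates of \<open>p r\<close> and
  \<open>q r\<close> provide a still lower point in the column. \<open>E2\<close> is kept abstract
  so that the lemma serves the flip and its reverse.\<close>

lemma below_transfer:
  assumes E: "max_noncrossing E" and E2: "max_noncrossing E2" and sub: "\<And>a b. (a, b) \<in> E \<Longrightarrow> (a, b) \<notin> orbit_pairs p q \<Longrightarrow> (a, b) \<in> E2"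
    and r: "(p, r) \<in> E2" "(q, r) \<in> E2" and pq: "(p, q) \<in> E" "u p < u q" "v r < line_ht p q (u r)"
    and ab: "(a, b) \<in> E" "u a < u b" "below E a b"
  shows "below E2 a b"
proof -
  define t where "t = (u a + u b) / 2"
  have t: "u a < t" "t < u b" using ab(2) unfolding t_def by auto
  obtain c where c: "v c < line_ht a b (u c)" "empty_triangle E a b c"
    using empty_triangle_below[OF E ab] by blast
  obtain w where w: "w \<in> closed_segment a c \<or> w \<in> closed_segment b c" "u w = t" "v w < line_ht a b t"
    using column_exit[OF ab(2) c(1) t] by blast
  then obtain g h where gh: "(g, h) \<in> E" "w \<in> closed_segment g h"
    using c(2) unfolding empty_triangle_def by blast
  show ?thesis
  proof (cases "w \<in> P \<or> (g, h) \<in> E2")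
    case True
    then have "w \<in> cov E2 \<union> P" using covI[OF _ gh(2)] by blast
    then show ?thesis unfolding below_def using w t by blast
  next
    case False
    then have "(g, h) \<in> orbit_pairs p q" using sub[OF gh(1)] by blast
    then obtain k where k: "closed_segment g h = closed_segment (sh k p) (sh k q)" by (rule orbit_pairsE)
    let ?w = "sh (- k) w"
    have P: "p \<in> P" "q \<in> P" using noncrossing_P[OF E pq(1)] by auto
    have "?w \<in> closed_segment p q" "?w \<notin> P" using gh(2) False k sh_segment' sh_P by blast+
    then have "?w \<in> open_segment p q" using P unfolding open_segment_def by auto
    then have o: "u p < u ?w" "u ?w < u q" "v ?w = line_ht p q (u ?w)" using in_open_seg_iff[OF pq(2)] by blast+
    obtain x where x: "x \<in> closed_segment p r \<or> x \<in> closed_segment q r" "u x = u ?w" "v x < v ?w"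
      using column_exit[OF pq(2,3) o(1,2)] o(3) by auto
    have "sh k x \<in> closed_segment (sh k p) (sh k r) \<or> sh k x \<in> closed_segment (sh k q) (sh k r)"
      using x(1) sh_segment by blast
    then have "sh k x \<in> cov E2" using noncrossing_shift[OF E2 r(1), of k] noncrossing_shift[OF E2 r(2), of k] covI by blast
    moreover have "u (sh k x) = t" "v (sh k x) < line_ht a b t" using x w by simp_all
    ultimately show ?thesis unfolding below_def using t by blast
  qed
qed

lemma above_transfer:
  assumes "max_noncrossing E" "max_noncrossing E2" "\<And>a b. (a, b) \<in> E \<Longrightarrow> (a, b) \<notin> orbit_pairs p q \<Longrightarrow> (a, b) \<in> E2"
    "(p, s) \<in> E2" "(q, s) \<in> E2" "(p, q) \<in> E" "u p < u q" "v s > line_ht p q (u s)"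
    "(a, b) \<in> E" "u a < u b" "above E a b"
  shows "above E2 a b"
  using sweep_frame.below_transfer[OF mirror assms(1-7) _ assms(9,10)] assms(8,11)
  unfolding mirror_line_ht mirror_below by simp

text \<open>After the renaming the new diagonal runs from left to right, so that the transfer lemmas
  also apply to the reverse flip, with \<open>r' s'\<close> as the removed edge.\<close>

lemma flip_edges_orient:
  assumes E: "max_noncrossing E" and I: "improving E p q r s z"
  obtains r' s' p' q' where "{r', s'} = {r, s}" "{p', q'} = {p, q}" "u r' < u s'"
    "v p' < line_ht r' s' (u p')" "v q' > line_ht r' s' (u q')" "orbit_pairs r' s' = orbit_pairs r s"
proof (cases "u r < u s")
  case True
  show ?thesis
    using diagonal_signs[OF E I] line_ht_orient_iff[OF True] True by (intro that[of r s q p]) auto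
next
  case False
  then have sr: "u s < u r" using improving_flip(4)[OF E I] by simp
  have "orient s r p < 0" "orient s r q > 0" using diagonal_signs[OF E I] orient_swap[of s r p] orient_swap[of s r q] by simp_all
  then have "v p < line_ht s r (u p)" "v q > line_ht s r (u q)" using line_ht_orient_iff[OF sr] by blast+
  then show ?thesis
    using sr by (intro that[of s r p q] orbit_pairs_commute) auto
qed

text \<open>Both diagonals have something on either side, so neither is ever onesided; for all other
  edges \<open>below\<close> and \<open>above\<close> carry over in both directions.\<close>

lemma onesided_flip_edges:
  assumes E: "max_noncrossing E" and I: "improving E p q r s z"
  shows "onesided (flip_edges E p q r s) = onesided E"
proof -
  let ?E = "flip_edges E p q r s"
  have Q: "quad E p q r s" using I unfolding improving_def by auto
  note D = quadD[OF E Q] and E' = flip_edges_noncrossing[OF E I] and ed = flip_edges_edges[OF E I]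
  have lr: "v r < line_ht p q (u r)" "v s > line_ht p q (u s)" using Q unfolding quad_def by auto
  have sub: "(a, b) \<in> ?E" if "(a, b) \<in> E" "(a, b) \<notin> orbit_pairs p q" for a b using that unfolding flip_edges_def by blast
  obtain r' s' p' q' where o: "{r', s'} = {r, s}" "{p', q'} = {p, q}" "u r' < u s'"
    "v p' < line_ht r' s' (u p')" "v q' > line_ht r' s' (u q')" "orbit_pairs r' s' = orbit_pairs r s"
    by (rule flip_edges_orient[OF E I])
  have sub': "(a, b) \<in> E" if "(a, b) \<in> ?E" "(a, b) \<notin> orbit_pairs r' s'" for a b
    using that unfolding flip_edges_def o(6) by blast
  have ed': "(r', p') \<in> E" "(s', p') \<in> E" "(r', q') \<in> E" "(s', q') \<in> E"
    "(r', p') \<in> ?E" "(s', p') \<in> ?E" "(r', q') \<in> ?E" "(s', q') \<in> ?E" "(r', s') \<in> ?E"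
    using o(1,2) D ed noncrossing_sym[OF E] noncrossing_sym[OF E'] by (auto simp: doubleton_eq_iff)
  have bel: "below ?E a b \<longleftrightarrow> below E a b" "above ?E a b \<longleftrightarrow> above E a b"
    if ab: "(a, b) \<in> E" "(a, b) \<in> ?E" "u a < u b" for a b
    using below_transfer[OF E E' sub ed(2,3) D(1,10) lr(1) ab(1,3)] above_transfer[OF E E' sub ed(4,5) D(1,10) lr(2) ab(1,3)]
      below_transfer[OF E' E sub' ed'(1,2,9) o(3,4) ab(2,3)] above_transfer[OF E' E sub' ed'(3,4,9) o(3,5) ab(2,3)]
    by blast+
  have 1: "(a, b) \<notin> orbit_pairs p q" if m: "(a, b) \<in> onesided E" for a b
  proof
    assume "(a, b) \<in> orbit_pairs p q"
    then obtain k where "a = sh k p" "b = sh k q" using orbit_pairs_oriented D(10) m unfolding onesided_def by blast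
    then show False using m below_sh_edge[OF E D(2,3,10) lr(1), of k] above_sh_edge[OF E D(4,5,10) lr(2), of k]
      unfolding onesided_def by blast
  qed
  have 2: "(a, b) \<notin> orbit_pairs r s" if m: "(a, b) \<in> onesided ?E" for a b
  proof
    assume "(a, b) \<in> orbit_pairs r s"
    then obtain k where "a = sh k r'" "b = sh k s'"
      using orbit_pairs_oriented[of a b r' s'] o(3) m unfolding onesided_def o(6) by blast
    then show False using m below_sh_edge[OF E' ed'(5,6) o(3,4), of k] above_sh_edge[OF E' ed'(7,8) o(3,5), of k]
      unfolding onesided_def by blast
  qed
  have "(a, b) \<in> onesided ?E \<longleftrightarrow> (a, b) \<in> onesided E" for a b
  proof
    assume a: "(a, b) \<in> onesided ?E"
    then have "(a, b) \<in> ?E" "(a, b) \<in> E" "u a < u b" using 2[OF a] unfolding onesided_def flip_edges_def by blast+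
    then show "(a, b) \<in> onesided E" using a bel unfolding onesided_def by blast
  next
    assume a: "(a, b) \<in> onesided E"
    then have "(a, b) \<in> E" "(a, b) \<in> ?E" "u a < u b" using 1[OF a] unfolding onesided_def flip_edges_def by blast+
    then show "(a, b) \<in> onesided ?E" using a bel unfolding onesided_def by blast
  qed
  then show ?thesis by auto
qed

text \<open>The segment from the midpoint of \<open>r s\<close> to \<open>c\<close> leaves the
  triangle \<open>r s x\<close> through \<open>r x\<close> or \<open>s x\<close>. Before reaching
  \<open>c\<close> it is inside the empty triangle \<open>r s c\<close>, so the exit is
  \<open>c\<close> itself, a vertex on one of these edges.\<close>

lemma empty_triangle_apex:
  assumes E: "max_noncrossing E" and T: "empty_triangle E r s c" and x: "(r, x) \<in> E" "(s, x) \<in> E"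
    and side: "orient r s c / orient r s x > 0" and c: "c \<notin> interior (convex hull {r, s, x})"
  shows "c = x"
proof -
  have n: "orient r s x \<noteq> 0" "orient r s c \<noteq> 0" using side by auto
  have rs: "(r, s) \<in> E" "(r, c) \<in> E" using T unfolding empty_triangle_def by auto
  have "r \<noteq> s" "c \<in> P" using noncrossing_P[OF E] rs by blast+
  let ?z = "midpoint r s"
  have z: "?z \<in> open_segment r s" using \<open>r \<noteq> s\<close> by simp
  obtain t where t: "0 < t" "t \<le> 1" "(1 - t) *\<^sub>R ?z + t *\<^sub>R c \<in> closed_segment r x \<union> closed_segment s x"
    using exit_triangle[OF n(1) z side c] by blast
  have "t = 1"
  proof (rule ccontr)
    assume "t \<noteq> 1"
    then have "(1 - (1 - t)) *\<^sub>R c + (1 - t) *\<^sub>R ?z \<in> interior (convex hull {r, s, c})"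
      using t by (intro interior_cone[OF n(2) z]) auto
    moreover have "(1 - (1 - t)) *\<^sub>R c + (1 - t) *\<^sub>R ?z \<in> cov E"
      using t(3) x covI by (auto simp: add.commute)
    ultimately show False using T unfolding empty_triangle_def by blast
  qed
  then have "c \<in> closed_segment r x \<union> closed_segment s x" using t(3) by simp
  then have "c = r \<or> c = s \<or> c = x"
    using seg_P[OF noncrossing_seg[OF E x(1)] _ \<open>c \<in> P\<close>] seg_P[OF noncrossing_seg[OF E x(2)] _ \<open>c \<in> P\<close>] by blast
  then show ?thesis using n by auto
qed

text \<open>Emptiness is not checked directly: the general lemmas give an empty triangle on each
  side of the new diagonal, and \<open>empty_triangle_apex\<close> identifies its apex with
  \<open>p\<close> or \<open>q\<close>.\<close>

lemma flip_edges_triangles: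
  assumes E: "max_noncrossing E" and I: "improving E p q r s z"
  shows "empty_triangle (flip_edges E p q r s) r s p" "empty_triangle (flip_edges E p q r s) r s q"
proof -
  let ?E = "flip_edges E p q r s"
  have Q: "quad E p q r s" using I unfolding improving_def by auto
  note D = quadD[OF E Q] and E' = flip_edges_noncrossing[OF E I] and ed = flip_edges_edges[OF E I]
  obtain r' s' p' q' where o: "{r', s'} = {r, s}" "{p', q'} = {p, q}" "u r' < u s'"
    "v p' < line_ht r' s' (u p')" "v q' > line_ht r' s' (u q')" "orbit_pairs r' s' = orbit_pairs r s"
    by (rule flip_edges_orient[OF E I])
  have ed': "(r', p') \<in> ?E" "(s', p') \<in> ?E" "(r', q') \<in> ?E" "(s', q') \<in> ?E" "(r', s') \<in> ?E"
    using o(1,2) ed noncrossing_sym[OF E'] by (auto simp: doubleton_eq_iff)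
  have hullP: "w \<notin> interior (convex hull {r', s', x})" if "w \<in> P" "x = p \<or> x = q" for w x
  proof -
    have "{r', s', x} = {r, s, x}" using o(1) by auto
    then show ?thesis using diagonal_triangle_P[OF E I that(2,1)] by simp
  qed
  have b: "below ?E r' s'" using below_sh_edge[OF E' ed'(1,2) o(3,4), of 0] by simp
  have a: "above ?E r' s'" using above_sh_edge[OF E' ed'(3,4) o(3,5), of 0] by simp
  have "empty_triangle ?E r' s' p'"
  proof -
    obtain c where c: "v c < line_ht r' s' (u c)" "empty_triangle ?E r' s' c"
      using empty_triangle_below[OF E' ed'(5) o(3) b] by blast
    have "c \<in> P" using c(2) noncrossing_P[OF E'] unfolding empty_triangle_def by blast
    then have "c \<notin> interior (convex hull {r', s', p'})" using hullP o(2) by blast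
    moreover have "orient r' s' c / orient r' s' p' > 0" using c(1) o(4) line_ht_orient_iff(1)[OF o(3)] by (simp add: divide_neg_neg)
    ultimately show ?thesis using empty_triangle_apex[OF E' c(2) ed'(1,2)] c(2) by blast
  qed
  moreover have "empty_triangle ?E r' s' q'"
  proof -
    obtain c where c: "v c > line_ht r' s' (u c)" "empty_triangle ?E r' s' c"
      using empty_triangle_above[OF E' ed'(5) o(3) a] by blast
    have "c \<in> P" using c(2) noncrossing_P[OF E'] unfolding empty_triangle_def by blast
    then have "c \<notin> interior (convex hull {r', s', q'})" using hullP o(2) by blast
    moreover have "orient r' s' c / orient r' s' q' > 0" using c(1) o(5) line_ht_orient_iff(2)[OF o(3)] by simp
    ultimately show ?thesis using empty_triangle_apex[OF E' c(2) ed'(3,4)] c(2) by blast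
  qed
  ultimately have "empty_triangle ?E r s p' \<and> empty_triangle ?E r s q'"
    using o(1) empty_triangle_perm(1)[OF E'] by (auto simp: doubleton_eq_iff)
  then show "empty_triangle ?E r s p" "empty_triangle ?E r s q" using o(2) by (auto simp: doubleton_eq_iff)
qed

lemma edge_subset_hulls:
  assumes E: "max_noncrossing E" and I: "improving E p q r s z"
  shows "closed_segment p q \<subseteq> convex hull {r, s, p} \<union> convex hull {r, s, q}"
proof -
  have z: "z \<in> closed_segment r s" using I unfolding improving_def open_segment_def by auto
  then have "z \<in> convex hull {r, s}" by (simp add: segment_convex_hull)
  then have zz: "z \<in> convex hull {r, s, p}" "z \<in> convex hull {r, s, q}"
    using hull_mono[of "{r, s}" "{r, s, p}"] hull_mono[of "{r, s}" "{r, s, q}"] by blast+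
  have "closed_segment p q = closed_segment p z \<union> closed_segment z q"
    using improving_flip(1)[OF E I] by (intro Un_closed_segment[symmetric]) (auto simp: open_segment_def)
  moreover have "closed_segment p z \<subseteq> convex hull {r, s, p}" "closed_segment z q \<subseteq> convex hull {r, s, q}"
    by (intro closed_segment_subset zz convex_convex_hull hull_inc; simp)+
  ultimately show ?thesis by blast
qed

end

section \<open>The triangulated region\<close>

text \<open>Independent of the coordinates u and v, so that it is the same set for a frame and its
  mirror image.\<close>

definition region :: "complex set \<Rightarrow> edge_set \<Rightarrow> complex set" where
  "region Q E = \<Union>{convex hull {p, q, r} | p q r. p \<in> Q \<and> q \<in> Q \<and> r \<in> Q \<and> \<not> collinear {p, q, r} \<and>
     interior (convex hull {p, q, r}) \<in> components (- cov E)}"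

context sweep_frame
begin

lemma continuous_u: "continuous_on A u" and continuous_v: "continuous_on A v"
  using u_lin v_lin by (simp_all add: linear_continuous_on linear_conv_bounded_linear)

lemma continuous_orient: "continuous_on A (orient a b)"
  unfolding orient_def by (intro continuous_intros continuous_on_subset[OF continuous_u] continuous_on_subset[OF continuous_v]) auto

text \<open>Local finiteness: an edge meeting the strip of half-width 1 around z has both ends
  within 2 of u z. The subset \<open>F\<close> allows an edge to be left out, as
  \<open>edge_neighbourhood\<close> requires.\<close>

lemma closed_cov:
  assumes E: "max_noncrossing E" and sub: "F \<subseteq> E"
  shows "closed (cov F)"
proof -
  have "\<exists>T. open T \<and> z \<in> T \<and> T \<subseteq> - cov F" if z: "z \<in> - cov F" for z
  proof -
    define Q where "Q = {p \<in> P. u z - 2 \<le> u p \<and> u p \<le> u z + 2}"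
    define G where "G = F \<inter> (Q \<times> Q)"
    have "finite G" unfolding G_def Q_def using P_fin by (intro finite_Int disjI2 finite_cartesian_product) auto
    then have "closed (cov G)" unfolding cov_def by (auto intro: closed_UN)
    moreover have "open {y. \<bar>u y - u z\<bar> < 1}"
      by (intro open_Collect_less continuous_intros continuous_u)
    ultimately have o: "open ({y. \<bar>u y - u z\<bar> < 1} - cov G)" by (simp add: open_Diff)
    have "y \<notin> cov F" if y: "\<bar>u y - u z\<bar> < 1" "y \<notin> cov G" for y
    proof
      assume "y \<in> cov F"
      then obtain a b where ab: "(a, b) \<in> F" "y \<in> closed_segment a b" unfolding cov_def by auto
      have abE: "(a, b) \<in> E" using ab sub by blast
      have w: "\<bar>u a - u b\<bar> < 1" "a \<in> P" "b \<in> P" using noncrossing_P[OF E abE] W_width by auto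
      have "min (u a) (u b) \<le> u y \<and> u y \<le> max (u a) (u b)"
        using ab(2) in_seg_iff[of a b y] in_seg_iff[of b a y] noncrossing_P[OF E abE]
        by (cases "u a < u b") (auto simp: closed_segment_commute)
      then have "(a, b) \<in> G" unfolding G_def Q_def using ab(1) w y(1) by auto
      then show False using covI[OF _ ab(2)] y(2) by blast
    qed
    moreover have "z \<notin> cov G" using z unfolding G_def cov_def by auto
    ultimately show ?thesis using o by (intro exI[of _ "{y. \<bar>u y - u z\<bar> < 1} - cov G"]) auto
  qed
  then show ?thesis unfolding closed_def by (subst open_subopen) blast
qed

lemma triangle_interior_nonempty:
  assumes "\<not> collinear {p, q, r :: complex}"
  shows "interior (convex hull {p, q, r}) \<noteq> {}"
proof -
  have "(1/3) *\<^sub>R p + (1/3) *\<^sub>R q + (1/3) *\<^sub>R r \<in> interior (convex hull {p, q, r})"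
    using interior_convex_hull_3_minimal[OF assms]
    by (auto intro!: exI[of _ "1/3 :: real"])
  then show ?thesis by blast
qed

text \<open>The frontier of the interior consists of edges, so a larger connected set would meet
  \<open>cov E\<close>.\<close>

lemma empty_triangle_component:
  assumes E: "max_noncrossing E" and T: "empty_triangle E p q r"
  shows "interior (convex hull {p, q, r}) \<in> components (- cov E)"
proof -
  let ?I = "interior (convex hull {p, q, r})"
  have "frontier ?I \<subseteq> frontier (convex hull {p, q, r})" by (rule frontier_interior_subset)
  also have "\<dots> = closed_segment p q \<union> closed_segment q r \<union> closed_segment r p"
    by (rule frontier_of_triangle) simp
  also have "\<dots> \<subseteq> cov E" using T noncrossing_sym[OF E] covI unfolding empty_triangle_def by blast
  finally have fr: "frontier ?I \<subseteq> cov E" .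
  have "d = ?I" if d: "?I \<subseteq> d" "d \<subseteq> - cov E" "connected d" for d
  proof (rule ccontr)
    assume "d \<noteq> ?I"
    then have "d - ?I \<noteq> {}" using d(1) by blast
    moreover have "d \<inter> ?I \<noteq> {}" using d(1) triangle_interior_nonempty T unfolding empty_triangle_def by blast
    ultimately have "d \<inter> frontier ?I \<noteq> {}" using connected_Int_frontier[OF d(3)] by blast
    then show False using fr d(2) by blast
  qed
  moreover have "connected ?I" by (intro convex_connected convex_interior convex_convex_hull)
  ultimately show ?thesis unfolding in_components_maximal
    using T triangle_interior_nonempty unfolding empty_triangle_def by blast
qed

lemma empty_triangle_region:
  assumes "max_noncrossing E" "empty_triangle E p q r"
  shows "convex hull {p, q, r} \<subseteq> region P E"
  using empty_triangle_component[OF assms] assms(2) noncrossing_P[OF assms(1)]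
  unfolding region_def empty_triangle_def by blast

lemma edge_neighbourhood:
  assumes E: "max_noncrossing E" and ab: "(a, b) \<in> E" "u a < u b" and z: "z \<in> open_segment a b"
  obtains d where "d > 0" "\<And>y. dist z y < d \<Longrightarrow> u a < u y \<and> u y < u b \<and> (y \<in> cov E \<longrightarrow> v y = line_ht a b (u y))"
proof -
  define F where "F = {e \<in> E. {fst e, snd e} \<noteq> {a, b}}"
  have "closed (cov F)" by (rule closed_cov[OF E]) (auto simp: F_def)
  moreover have "z \<notin> cov F"
  proof
    assume "z \<in> cov F"
    then obtain c d where "(c, d) \<in> E" "{c, d} \<noteq> {a, b}" "z \<in> closed_segment c d"
      unfolding cov_def F_def by auto
    then show False using noncrossing_nc[OF E _ ab(1) _ _ open_seg_notP[OF E ab(1) z]] z unfolding open_segment_def by blast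
  qed
  moreover have "open {y. u a < u y}" "open {y. u y < u b}"
    by (intro open_Collect_less continuous_intros continuous_u)+
  ultimately have "open ({y. u a < u y} \<inter> {y. u y < u b} - cov F)" "z \<in> {y. u a < u y} \<inter> {y. u y < u b} - cov F"
    using z in_open_seg_iff[OF ab(2)] by auto
  then obtain d where d: "d > 0" "ball z d \<subseteq> {y. u a < u y} \<inter> {y. u y < u b} - cov F"
    using open_contains_ball by blast
  show ?thesis
  proof (rule that[OF d(1)])
    fix y assume "dist z y < d"
    then have y: "u a < u y" "u y < u b" "y \<notin> cov F" using d(2) by auto
    have "v y = line_ht a b (u y)" if "y \<in> cov E"
    proof -
      obtain c e where ce: "(c, e) \<in> E" "y \<in> closed_segment c e" using \<open>y \<in> cov E\<close> unfolding cov_def by auto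
      have "{c, e} = {a, b}" using y(3) ce unfolding F_def cov_def by force
      then have "closed_segment c e = closed_segment a b" by (auto simp: doubleton_eq_iff closed_segment_commute)
      then show ?thesis using ce(2) in_seg_iff[OF ab(2)] by blast
    qed
    then show "u a < u y \<and> u y < u b \<and> (y \<in> cov E \<longrightarrow> v y = line_ht a b (u y))" using y by blast
  qed
qed

text \<open>A face accumulating at an edge from below is bounded, so the downward ray meets its frontier.\<close>
lemma region_below:
  assumes E: "max_noncrossing E" and ab: "(a, b) \<in> E" "u a < u b" and z: "z \<in> open_segment a b"
    and acc: "\<And>d. d > 0 \<Longrightarrow> \<exists>y \<in> region P E. dist z y < d \<and> v y < line_ht a b (u y)"
  shows "below E a b"
proof -
  obtain d where d: "d > 0" "\<And>y. dist z y < d \<Longrightarrow> u a < u y \<and> u y < u b \<and> (y \<in> cov E \<longrightarrow> v y = line_ht a b (u y))"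
    using edge_neighbourhood[OF E ab z] by blast
  \<comment> \<open>Half a disc below \<open>a b\<close>: it is connected and free of edges, so a
    face that meets it contains all of it.\<close>
  define N where "N = ball z d \<inter> {y. orient a b y < 0}"
  obtain y where y: "y \<in> region P E" "y \<in> N" using acc[OF d(1)] line_ht_orient_iff(1)[OF ab(2)] unfolding N_def by auto
  obtain p q r where K: "y \<in> convex hull {p, q, r}" "\<not> collinear {p, q, r}"
    "interior (convex hull {p, q, r}) \<in> components (- cov E)" using y(1) unfolding region_def by auto
  let ?I = "interior (convex hull {p, q, r})"
  have oN: "open N" unfolding N_def by (intro open_Int open_ball open_Collect_less continuous_orient continuous_intros)
  have "y \<in> closure ?I" using convex_closure_interior[OF convex_convex_hull triangle_interior_nonempty[OF K(2)]] K(1)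
      closure_subset by blast
  then have "?I \<inter> N \<noteq> {}" using oN y(2) open_Int_closure_eq_empty[OF oN, of ?I] by blast
  moreover have "convex {y. orient a b y < 0}" unfolding convex_alt
  proof (intro ballI allI impI)
    fix x y and t :: real assume *: "x \<in> {y. orient a b y < 0}" "y \<in> {y. orient a b y < 0}" "0 \<le> t \<and> t \<le> 1"
    have "(1 - t) * orient a b x + t * orient a b y < 0"
    proof (cases "t = 0")
      case False
      then have "t * orient a b y < 0" "(1 - t) * orient a b x \<le> 0" using * by (auto simp: mult_pos_neg mult_nonneg_nonpos)
      then show ?thesis by simp
    qed (use * in simp)
    then show "(1 - t) *\<^sub>R x + t *\<^sub>R y \<in> {y. orient a b y < 0}" by (simp add: orient_mix)
  qed
  then have "connected N" unfolding N_def by (intro convex_connected convex_Int convex_ball)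
  moreover have "N \<subseteq> - cov E" using d(2) line_ht_orient_iff(3)[OF ab(2)] unfolding N_def by auto
  ultimately have NI: "N \<subseteq> ?I" using components_maximal[OF K(3)] by blast
  have nn: "norm nn > 0" using coords(4) by auto
  define h where "h = d / 2 / norm nn"
  have h: "h > 0" "h * norm nn < d" using d(1) nn unfolding h_def by simp_all
  define y0 where "y0 = z - h *\<^sub>R nn"
  have uy0: "u y0 = u z" "v y0 = v z - h" unfolding y0_def using coords by simp_all
  have zc: "v z = line_ht a b (u z)" "u a < u z" "u z < u b" using z in_open_seg_iff[OF ab(2)] by auto
  have "dist z y0 < d" using h unfolding y0_def by (simp add: dist_norm)
  moreover have "orient a b y0 < 0" using line_ht_orient_iff(1)[OF ab(2), of y0] uy0 zc h by simp
  ultimately have y0: "y0 \<in> ?I" using NI unfolding N_def by auto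
  have "bounded ?I" by (rule bounded_subset[OF _ interior_subset]) (simp add: finite_imp_bounded_convex_hull)
  then obtain B where B: "\<And>x. x \<in> ?I \<Longrightarrow> norm x \<le> B" unfolding bounded_iff by blast
  \<comment> \<open>Far enough down for \<open>y1\<close> to be outside a ball that contains the
    face.\<close>
  define m where "m = (B + norm y0 + 1) / norm nn"
  have "B \<ge> 0" using B[OF y0] norm_ge_zero order_trans by blast
  then have m: "m > 0" "m * norm nn = B + norm y0 + 1" using nn unfolding m_def by (simp_all add: add_nonneg_pos)
  define y1 where "y1 = y0 - m *\<^sub>R nn"
  have "norm (m *\<^sub>R nn) \<le> norm y0 + norm y1"
    using norm_triangle_ineq4[of y0 y1] unfolding y1_def by simp
  then have "norm y1 > B" using m by simp
  then have "y1 \<notin> ?I" using B by force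
  then have "closed_segment y0 y1 \<inter> frontier ?I \<noteq> {}"
    using y0 by (intro connected_Int_frontier) auto
  then obtain w where w: "w \<in> closed_segment y0 y1" "w \<in> frontier ?I" by blast
  have cl: "closed (cov E)" by (rule closed_cov[OF E order_refl])
  have "w \<in> cov E" using w(2) frontier_of_components_closed_complement[OF cl K(3)] by blast
  moreover obtain k where k: "0 \<le> k" "w = (1 - k) *\<^sub>R y0 + k *\<^sub>R y1" using w(1) unfolding in_segment by blast
  have "w = y0 - (k * m) *\<^sub>R nn" unfolding k(2) y1_def by (simp add: algebra_simps)
  then have "u w = u z" "v w = v z - h - k * m" using uy0 coords by simp_all
  moreover have "k * m \<ge> 0" using k m by simp
  ultimately show ?thesis unfolding below_def using zc h by (intro bexI[of _ w]) auto
qed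

lemma region_above:
  assumes "max_noncrossing E" "(a, b) \<in> E" "u a < u b" "z \<in> open_segment a b"
    and "\<And>d. d > 0 \<Longrightarrow> \<exists>y \<in> region P E. dist z y < d \<and> v y > line_ht a b (u y)"
  shows "above E a b"
  using sweep_frame.region_below[OF mirror assms(1-4)] assms(5) unfolding mirror_line_ht mirror_below neg_less_iff_less
  by blast

lemma above_sh: "max_noncrossing E \<Longrightarrow> above E a b \<Longrightarrow> above E (sh k a) (sh k b)"
  and below_sh: "max_noncrossing E \<Longrightarrow> below E a b \<Longrightarrow> below E (sh k a) (sh k b)"
proof -
  have c: "sh k w \<in> cov E \<union> P" if E: "max_noncrossing E" and w: "w \<in> cov E \<union> P" for w k
    using w
  proof
    assume "w \<in> cov E"
    then obtain c d where "(c, d) \<in> E" "w \<in> closed_segment c d" unfolding cov_def by auto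
    then show ?thesis using noncrossing_shift[OF E] sh_segment covI by blast
  qed (use P_shift in blast)
  have l: "line_ht (sh k a) (sh k b) (u (sh k w)) = line_ht a b (u w)" for w by (simp only: u_simps uv_shift line_ht_sh)
  show "below E (sh k a) (sh k b)" if E: "max_noncrossing E" and b: "below E a b"
  proof -
    obtain w where "w \<in> cov E \<union> P" "u a < u w" "u w < u b" "v w < line_ht a b (u w)" using b unfolding below_def by blast
    then show ?thesis unfolding below_def using c[OF E, of w k] l[of w] by (intro bexI[of _ "sh k w"]) simp_all
  qed
  show "above E (sh k a) (sh k b)" if E: "max_noncrossing E" and b: "above E a b"
  proof -
    obtain w where "w \<in> cov E \<union> P" "u a < u w" "u w < u b" "v w > line_ht a b (u w)" using b unfolding above_def by blast
    then show ?thesis unfolding above_def using c[OF E, of w k] l[of w] by (intro bexI[of _ "sh k w"]) simp_all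
  qed
qed

lemma onesided_sh:
  assumes E: "max_noncrossing E" and ab: "(a, b) \<in> onesided E"
  shows "(sh k a, sh k b) \<in> onesided E"
proof -
  have e: "sh (- k) (sh k x) = x" for x by simp
  have "below E (sh k a) (sh k b) \<longleftrightarrow> below E a b" "above E (sh k a) (sh k b) \<longleftrightarrow> above E a b"
    using below_sh[OF E, of a b k] below_sh[OF E, of "sh k a" "sh k b" "- k"]
      above_sh[OF E, of a b k] above_sh[OF E, of "sh k a" "sh k b" "- k"] unfolding e by blast+
  then show ?thesis using ab noncrossing_shift[OF E, of a b k] unfolding onesided_def by simp
qed

text \<open>The triangle on one side puts \<open>a b\<close> into the region. If a point inside
  \<open>a b\<close> were interior to the region, the region would come arbitrarily close to it from
  both sides, giving both \<open>below\<close> and \<open>above\<close>. The endpoints follow by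
  closure.\<close>

lemma onesided_frontier:
  assumes E: "max_noncrossing E" and o: "(a, b) \<in> onesided E"
  shows "closed_segment a b \<subseteq> frontier (region P E)"
proof -
  have ab: "(a, b) \<in> E" "u a < u b" "below E a b \<longleftrightarrow> \<not> above E a b" using o unfolding onesided_def by auto
  then obtain c where "empty_triangle E a b c"
    using empty_triangle_below[OF E ab(1,2)] empty_triangle_above[OF E ab(1,2)] by blast
  then have "convex hull {a, b, c} \<subseteq> region P E" by (rule empty_triangle_region[OF E])
  moreover have "closed_segment a b \<subseteq> convex hull {a, b, c}"
    unfolding segment_convex_hull by (rule hull_mono) auto
  ultimately have R: "closed_segment a b \<subseteq> region P E" by blast
  have nn: "norm nn > 0" using coords(4) by auto
  have "z \<in> frontier (region P E)" if z: "z \<in> open_segment a b" for z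
  proof -
    have zc: "v z = line_ht a b (u z)" using z in_open_seg_iff[OF ab(2)] by auto
    have "z \<notin> interior (region P E)"
    proof
      assume "z \<in> interior (region P E)"
      then obtain e where e: "e > 0" "ball z e \<subseteq> region P E" unfolding mem_interior by blast
      have near: "\<exists>y \<in> region P E. dist z y < d \<and> u y = u z \<and> v y = v z + s * (min d e / 2 / norm nn)"
        if d: "d > 0" and s: "\<bar>s\<bar> = 1" for d s
      proof -
        define h where "h = min d e / 2 / norm nn"
        have h: "h > 0" "h * norm nn < min d e" unfolding h_def using d e nn by auto
        have "dist z (z + (s * h) *\<^sub>R nn) < min d e" using h s by (simp add: dist_norm abs_mult)
        then show ?thesis using e coords h_def by (intro bexI[of _ "z + (s * h) *\<^sub>R nn"]) auto
      qed
      have pos: "min d e / 2 / norm nn > 0" if "d > 0" for d using that e nn by auto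
      have "below E a b"
        by (rule region_below[OF E ab(1,2) z]) (use near[of _ "- 1"] pos zc in force)
      moreover have "above E a b"
        by (rule region_above[OF E ab(1,2) z]) (use near[of _ 1] pos zc in force)
      ultimately show False using ab(3) by blast
    qed
    moreover have "z \<in> closure (region P E)" using R z closure_subset unfolding open_segment_def by blast
    ultimately show ?thesis unfolding frontier_def by blast
  qed
  then have "closure (open_segment a b) \<subseteq> frontier (region P E)"
    by (intro closure_minimal frontier_closed) blast
  moreover have "a \<noteq> b" using ab by auto
  ultimately show ?thesis by simp
qed

text \<open>With triangles on both sides the midpoint of \<open>a b\<close> is interior to the
  region; with nothing on either side it is not even in the closure.\<close>

lemma frontier_onesided:
  assumes E: "max_noncrossing E" and ab: "(a, b) \<in> E" "u a < u b" and f: "closed_segment a b \<subseteq> frontier (region P E)"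
  shows "(a, b) \<in> onesided E"
proof (rule ccontr)
  assume n: "\<not> ?thesis"
  define z where "z = midpoint a b"
  have "a \<noteq> b" using ab by auto
  then have z: "z \<in> open_segment a b" unfolding z_def by simp
  then have zf: "z \<in> frontier (region P E)" using f unfolding open_segment_def by blast
  show False
  proof (cases "below E a b")
    case True
    then have "above E a b" using n ab unfolding onesided_def by blast
    then obtain r s where Q: "quad E a b r s"
      using empty_triangle_below[OF E ab True] empty_triangle_above[OF E ab] ab(2) unfolding quad_def by blast
    note S = quad_sign[OF Q]
    have T: "convex hull {a, b, r} \<subseteq> region P E" "convex hull {a, b, s} \<subseteq> region P E"
      using Q empty_triangle_region[OF E] unfolding quad_def by blast+
    \<comment> \<open>The strict inequalities of both triangles except those across
      \<open>a b\<close>: an open set around z in which the sign of \<open>orient a b y\<close>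
      decides between the triangles.\<close>
    define U where "U = {y. orient b r y < 0} \<inter> {y. orient r a y < 0} \<inter> {y. 0 < orient b s y} \<inter> {y. 0 < orient s a y}"
    have oU: "open U" unfolding U_def by (intro open_Int open_Collect_less continuous_orient continuous_intros)
    have zm: "z = (1 - 1/2) *\<^sub>R a + (1/2) *\<^sub>R b" unfolding z_def midpoint_def by (simp add: scaleR_add_right)
    have "orient b r z = orient a b r / 2" "orient r a z = orient a b r / 2" "orient b s z = orient a b s / 2" "orient s a z = orient a b s / 2"
      unfolding zm orient_mix by (simp_all add: orient_rot)
    then have "z \<in> U" unfolding U_def using S by simp
    moreover have "U \<subseteq> region P E"
    proof
      fix y assume y: "y \<in> U"
      show "y \<in> region P E"
      proof (cases "orient a b y \<le> 0")
        case True
        then have "y \<in> convex hull {a, b, r}"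
          using triangle_iff[of a b r y] S y unfolding U_def by (auto intro: divide_nonpos_neg less_imp_le)
        then show ?thesis using T by blast
      next
        case False
        then have "y \<in> convex hull {a, b, s}"
          using triangle_iff[of a b s y] S y unfolding U_def by auto
        then show ?thesis using T by blast
      qed
    qed
    ultimately have "z \<in> interior (region P E)" using oU by (meson interior_maximal subsetD)
    then show False using zf unfolding frontier_def by blast
  next
    case nb: False
    then have na: "\<not> above E a b" using n ab unfolding onesided_def by blast
    \<comment> \<open>Near z the region could consist only of points of \<open>a b\<close>. But a
      triangle of the region that comes near z also has inner points there, and these are off
      \<open>cov E\<close>.\<close>
    have "\<exists>d>0. \<forall>y\<in>region P E. dist z y < d \<longrightarrow> \<not> v y < line_ht a b (u y)"
      using region_below[OF E ab z] nb by blast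
    then obtain d1 where d1: "d1 > 0" "\<forall>y\<in>region P E. dist z y < d1 \<longrightarrow> \<not> v y < line_ht a b (u y)"
      by blast
    have "\<exists>d>0. \<forall>y\<in>region P E. dist z y < d \<longrightarrow> \<not> v y > line_ht a b (u y)"
      using region_above[OF E ab z] na by blast
    then obtain d2 where d2: "d2 > 0" "\<forall>y\<in>region P E. dist z y < d2 \<longrightarrow> \<not> v y > line_ht a b (u y)"
      by blast
    have "\<exists>d>0. \<forall>y. dist z y < d \<longrightarrow> u a < u y \<and> u y < u b"
      by (rule edge_neighbourhood[OF E ab z]) blast
    then obtain d3 where d3: "d3 > 0" "\<forall>y. dist z y < d3 \<longrightarrow> u a < u y \<and> u y < u b"
      by blast
    define d where "d = min d1 (min d2 d3)"
    have d: "d > 0" using d1 d2 d3 unfolding d_def by simp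
    have "z \<in> closure (region P E)" using zf unfolding frontier_def by blast
    then obtain y where y: "y \<in> region P E" "dist y z < d" using d closure_approachable by blast
    then obtain p q r where K: "y \<in> convex hull {p, q, r}" "\<not> collinear {p, q, r}" "p \<in> P" "q \<in> P" "r \<in> P"
      "interior (convex hull {p, q, r}) \<in> components (- cov E)" unfolding region_def by auto
    let ?I = "interior (convex hull {p, q, r})"
    have "y \<in> closure ?I"
      using convex_closure_interior[OF convex_convex_hull triangle_interior_nonempty[OF K(2)]] K(1) closure_subset by blast
    moreover have "y \<in> ball z d" using y(2) by (simp add: dist_commute)
    ultimately obtain x where x: "x \<in> ?I" "x \<in> ball z d"
      using open_Int_closure_eq_empty[OF open_ball, of z d ?I] by blast
    have "x \<in> region P E" using x(1) interior_subset K unfolding region_def by blast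
    then have "v x = line_ht a b (u x)" "u a < u x" "u x < u b"
      using d1(2) d2(2) d3(2) x(2) unfolding d_def by force+
    then have "x \<in> cov E" using covI[OF ab(1)] in_seg_iff[OF ab(2)] by (simp add: less_imp_le)
    then show False using x(1) K(6) in_components_subset by blast
  qed
qed

end

section \<open>Frames in general position\<close>

text \<open>Translations change only the real part of (a - b) / \<tau>. The bound is strict because
  at exactly 1/2 there are two shortest geodesics.\<close>

definition short_mod :: "complex \<Rightarrow> complex \<Rightarrow> complex \<Rightarrow> bool" where
  "short_mod \<tau> a b \<longleftrightarrow> \<bar>Re ((a - b) / \<tau>)\<bar> < 1 / 2"

text \<open>The right-hand side is the smallest positive number that differs from d by an
  integer.\<close>

lemma int_shift_pos:
  fixes d :: real and k :: int
  assumes "d + k > 0"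
  shows "d + k \<ge> d - \<lceil>d\<rceil> + 1"
proof -
  have "- k < \<lceil>d\<rceil>" using assms by linarith
  then show ?thesis by linarith
qed

text \<open>If all coefficients of the difference vanished, then A B (p q' - q p')^2 would be
  0.\<close>

lemma finite_quadratic_tie:
  fixes A B p p' q q' :: real
  assumes "A > 0" "B > 0" "p * q' \<noteq> q * p'"
  shows "finite {e. A * (p + e * p')\<^sup>2 = B * (q + e * q')\<^sup>2}"
proof -
  define f where "f = [:A * p\<^sup>2 - B * q\<^sup>2, 2 * (A * p * p' - B * q * q'), A * p'\<^sup>2 - B * q'\<^sup>2:]"
  have "f \<noteq> 0"
  proof
    assume "f = 0"
    then have 0: "A * p\<^sup>2 = B * q\<^sup>2" "A * p * p' = B * q * q'" "A * p'\<^sup>2 = B * q'\<^sup>2"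
      unfolding f_def by auto
    have "A * B * (p * q' - q * p')\<^sup>2 =
        (A * p\<^sup>2) * (B * q'\<^sup>2) - 2 * ((A * p * p') * (B * q * q')) + (B * q\<^sup>2) * (A * p'\<^sup>2)"
      by (simp add: power2_eq_square algebra_simps)
    also have "\<dots> = 0" unfolding 0(1)[symmetric] 0(2)[symmetric] 0(3)[symmetric]
      by (simp add: power2_eq_square algebra_simps)
    finally show False using assms by simp
  qed
  then have "finite {e. poly f e = 0}" by (rule poly_roots_finite)
  moreover have "poly f e = A * (p + e * p')\<^sup>2 - B * (q + e * q')\<^sup>2" for e
    unfolding f_def by (simp add: power2_eq_square algebra_simps)
  ultimately show ?thesis by simp
qed

locale cyl_config =
  fixes \<tau> :: complex and S :: "complex set set"
  assumes tau: "\<tau> \<noteq> 0" and finS: "finite S" and Scyl: "S \<subseteq> cyl_points \<tau>"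
begin

definition xco :: "complex \<Rightarrow> real" where "xco z = Re (z / \<tau>)"
definition yco :: "complex \<Rightarrow> real" where "yco z = Im (z / \<tau>)"
abbreviation "Q \<equiv> \<Union>S"

lemma xy_simps [simp]: "xco (a + b) = xco a + xco b" "xco (a - b) = xco a - xco b" "xco (c *\<^sub>R a) = c * xco a"
  "yco (a + b) = yco a + yco b" "yco (a - b) = yco a - yco b" "yco (c *\<^sub>R a) = c * yco a"
proof -
  have "c *\<^sub>R a / \<tau> = c *\<^sub>R (a / \<tau>)" by (simp add: scaleR_conv_of_real)
  then show "xco (c *\<^sub>R a) = c * xco a" "yco (c *\<^sub>R a) = c * yco a" unfolding xco_def yco_def by simp_all
qed (simp_all add: xco_def yco_def add_divide_distrib diff_divide_distrib)

lemma xy_shift [simp]: "xco (of_int k * \<tau>) = of_int k" "yco (of_int k * \<tau>) = 0"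
  unfolding xco_def yco_def using tau by simp_all

lemma short_mod_x: "short_mod \<tau> a b \<longleftrightarrow> \<bar>xco a - xco b\<bar> < 1 / 2"
  unfolding short_mod_def by (simp add: xco_def diff_divide_distrib)

lemma xy_eqI: "xco a = xco b \<Longrightarrow> yco a = yco b \<Longrightarrow> a = b"
  unfolding xco_def yco_def using tau complex_eqI[of "a / \<tau>" "b / \<tau>"] by simp

lemma orb_mem: "q \<in> orb \<tau> p \<longleftrightarrow> (\<exists>k. q = p + of_int k * \<tau>)"
  unfolding orb_def by blast

lemma orb_self: "p \<in> orb \<tau> p"
  unfolding orb_mem by (intro exI[of _ 0]) simp

lemma orb_eq: "q \<in> orb \<tau> p \<Longrightarrow> orb \<tau> q = orb \<tau> p"
proof -
  assume "q \<in> orb \<tau> p"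
  then obtain k where k: "q = p + of_int k * \<tau>" unfolding orb_mem by blast
  show ?thesis
  proof (intro set_eqI iffI)
    fix w assume "w \<in> orb \<tau> q"
    then obtain l where "w = q + of_int l * \<tau>" unfolding orb_mem by blast
    then have "w = p + of_int (k + l) * \<tau>" using k by (simp add: algebra_simps)
    then show "w \<in> orb \<tau> p" unfolding orb_mem by blast
  next
    fix w assume "w \<in> orb \<tau> p"
    then obtain l where "w = p + of_int l * \<tau>" unfolding orb_mem by blast
    then have "w = q + of_int (l - k) * \<tau>" using k by (simp add: algebra_simps)
    then show "w \<in> orb \<tau> q" unfolding orb_mem by blast
  qed
qed

lemma S_orb: "A \<in> S \<Longrightarrow> a \<in> A \<Longrightarrow> A = orb \<tau> a"
proof -
  assume A: "A \<in> S" "a \<in> A"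
  then obtain p where "A = orb \<tau> p" using Scyl unfolding cyl_points_def by blast
  then show ?thesis using orb_eq A(2) by blast
qed

lemma orb_in_S: "orb \<tau> p \<in> S \<longleftrightarrow> p \<in> Q"
  using S_orb orb_self by blast

lemma Q_shift: "p \<in> Q \<Longrightarrow> p + of_int k * \<tau> \<in> Q"
  using orb_in_S[of p] orb_mem by blast

section \<open>Finiteness modulo translation\<close>

lemma Q_reps: "\<exists>F. finite F \<and> F \<subseteq> Q \<and> (\<forall>p\<in>Q. \<exists>f\<in>F. \<exists>k. p = f + of_int k * \<tau>)"
proof -
  define F where "F = (\<lambda>A. SOME a. a \<in> A) ` S"
  have ne: "(SOME a. a \<in> A) \<in> A" if A: "A \<in> S" for A
  proof -
    obtain p where "A = orb \<tau> p" using Scyl A unfolding cyl_points_def by blast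
    then show ?thesis using orb_self someI_ex[of "\<lambda>a. a \<in> A"] by blast
  qed
  have "\<exists>f\<in>F. \<exists>k. p = f + of_int k * \<tau>" if p: "p \<in> Q" for p
  proof -
    obtain A where A: "A \<in> S" "p \<in> A" using p by blast
    then have "A = orb \<tau> (SOME a. a \<in> A)" using S_orb[OF A(1) ne[OF A(1)]] by blast
    then show ?thesis using A orb_mem unfolding F_def by blast
  qed
  moreover have "F \<subseteq> Q" using ne unfolding F_def by blast
  ultimately show ?thesis using finS unfolding F_def by blast
qed

lemma y_bound: "\<exists>M>0. \<forall>a\<in>Q. \<bar>yco a\<bar> \<le> M"
proof -
  obtain F where F: "finite F" "\<forall>p\<in>Q. \<exists>f\<in>F. \<exists>k. p = f + of_int k * \<tau>" using Q_reps by blast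
  define M where "M = Max (insert 1 ((\<lambda>f. \<bar>yco f\<bar>) ` F))"
  have fin: "finite (insert 1 ((\<lambda>f. \<bar>yco f\<bar>) ` F))" using F by simp
  have "M \<ge> 1" unfolding M_def using fin by (intro Max_ge) auto
  moreover have "\<bar>yco a\<bar> \<le> M" if a: "a \<in> Q" for a
  proof -
    obtain f k where "f \<in> F" "a = f + of_int k * \<tau>" using F a by blast
    then have "\<bar>yco a\<bar> \<in> insert 1 ((\<lambda>f. \<bar>yco f\<bar>) ` F)" by simp
    then show ?thesis unfolding M_def using fin by (intro Max_ge)
  qed
  ultimately show ?thesis by (intro exI[of _ M]) auto
qed

text \<open>Modulo the integers the differences of x-coordinates take finitely many values, each
  with a smallest positive representative.\<close>

lemma x_gap: "\<exists>d>0. \<forall>a\<in>Q. \<forall>b\<in>Q. xco a < xco b \<longrightarrow> xco b - xco a \<ge> d"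
proof -
  obtain F where F: "finite F" "\<forall>p\<in>Q. \<exists>f\<in>F. \<exists>k. p = f + of_int k * \<tau>" using Q_reps by blast
  define G where "G = insert 1 ((\<lambda>(f, g). (xco g - xco f) - \<lceil>xco g - xco f\<rceil> + 1) ` (F \<times> F))"
  have fin: "finite G" using F unfolding G_def by simp
  have "\<forall>g\<in>G. g > 0" unfolding G_def by auto (linarith)
  then have "Min G > 0" using Min_in[OF fin] unfolding G_def by blast
  moreover have "xco b - xco a \<ge> Min G" if ab: "a \<in> Q" "b \<in> Q" "xco a < xco b" for a b
  proof -
    obtain f k where f: "f \<in> F" "a = f + of_int k * \<tau>" using F ab by blast
    obtain g l where g: "g \<in> F" "b = g + of_int l * \<tau>" using F ab by blast
    have e: "xco b - xco a = (xco g - xco f) + of_int (l - k)" unfolding f g by simp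
    then have "xco b - xco a \<ge> (xco g - xco f) - \<lceil>xco g - xco f\<rceil> + 1"
      using int_shift_pos[of "xco g - xco f" "l - k"] ab(3) by linarith
    moreover have "(xco g - xco f) - \<lceil>xco g - xco f\<rceil> + 1 \<in> G" unfolding G_def using f g by force
    ultimately show ?thesis using Min_le[OF fin] by fastforce
  qed
  ultimately show ?thesis by blast
qed

lemma finite_x_range: "finite {p \<in> Q. s \<le> xco p \<and> xco p \<le> t}"
proof -
  obtain F where F: "finite F" "\<forall>p\<in>Q. \<exists>f\<in>F. \<exists>k. p = f + of_int k * \<tau>" using Q_reps by blast
  have "{p \<in> Q. s \<le> xco p \<and> xco p \<le> t} \<subseteq> (\<Union>f\<in>F. (\<lambda>k. f + of_int k * \<tau>) ` {\<lceil>s - xco f\<rceil>..\<lfloor>t - xco f\<rfloor>})"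
  proof
    fix p assume p: "p \<in> {p \<in> Q. s \<le> xco p \<and> xco p \<le> t}"
    then obtain f k where f: "f \<in> F" "p = f + of_int k * \<tau>" using F by blast
    have "s \<le> xco f + k" "xco f + k \<le> t" using p f by simp_all
    then have "k \<in> {\<lceil>s - xco f\<rceil>..\<lfloor>t - xco f\<rfloor>}" by (auto simp: ceiling_le_iff le_floor_iff)
    then show "p \<in> (\<Union>f\<in>F. (\<lambda>k. f + of_int k * \<tau>) ` {\<lceil>s - xco f\<rceil>..\<lfloor>t - xco f\<rfloor>})" using f by blast
  qed
  then show ?thesis by (rule finite_subset) (use F in simp)
qed

text \<open>The failure of \<open>generic\<close> for u = xco + e yco. Non-parallelism is stated in
  (x, y) because the shear to (u, y) does not change that determinant.\<close>

definition tie :: "real \<Rightarrow> complex \<Rightarrow> complex \<Rightarrow> complex \<Rightarrow> complex \<Rightarrow> complex \<Rightarrow> bool" where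
  "tie e a b c d z \<longleftrightarrow> z \<in> open_segment a b \<and> z \<in> open_segment c d \<and>
     (xco b - xco a) * (yco d - yco c) \<noteq> (xco d - xco c) * (yco b - yco a) \<and>
     ((xco z + e * yco z) - (xco a + e * yco a)) * ((xco b + e * yco b) - (xco z + e * yco z)) =
     ((xco z + e * yco z) - (xco c + e * yco c)) * ((xco d + e * yco d) - (xco z + e * yco z))"

text \<open>If z divides \<open>a b\<close> in the ratio given by l, the left product is l (1 - l)
  times the squared u-extent of \<open>a b\<close>, which is affine in e; likewise for
  \<open>c d\<close>. So a tie at z is a quadratic equation for e.\<close>

lemma finite_tie_point: "finite {e. tie e a b c d z}"
proof (cases "\<exists>e. tie e a b c d z")
  case True
  then have z: "z \<in> open_segment a b" "z \<in> open_segment c d"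
    "(xco b - xco a) * (yco d - yco c) \<noteq> (xco d - xco c) * (yco b - yco a)" unfolding tie_def by blast+
  obtain l where l: "0 < l" "l < 1" "z = (1 - l) *\<^sub>R a + l *\<^sub>R b" using z(1) unfolding in_segment by blast
  obtain m where m: "0 < m" "m < 1" "z = (1 - m) *\<^sub>R c + m *\<^sub>R d" using z(2) unfolding in_segment by blast
  have 1: "((xco z + e * yco z) - (xco a + e * yco a)) * ((xco b + e * yco b) - (xco z + e * yco z)) =
      (l * (1 - l)) * ((xco b - xco a) + e * (yco b - yco a))\<^sup>2" for e
    unfolding l(3) by (simp add: algebra_simps power2_eq_square)
  have 2: "((xco z + e * yco z) - (xco c + e * yco c)) * ((xco d + e * yco d) - (xco z + e * yco z)) =
      (m * (1 - m)) * ((xco d - xco c) + e * (yco d - yco c))\<^sup>2" for e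
    unfolding m(3) by (simp add: algebra_simps power2_eq_square)
  have "finite {e. (l * (1 - l)) * ((xco b - xco a) + e * (yco b - yco a))\<^sup>2 = (m * (1 - m)) * ((xco d - xco c) + e * (yco d - yco c))\<^sup>2}"
    by (rule finite_quadratic_tie) (use l m z(3) in auto)
  then show ?thesis by (rule finite_subset[rotated]) (use 1 2 in \<open>auto simp: tie_def\<close>)
qed simp

text \<open>Non-parallel segments have only one common point, and it does not depend on e.\<close>

lemma tie_unique:
  assumes "tie e a b c d z" "tie e' a b c d z'"
  shows "z = z'"
proof -
  have ne: "(xco b - xco a) * (yco d - yco c) - (xco d - xco c) * (yco b - yco a) \<noteq> 0" using assms(1) unfolding tie_def by simp
  obtain l m where l: "z = (1 - l) *\<^sub>R a + l *\<^sub>R b" and m: "z = (1 - m) *\<^sub>R c + m *\<^sub>R d"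
    using assms(1) unfolding tie_def in_segment by blast
  obtain l' m' where l': "z' = (1 - l') *\<^sub>R a + l' *\<^sub>R b" and m': "z' = (1 - m') *\<^sub>R c + m' *\<^sub>R d"
    using assms(2) unfolding tie_def in_segment by blast
  have 1: "xco z - xco z' = (l - l') * (xco b - xco a)" "yco z - yco z' = (l - l') * (yco b - yco a)"
    unfolding l l' by (simp_all add: algebra_simps)
  have 2: "xco z - xco z' = (m - m') * (xco d - xco c)" "yco z - yco z' = (m - m') * (yco d - yco c)"
    unfolding m m' by (simp_all add: algebra_simps)
  have "(l - l') * ((xco b - xco a) * (yco d - yco c) - (xco d - xco c) * (yco b - yco a)) =
      (xco z - xco z') * (yco d - yco c) - (xco d - xco c) * (yco z - yco z')"
    unfolding 1 by (simp add: algebra_simps)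
  also have "\<dots> = 0" unfolding 2 by (simp add: algebra_simps)
  finally have "l = l'" using ne by simp
  then show ?thesis unfolding l l' by simp
qed

lemma finite_ties: "finite {e. \<exists>a\<in>Q. \<exists>b\<in>Q. \<exists>c\<in>Q. \<exists>d\<in>Q. \<exists>z. short_mod \<tau> a b \<and> short_mod \<tau> c d \<and> tie e a b c d z}"
proof -
  \<comment> \<open>Translate so that the x-coordinate of \<open>a\<close> is in [0, 1). Then
    \<open>b\<close>, the common point, and with it \<open>c\<close> and \<open>d\<close> stay
    within the bound 3.\<close>
  define R where "R = {p \<in> Q. - 3 \<le> xco p \<and> xco p \<le> 3}"
  have fin1: "finite {e. \<exists>z. tie e a b c d z}" for a b c d
  proof (cases "\<exists>e z. tie e a b c d z")
    case True
    then obtain e0 z0 where "tie e0 a b c d z0" by blast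
    then have "{e. \<exists>z. tie e a b c d z} \<subseteq> {e. tie e a b c d z0}" using tie_unique by blast
    then show ?thesis by (rule finite_subset[OF _ finite_tie_point])
  qed simp
  have fin2: "finite (\<Union>a\<in>R. \<Union>b\<in>R. \<Union>c\<in>R. \<Union>d\<in>R. {e. \<exists>z. tie e a b c d z})"
    using finite_x_range fin1 unfolding R_def by (intro finite_UN_I) auto
  have "\<exists>a\<in>R. \<exists>b\<in>R. \<exists>c\<in>R. \<exists>d\<in>R. \<exists>z. tie e a b c d z"
    if P: "a \<in> Q" "b \<in> Q" "c \<in> Q" "d \<in> Q" and W: "short_mod \<tau> a b" "short_mod \<tau> c d" and t: "tie e a b c d z" for e a b c d z
  proof -
    define k where "k = - \<lfloor>xco a\<rfloor>"
    let ?s = "\<lambda>w. w + of_int k * \<tau>"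
    have oseg: "?s z \<in> open_segment (?s p) (?s q)" if "z \<in> open_segment p q" for p q
      using open_segment_translation_eq[of "of_int k * \<tau>" z p q] that by (simp add: add.commute)
    have dif: "(xco (?s p) + e * yco (?s p)) - (xco (?s q) + e * yco (?s q)) = (xco p + e * yco p) - (xco q + e * yco q)"
      "xco (?s p) - xco (?s q) = xco p - xco q" "yco (?s p) - yco (?s q) = yco p - yco q" for p q by simp_all
    have t': "tie e (?s a) (?s b) (?s c) (?s d) (?s z)"
      using t oseg[of a b] oseg[of c d] unfolding tie_def dif by blast
    have rng: "min (xco p) (xco q) \<le> xco z \<and> xco z \<le> max (xco p) (xco q)" if z: "z \<in> open_segment p q" for p q
    proof -
      obtain l where l: "0 < l" "l < 1" "z = (1 - l) *\<^sub>R p + l *\<^sub>R q" using z unfolding in_segment by blast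
      have "xco z = (1 - l) * xco p + l * xco q" unfolding l by simp
      moreover have "xco z \<in> closed_segment (xco p) (xco q)"
        unfolding in_segment using l by (intro exI[of _ l]) simp
      ultimately show ?thesis by (auto simp: closed_segment_eq_real_ivl split: if_splits)
    qed
    have "min (xco a) (xco b) \<le> xco z \<and> xco z \<le> max (xco a) (xco b)" "min (xco c) (xco d) \<le> xco z \<and> xco z \<le> max (xco c) (xco d)"
      using rng t unfolding tie_def by blast+
    moreover have "0 \<le> xco a + k" "xco a + k < 1" unfolding k_def by (simp_all, linarith+)
    ultimately have "- 3 \<le> xco p + k \<and> xco p + k \<le> 3" if "p = a \<or> p = b \<or> p = c \<or> p = d" for p
      using W that unfolding short_mod_x by (auto simp: abs_less_iff min_def max_def split: if_splits)
    then have "?s a \<in> R" "?s b \<in> R" "?s c \<in> R" "?s d \<in> R" unfolding R_def using P Q_shift by simp_all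
    then show ?thesis using t' by blast
  qed
  note red = this
  have "{e. \<exists>a\<in>Q. \<exists>b\<in>Q. \<exists>c\<in>Q. \<exists>d\<in>Q. \<exists>z. short_mod \<tau> a b \<and> short_mod \<tau> c d \<and> tie e a b c d z} \<subseteq>
      (\<Union>a\<in>R. \<Union>b\<in>R. \<Union>c\<in>R. \<Union>d\<in>R. {e. \<exists>z. tie e a b c d z})"
  proof
    fix e assume "e \<in> {e. \<exists>a\<in>Q. \<exists>b\<in>Q. \<exists>c\<in>Q. \<exists>d\<in>Q. \<exists>z. short_mod \<tau> a b \<and> short_mod \<tau> c d \<and> tie e a b c d z}"
    then obtain a b c d z where "a \<in> Q" "b \<in> Q" "c \<in> Q" "d \<in> Q" "short_mod \<tau> a b" "short_mod \<tau> c d" "tie e a b c d z"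
      by (elim CollectE bexE exE conjE)
    from red[OF this] show "e \<in> (\<Union>a\<in>R. \<Union>b\<in>R. \<Union>c\<in>R. \<Union>d\<in>R. {e. \<exists>z. tie e a b c d z})"
      by (elim bexE) (intro UN_I CollectI; assumption)
  qed
  then show ?thesis using fin2 by (rule finite_subset)
qed

text \<open>Take u = xco + e yco with e positive, small, and outside the finite set of ties.\<close>
lemma generic_frame: "\<exists>u v nn. sweep_frame u v \<tau> nn Q (short_mod \<tau>)"
proof -
  obtain M where M: "M > 0" "\<forall>a\<in>Q. \<bar>yco a\<bar> \<le> M" using y_bound by blast
  obtain g where g: "g > 0" "\<forall>a\<in>Q. \<forall>b\<in>Q. xco a < xco b \<longrightarrow> xco b - xco a \<ge> g" using x_gap by blast
  let ?bad = "{e. \<exists>a\<in>Q. \<exists>b\<in>Q. \<exists>c\<in>Q. \<exists>d\<in>Q. \<exists>z. short_mod \<tau> a b \<and> short_mod \<tau> c d \<and> tie e a b c d z}"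
  \<comment> \<open>The tilts e yco of two vertices differ by at most 2 M e, which is less than g
    and than 1/2. Being less than g, they keep the strict order by x; being less than 1/2, they keep
    segments narrower than 1 in u.\<close>
  define h where "h = min g (1/2) / (4 * M)"
  have h: "h > 0" "h * (4 * M) \<le> g" "h * (4 * M) \<le> 1/2" using M g unfolding h_def by auto
  have "infinite ({0<..<h} - ?bad)" using h finite_ties infinite_Ioo[of 0 h] by (simp add: Diff_infinite_finite)
  then obtain e where e: "0 < e" "e < h" "e \<notin> ?bad" by (metis (no_types, lifting) Diff_iff finite.emptyI equals0I greaterThanLessThan_iff)
  have eM: "e * (4 * M) < h * (4 * M)" using e M by simp
  have ey: "\<bar>e * yco a - e * yco b\<bar> < min g (1/2)" if "a \<in> Q" "b \<in> Q" for a b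
  proof -
    have "\<bar>yco a\<bar> \<le> M" "\<bar>yco b\<bar> \<le> M" using M(2) that by blast+
    then have "\<bar>yco a - yco b\<bar> \<le> 2 * M" by linarith
    then have "e * \<bar>yco a - yco b\<bar> \<le> e * (2 * M)" using e by (intro mult_left_mono) auto
    also have "\<dots> \<le> e * (4 * M)" using e M by simp
    also have "\<dots> < min g (1/2)" using less_le_trans[OF eM h(2)] less_le_trans[OF eM h(3)] by simp
    finally show ?thesis using e by (simp add: abs_mult right_diff_distrib[symmetric])
  qed
  define u where "u z = xco z + e * yco z" for z
  have ux: "u a < u b" if "a \<in> Q" "b \<in> Q" "xco a < xco b" for a b
    using ey[OF that(1,2)] g(2) that unfolding u_def by fastforce
  have xle: "xco a \<le> xco b" if "a \<in> Q" "b \<in> Q" "u a \<le> u b" for a b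
    using ux[OF that(2,1)] that(3) by force
  \<comment> \<open>The vector \<tau> (i - e) has x = -e and y = 1: the direction along which u is
    constant.\<close>
  have "sweep_frame u yco \<tau> (\<tau> * (\<i> - of_real e)) Q (short_mod \<tau>)"
  proof (rule sweep_frame.intro)
    show "linear u" unfolding u_def by (rule linearI) (simp_all add: algebra_simps)
    show "linear yco" by (rule linearI) simp_all
    have xn: "xco (\<tau> * (\<i> - of_real e)) = - e" "yco (\<tau> * (\<i> - of_real e)) = 1"
      unfolding xco_def yco_def using tau by simp_all
    have xt: "xco \<tau> = 1" "yco \<tau> = 0" using xy_shift[of 1] by simp_all
    show "u \<tau> = 1" "yco \<tau> = 0" "u (\<tau> * (\<i> - of_real e)) = 0" "yco (\<tau> * (\<i> - of_real e)) = 1"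
      unfolding u_def using xn xt by simp_all
    show "z = u z *\<^sub>R \<tau> + yco z *\<^sub>R (\<tau> * (\<i> - of_real e))" for z
      by (rule xy_eqI; simp only: xy_simps xn xt u_def; simp)
    show "p + of_int k * \<tau> \<in> Q" if "p \<in> Q" for p k by (rule Q_shift[OF that])
    show "finite {p \<in> Q. s \<le> u p \<and> u p \<le> t}" for s t
    proof (rule finite_subset[OF _ finite_x_range[of "s - e * M" "t + e * M"]])
      show "{p \<in> Q. s \<le> u p \<and> u p \<le> t} \<subseteq> {p \<in> Q. s - e * M \<le> xco p \<and> xco p \<le> t + e * M}"
      proof
        fix p assume p: "p \<in> {p \<in> Q. s \<le> u p \<and> u p \<le> t}"
        then have "\<bar>yco p\<bar> \<le> M" using M(2) by blast
        then have "\<bar>e * yco p\<bar> \<le> e * M" using e by (simp add: abs_mult)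
        then have "s - e * M \<le> xco p" "xco p \<le> t + e * M" using p unfolding u_def mem_Collect_eq by linarith+
        then show "p \<in> {p \<in> Q. s - e * M \<le> xco p \<and> xco p \<le> t + e * M}" using p by blast
      qed
    qed
    show "inj_on u Q"
    proof (rule inj_onI)
      fix a b assume ab: "a \<in> Q" "b \<in> Q" "u a = u b"
      then have "xco a = xco b" using xle[of a b] xle[of b a] by simp
      then show "a = b" using ab e unfolding u_def by (intro xy_eqI) auto
    qed
    show "short_mod \<tau> b a" if "short_mod \<tau> a b" for a b using that unfolding short_mod_x by linarith
    show "short_mod \<tau> (a + of_int k * \<tau>) (b + of_int k * \<tau>)" if "short_mod \<tau> a b" for a b k
      using that unfolding short_mod_x by simp
    show "short_mod \<tau> c d" if "a \<in> Q" "b \<in> Q" "c \<in> Q" "d \<in> Q" "short_mod \<tau> a b" "u a \<le> u c" "u c \<le> u d" "u d \<le> u b"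
      for a b c d
      using xle[OF that(1,3,6)] xle[OF that(3,4,7)] xle[OF that(4,2,8)] that(5) unfolding short_mod_x by linarith
    show "\<bar>u a - u b\<bar> < 1" if "a \<in> Q" "b \<in> Q" "short_mod \<tau> a b" for a b
      using ey[OF that(1,2)] that(3) unfolding short_mod_x u_def by linarith
    show "(u z - u a) * (u b - u z) \<noteq> (u z - u c) * (u d - u z)"
      if "a \<in> Q" "b \<in> Q" "c \<in> Q" "d \<in> Q" "short_mod \<tau> a b" "short_mod \<tau> c d" "z \<in> open_segment a b" "z \<in> open_segment c d"
        "(u b - u a) * (yco d - yco c) \<noteq> (u d - u c) * (yco b - yco a)" for a b c d z
    proof
      assume eq: "(u z - u a) * (u b - u z) = (u z - u c) * (u d - u z)"
      have "(xco b - xco a) * (yco d - yco c) \<noteq> (xco d - xco c) * (yco b - yco a)"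
        using that(9) unfolding u_def by (simp add: algebra_simps)
      then have "tie e a b c d z" unfolding tie_def using that(7,8) eq unfolding u_def by blast
      then show False using e(3) that(1-6) by blast
    qed
  qed
  then show ?thesis by blast
qed

end

section \<open>Triangulations of the cylinder\<close>

locale framed_config = cyl_config \<tau> S + sweep_frame u v \<tau> nn "\<Union>S" "short_mod \<tau>"
  for \<tau> :: complex and S :: "complex set set" and u v :: "complex \<Rightarrow> real" and nn :: complex
begin

section \<open>Lifting segments and triangulations to the plane\<close>

definition edges :: "complex set set set \<Rightarrow> edge_set" where
  "edges T = {(a, b). a \<in> Q \<and> b \<in> Q \<and> short_mod \<tau> a b \<and> {orb \<tau> a, orb \<tau> b} \<in> T}"

text \<open>The imaginary part is common to all candidates, so the comparison reduces to k (k - 2 Re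
  w) \<ge> 0 for all integers k, and k = 1 and k = -1 decide.\<close>

lemma shortest_iff: "shortest \<tau> p q \<longleftrightarrow> \<bar>xco p - xco q\<bar> \<le> 1 / 2"
proof -
  define w where "w = (p - q) / \<tau>"
  have x: "Re w = xco p - xco q" unfolding w_def by (simp add: xco_def diff_divide_distrib)
  have "norm (p - q) \<le> norm (p - (q + of_int k * \<tau>)) \<longleftrightarrow> (Re w)\<^sup>2 \<le> (Re w - k)\<^sup>2" for k :: int
  proof -
    have 1: "p - q = w * \<tau>" "p - (q + of_int k * \<tau>) = (w - of_int k) * \<tau>"
      unfolding w_def using tau by (simp_all add: field_simps)
    have "norm (p - q) \<le> norm (p - (q + of_int k * \<tau>)) \<longleftrightarrow> norm w \<le> norm (w - of_int k)"
      unfolding 1 norm_mult using tau by simp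
    then show ?thesis by (simp add: cmod_def)
  qed
  then have e: "shortest \<tau> p q \<longleftrightarrow> (\<forall>k::int. (Re w)\<^sup>2 \<le> (Re w - k)\<^sup>2)" unfolding shortest_def by simp
  have d: "(Re w - of_int k)\<^sup>2 - (Re w)\<^sup>2 = of_int k * (of_int k - 2 * Re w)" for k :: int
    by (simp add: power2_eq_square algebra_simps)
  show ?thesis
  proof
    assume "shortest \<tau> p q"
    then have "(Re w)\<^sup>2 \<le> (Re w - of_int 1)\<^sup>2" "(Re w)\<^sup>2 \<le> (Re w - of_int (- 1))\<^sup>2" using e by blast+
    then have "1 - 2 * Re w \<ge> 0" "1 + 2 * Re w \<ge> 0" using d[of 1] d[of "- 1"] by simp_all
    then show "\<bar>xco p - xco q\<bar> \<le> 1 / 2" unfolding x[symmetric] by linarith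
  next
    assume "\<bar>xco p - xco q\<bar> \<le> 1 / 2"
    then have a: "2 * Re w \<le> 1" "- 1 \<le> 2 * Re w" unfolding x[symmetric] by linarith+
    have "of_int k * (of_int k - 2 * Re w) \<ge> 0" for k :: int
    proof -
      consider "k = 0" | "k \<ge> 1" | "k \<le> - 1" by linarith
      then show ?thesis
      proof cases
        case 2
        then have "real_of_int k \<ge> 1" by simp
        then have "real_of_int k - 2 * Re w \<ge> 0" "real_of_int k \<ge> 0" using a by linarith+
        then show ?thesis by simp
      next
        case 3
        then have "real_of_int k \<le> - 1" by linarith
        then have "real_of_int k - 2 * Re w \<le> 0" "real_of_int k \<le> 0" using a by linarith+
        then show ?thesis by (simp add: mult_nonpos_nonpos)
      qed simp
    qed
    then show "shortest \<tau> p q" unfolding e using d by (metis diff_ge_0_iff_ge)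
  qed
qed

lemma shortest_orb:
  assumes W: "short_mod \<tau> a b" and p: "p \<in> orb \<tau> a" and q: "q \<in> orb \<tau> b" and s: "shortest \<tau> p q"
  obtains k where "p = sh k a" "q = sh k b"
proof -
  obtain k where k: "p = sh k a" using p orb_mem by blast
  obtain l where l: "q = sh l b" using q orb_mem by blast
  have "\<bar>xco a + k - (xco b + l)\<bar> \<le> 1 / 2" using s unfolding shortest_iff k l by simp
  then have "\<bar>real_of_int k - real_of_int l\<bar> < 1" using W unfolding short_mod_x by linarith
  then have "k = l" by linarith
  then show ?thesis using that k l by blast
qed

text \<open>Rounding gives a representative at distance at most 1/2 in x. At exactly 1/2 one of its
  neighbours would be equally close, against uniqueness.\<close>

lemma unique_shortest_short_mod:
  assumes "unique_shortest \<tau> (orb \<tau> a) (orb \<tau> b)"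
  shows "\<exists>b'\<in>orb \<tau> b. short_mod \<tau> a b'"
proof -
  define k where "k = round (xco a - xco b)"
  have xk: "xco (sh l b) = xco b + of_int l" for l by simp
  have m: "sh l b \<in> orb \<tau> b" for l using orb_mem by blast
  have r: "\<bar>xco a - xco (sh k b)\<bar> \<le> 1 / 2"
    using of_int_round_abs_le[of "xco a - xco b"] unfolding xk k_def by linarith
  have "\<bar>xco a - xco (sh k b)\<bar> \<noteq> 1 / 2"
  proof
    assume "\<bar>xco a - xco (sh k b)\<bar> = 1 / 2"
    then have "\<bar>xco a - xco (sh (k + 1) b)\<bar> \<le> 1 / 2 \<or> \<bar>xco a - xco (sh (k - 1) b)\<bar> \<le> 1 / 2"
      unfolding xk by (auto simp: abs_if split: if_splits)
    then obtain l where "l = k + 1 \<or> l = k - 1" and l2: "\<bar>xco a - xco (sh l b)\<bar> \<le> 1 / 2" by blast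
    then have l: "l \<noteq> k" by auto
    have "sh l b = sh k b" using assms orb_self[of a] m r l2 unfolding unique_shortest_def shortest_iff by blast
    then show False using l tau by simp
  qed
  then have "short_mod \<tau> a (sh k b)" using r unfolding short_mod_x by linarith
  then show ?thesis using m by blast
qed

lemma short_mod_unique_shortest: "short_mod \<tau> a b \<Longrightarrow> unique_shortest \<tau> (orb \<tau> a) (orb \<tau> b)"
  unfolding unique_shortest_def
proof (intro ballI impI)
  fix p q q' assume W: "short_mod \<tau> a b" and p: "p \<in> orb \<tau> a" and q: "q \<in> orb \<tau> b" "q' \<in> orb \<tau> b"
    and s: "shortest \<tau> p q \<and> shortest \<tau> p q'"
  obtain k where k: "p = sh k a" "q = sh k b" using shortest_orb[OF W p q(1)] s by blast
  obtain l where l: "p = sh l a" "q' = sh l b" using shortest_orb[OF W p q(2)] s by blast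
  show "q = q'" using k l tau by simp
qed

lemma lift_mem: "w \<in> lift \<tau> A \<longleftrightarrow> (\<exists>k. sh k w \<in> A)"
proof
  assume "w \<in> lift \<tau> A"
  then obtain z k where z: "w = sh k z" "z \<in> A" unfolding lift_def by blast
  then have "sh (- k) w = z" by simp
  then show "\<exists>k. sh k w \<in> A" using z(2) by blast
next
  assume "\<exists>k. sh k w \<in> A"
  then obtain k where k: "sh k w \<in> A" by blast
  have "w = sh (- k) (sh k w)" by simp
  then show "w \<in> lift \<tau> A" using k unfolding lift_def by blast
qed

lemma lift_self: "z \<in> A \<Longrightarrow> z \<in> lift \<tau> A"
  unfolding lift_mem by (intro exI[of _ 0]) simp

lemma lift_segment_sh: "lift \<tau> (closed_segment (sh k a) (sh k b)) = lift \<tau> (closed_segment a b)"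
proof (intro set_eqI)
  fix w
  have "sh (l - k) w \<in> closed_segment a b \<longleftrightarrow> sh l w \<in> closed_segment (sh k a) (sh k b)" for l
  proof -
    have e: "sh k (sh (l - k) w) = sh l w" by (simp only: sh_sh) simp
    show ?thesis using sh_segment[of "sh (l - k) w" a b k] unfolding e .
  qed
  then show "w \<in> lift \<tau> (closed_segment (sh k a) (sh k b)) \<longleftrightarrow> w \<in> lift \<tau> (closed_segment a b)"
    unfolding lift_mem by (metis add_diff_cancel_right')
qed

lemma segpts_eq:
  assumes W: "short_mod \<tau> a b"
  shows "segpts \<tau> (orb \<tau> a) (orb \<tau> b) = lift \<tau> (closed_segment a b)"
proof -
  have "shortest \<tau> a b" using W unfolding shortest_iff short_mod_x by linarith
  moreover have "lift \<tau> (closed_segment p q) = lift \<tau> (closed_segment a b)"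
    if pq: "p \<in> orb \<tau> a" "q \<in> orb \<tau> b" "shortest \<tau> p q" for p q
    using shortest_orb[OF W pq] lift_segment_sh by metis
  ultimately show ?thesis unfolding segpts_def using orb_self by blast
qed

lemma edge_pts_eq:
  assumes W: "short_mod \<tau> a b"
  shows "edge_pts \<tau> {orb \<tau> a, orb \<tau> b} = lift \<tau> (closed_segment a b)"
proof -
  have "segpts \<tau> (orb \<tau> b) (orb \<tau> a) = lift \<tau> (closed_segment a b)"
    using segpts_eq[OF W_sym[OF W]] by (simp add: closed_segment_commute)
  then have eq: "segpts \<tau> c d = lift \<tau> (closed_segment a b)" if "{orb \<tau> a, orb \<tau> b} = {c, d}" for c d
    using that segpts_eq[OF W] by (metis doubleton_eq_iff)
  show ?thesis
  proof (intro set_eqI iffI)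
    fix z assume "z \<in> edge_pts \<tau> {orb \<tau> a, orb \<tau> b}"
    then obtain c d where "{orb \<tau> a, orb \<tau> b} = {c, d}" "z \<in> segpts \<tau> c d"
      unfolding edge_pts_def by auto
    then show "z \<in> lift \<tau> (closed_segment a b)" using eq by metis
  next
    fix z assume "z \<in> lift \<tau> (closed_segment a b)"
    then have "z \<in> segpts \<tau> (orb \<tau> a) (orb \<tau> b)" using segpts_eq[OF W] by metis
    then show "z \<in> edge_pts \<tau> {orb \<tau> a, orb \<tau> b}" unfolding edge_pts_def by blast
  qed
qed

lemma seg_x_range:
  assumes "z \<in> closed_segment a b"
  shows "\<bar>xco z - xco a\<bar> \<le> \<bar>xco a - xco b\<bar>" "\<bar>xco z - xco b\<bar> \<le> \<bar>xco a - xco b\<bar>"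
proof -
  obtain l where l: "0 \<le> l" "l \<le> 1" "z = (1 - l) *\<^sub>R a + l *\<^sub>R b" using assms unfolding in_segment by blast
  have 1: "xco z - xco a = l * (xco b - xco a)" "xco z - xco b = (1 - l) * (xco a - xco b)"
    unfolding l(3) by (simp_all add: algebra_simps)
  show "\<bar>xco z - xco a\<bar> \<le> \<bar>xco a - xco b\<bar>" "\<bar>xco z - xco b\<bar> \<le> \<bar>xco a - xco b\<bar>"
    unfolding 1 abs_mult using l by (auto simp: abs_minus_commute mult_left_le_one_le)
qed

lemma orb_eq_iff: "orb \<tau> a = orb \<tau> b \<longleftrightarrow> (\<exists>k. b = sh k a)"
  using orb_eq orb_self orb_mem by metis

text \<open>Representatives of x-distance below 1/2 are determined up to a common translation, since
  two such differences cannot differ by a nonzero integer.\<close>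

lemma orb_pair_iff:
  assumes "short_mod \<tau> a b" "short_mod \<tau> c d"
  shows "{orb \<tau> c, orb \<tau> d} = {orb \<tau> a, orb \<tau> b} \<longleftrightarrow> (c, d) \<in> orbit_pairs a b"
proof
  have one: "\<exists>k. c = sh k a \<and> d = sh k b" if W: "short_mod \<tau> a b" "short_mod \<tau> c d" "orb \<tau> a = orb \<tau> c" "orb \<tau> b = orb \<tau> d"
    for a b c d
  proof -
    obtain k l where kl: "c = sh k a" "d = sh l b" using W(3,4) unfolding orb_eq_iff by blast
    have "\<bar>xco a + k - (xco b + l)\<bar> < 1 / 2" using W(2) unfolding short_mod_x kl by simp
    then have "\<bar>real_of_int k - real_of_int l\<bar> < 1" using W(1) unfolding short_mod_x by linarith
    then have "k = l" by linarith
    then show ?thesis using kl by blast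
  qed
  assume "{orb \<tau> c, orb \<tau> d} = {orb \<tau> a, orb \<tau> b}"
  then consider "orb \<tau> a = orb \<tau> c" "orb \<tau> b = orb \<tau> d" | "orb \<tau> b = orb \<tau> c" "orb \<tau> a = orb \<tau> d"
    by (auto simp: doubleton_eq_iff)
  then show "(c, d) \<in> orbit_pairs a b"
  proof cases
    case 1
    then show ?thesis using one[OF assms] unfolding orbit_pairs_def by blast
  next
    case 2
    then show ?thesis using one[OF W_sym[OF assms(1)] assms(2)] unfolding orbit_pairs_def by blast
  qed
next
  assume "(c, d) \<in> orbit_pairs a b"
  then obtain k where "{c, d} = {sh k a, sh k b}" by (rule orbit_pairsE)
  moreover have "orb \<tau> (sh k w) = orb \<tau> w" for w using orb_eq orb_mem by blast
  ultimately show "{orb \<tau> c, orb \<tau> d} = {orb \<tau> a, orb \<tau> b}" by (auto simp: doubleton_eq_iff)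
qed

lemma seg_orbit_pairs: "admissible a b \<Longrightarrow> (c, d) \<in> orbit_pairs a b \<Longrightarrow> admissible c d"
  using seg_sh seg_sym unfolding orbit_pairs_def by blast

text \<open>\<open>is_segment\<close> tolerates all translates of the endpoints on the segment,
  \<open>admissible\<close> only the endpoints themselves; a segment narrower than 1/2 in x contains
  no other translate.\<close>

lemma is_segment_iff: "is_segment \<tau> S e \<longleftrightarrow> (\<exists>a b. admissible a b \<and> e = {orb \<tau> a, orb \<tau> b})"
proof
  assume "is_segment \<tau> S e"
  then obtain A B where AB: "e = {A, B}" "A \<in> S" "B \<in> S" "A \<noteq> B" "unique_shortest \<tau> A B"
    "segpts \<tau> A B \<inter> Q \<subseteq> A \<union> B" unfolding is_segment_def by blast
  obtain a where a: "a \<in> A" using AB(2) Scyl orb_self unfolding cyl_points_def by blast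
  obtain b0 where b0: "b0 \<in> B" using AB(3) Scyl orb_self unfolding cyl_points_def by blast
  have A: "A = orb \<tau> a" and B0: "B = orb \<tau> b0" using S_orb AB(2,3) a b0 by blast+
  then obtain b where b: "b \<in> B" "short_mod \<tau> a b" using unique_shortest_short_mod AB(5) by blast
  then have B: "B = orb \<tau> b" using S_orb AB(3) by blast
  have "z = a \<or> z = b" if z: "z \<in> closed_segment a b" "z \<in> Q" for z
  proof -
    have "z \<in> lift \<tau> (closed_segment a b)" using z(1) by (rule lift_self)
    then have "z \<in> orb \<tau> a \<union> orb \<tau> b" using AB(6) segpts_eq[OF b(2)] z(2) unfolding A B by blast
    then obtain k where "z = sh k a \<or> z = sh k b" using orb_mem by blast
    then show ?thesis
    proof
      assume k: "z = sh k a"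
      then have "\<bar>real_of_int k\<bar> < 1" using seg_x_range(1)[OF z(1)] b(2) unfolding short_mod_x by simp
      then have "k = 0" by linarith
      then show ?thesis using k by simp
    next
      assume k: "z = sh k b"
      then have "\<bar>real_of_int k\<bar> < 1" using seg_x_range(2)[OF z(1)] b(2) unfolding short_mod_x by simp
      then have "k = 0" by linarith
      then show ?thesis using k by simp
    qed
  qed
  moreover have "a \<in> Q" "b \<in> Q" "a \<noteq> b" using a b AB A B by blast+
  ultimately have "admissible a b" unfolding admissible_def using b(2) by blast
  then show "\<exists>a b. admissible a b \<and> e = {orb \<tau> a, orb \<tau> b}" using AB(1) A B by blast
next
  assume "\<exists>a b. admissible a b \<and> e = {orb \<tau> a, orb \<tau> b}"
  then obtain a b where ab: "admissible a b" "e = {orb \<tau> a, orb \<tau> b}" by blast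
  have W: "short_mod \<tau> a b" "a \<in> Q" "b \<in> Q" "a \<noteq> b" using ab(1) unfolding admissible_def by auto
  have "orb \<tau> a \<noteq> orb \<tau> b"
  proof
    assume "orb \<tau> a = orb \<tau> b"
    then obtain k where k: "b = sh k a" unfolding orb_eq_iff by blast
    then have "\<bar>real_of_int k\<bar> < 1" using W(1) unfolding short_mod_x by simp
    then have "k = 0" by linarith
    then show False using k W(4) by simp
  qed
  moreover have "segpts \<tau> (orb \<tau> a) (orb \<tau> b) \<inter> Q \<subseteq> orb \<tau> a \<union> orb \<tau> b"
  proof
    fix z assume z: "z \<in> segpts \<tau> (orb \<tau> a) (orb \<tau> b) \<inter> Q"
    then have "z \<in> lift \<tau> (closed_segment a b)" using segpts_eq[OF W(1)] by blast
    then obtain k where k: "sh k z \<in> closed_segment a b" unfolding lift_mem by blast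
    then have "sh k z = a \<or> sh k z = b" using seg_P[OF ab(1)] z Q_shift by blast
    moreover have "z = sh (- k) (sh k z)" by simp
    ultimately show "z \<in> orb \<tau> a \<union> orb \<tau> b" using orb_mem by (metis UnI1 UnI2)
  qed
  ultimately show "is_segment \<tau> S e" unfolding is_segment_def ab(2)
    using short_mod_unique_shortest[OF W(1)] W(2,3) orb_in_S by blast
qed

definition segments :: "complex set set set \<Rightarrow> bool" where
  "segments T \<longleftrightarrow> (\<forall>e\<in>T. is_segment \<tau> S e)"

lemma edges_iff: "(a, b) \<in> edges T \<longleftrightarrow> a \<in> Q \<and> b \<in> Q \<and> short_mod \<tau> a b \<and> {orb \<tau> a, orb \<tau> b} \<in> T"
  unfolding edges_def mem_Collect_eq case_prod_conv ..

lemma edges_seg: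
  assumes "segments T" "(a, b) \<in> edges T"
  shows "admissible a b"
proof -
  have ab: "short_mod \<tau> a b" "{orb \<tau> a, orb \<tau> b} \<in> T" using assms(2) unfolding edges_iff by auto
  then obtain c d where cd: "admissible c d" "{orb \<tau> a, orb \<tau> b} = {orb \<tau> c, orb \<tau> d}"
    using assms(1) is_segment_iff unfolding segments_def by blast
  then have "(a, b) \<in> orbit_pairs c d" using orb_pair_iff[of c d a b] ab unfolding admissible_def by blast
  then show ?thesis using seg_orbit_pairs cd(1) by blast
qed

lemma edgesE:
  assumes "segments T" "e \<in> T"
  obtains a b where "(a, b) \<in> edges T" "e = {orb \<tau> a, orb \<tau> b}"
proof -
  have "is_segment \<tau> S e" using assms unfolding segments_def by blast
  then obtain a b where ab: "admissible a b" "e = {orb \<tau> a, orb \<tau> b}" unfolding is_segment_iff by blast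
  then have "(a, b) \<in> edges T" using assms(2) unfolding edges_def admissible_def by simp
  then show ?thesis using that ab(2) by blast
qed

lemma edges_inj:
  assumes "segments T1" "segments T2" "edges T1 = edges T2"
  shows "T1 = T2"
proof -
  have "T \<subseteq> T'" if T: "segments T" and eq: "edges T = edges T'" for T T'
  proof
    fix e assume "e \<in> T"
    then obtain a b where "(a, b) \<in> edges T" "e = {orb \<tau> a, orb \<tau> b}" using edgesE[OF T] by metis
    then have "(a, b) \<in> edges T'" "e = {orb \<tau> a, orb \<tau> b}" using eq by simp_all
    then show "e \<in> T'" unfolding edges_iff by blast
  qed
  then show ?thesis using assms by blast
qed

lemma edges_sh: "(a, b) \<in> edges T \<Longrightarrow> (sh k a, sh k b) \<in> edges T"
proof -
  assume "(a, b) \<in> edges T"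
  moreover have "orb \<tau> (sh k w) = orb \<tau> w" for w using orb_eq orb_mem by blast
  ultimately show ?thesis unfolding edges_iff using Q_shift W_shift by auto
qed

lemma cov_edges:
  assumes "segments T"
  shows "cov (edges T) = covered \<tau> T"
proof (intro set_eqI iffI)
  fix z assume "z \<in> cov (edges T)"
  then obtain a b where ab: "(a, b) \<in> edges T" "z \<in> closed_segment a b" unfolding cov_def by auto
  then have "z \<in> lift \<tau> (closed_segment a b)" using lift_self by blast
  then show "z \<in> covered \<tau> T" using ab(1) edge_pts_eq unfolding covered_def edges_def by blast
next
  fix z assume "z \<in> covered \<tau> T"
  then obtain e where e: "e \<in> T" "z \<in> edge_pts \<tau> e" unfolding covered_def by blast
  obtain a b where ab: "(a, b) \<in> edges T" "e = {orb \<tau> a, orb \<tau> b}" by (rule edgesE[OF assms e(1)])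
  then have "z \<in> lift \<tau> (closed_segment a b)" using e(2) edge_pts_eq unfolding edges_iff by auto
  then obtain k where k: "sh k z \<in> closed_segment a b" unfolding lift_mem by blast
  then have "z \<in> closed_segment (sh (- k) a) (sh (- k) b)" using sh_segment[of "sh k z" a b "- k"] by simp
  then show "z \<in> cov (edges T)" using covI[OF edges_sh[OF ab(1)]] by blast
qed

text \<open>Non-crossing on the cylinder compares different edges only. That two lifts of the same
  edge do not meet comes from their x-width being below 1/2.\<close>

lemma triangulation_edges:
  assumes "triangulation \<tau> S T"
  shows "segments T" "max_noncrossing (edges T)"
proof -
  note tr = assms[unfolded triangulation_def]
  show T: "segments T" unfolding segments_def using tr by (rule conjunct1)
  have nc: "\<forall>e\<in>T. \<forall>f\<in>T. e \<noteq> f \<longrightarrow> \<not> crossing \<tau> e f"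
    using conjunct2[OF tr] by (rule conjunct1)
  have mx: "\<forall>e. is_segment \<tau> S e \<and> e \<notin> T \<longrightarrow> (\<exists>f\<in>T. crossing \<tau> e f)"
    using conjunct2[OF conjunct2[OF tr]] by (rule conjunct1)
  have inS: "\<Union>(e \<inter> f) \<subseteq> Q" if "e \<in> T" for e f
  proof -
    have "is_segment \<tau> S e" using T that unfolding segments_def by blast
    then have "e \<subseteq> S" unfolding is_segment_def by auto
    then show ?thesis by blast
  qed
  show "max_noncrossing (edges T)" unfolding max_noncrossing_def
  proof (rule conjI[OF _ conjI]; intro allI impI)
    fix a b assume ab: "(a, b) \<in> edges T"
    have "(b, a) \<in> edges T" using ab W_sym unfolding edges_iff by (auto simp: insert_commute)
    then show "admissible a b \<and> (b, a) \<in> edges T \<and> (\<forall>k. (sh k a, sh k b) \<in> edges T)"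
      using edges_seg[OF T ab] edges_sh[OF ab] by blast
  next
    fix a b c d z
    assume *: "(a, b) \<in> edges T \<and> (c, d) \<in> edges T \<and> z \<in> closed_segment a b \<and> z \<in> closed_segment c d \<and> z \<notin> Q"
    have ed: "(a, b) \<in> edges T" "(c, d) \<in> edges T" using * by blast+
    have W: "short_mod \<tau> a b" "short_mod \<tau> c d" and m: "{orb \<tau> a, orb \<tau> b} \<in> T" "{orb \<tau> c, orb \<tau> d} \<in> T"
      using ed unfolding edges_iff by blast+
    have "z \<in> lift \<tau> (closed_segment a b)" "z \<in> lift \<tau> (closed_segment c d)"
      using * lift_self by blast+
    then have "crossing \<tau> {orb \<tau> a, orb \<tau> b} {orb \<tau> c, orb \<tau> d}"
      unfolding crossing_def edge_pts_eq[OF W(1)] edge_pts_eq[OF W(2)] using * inS[OF m(1)] by blast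
    then have "{orb \<tau> c, orb \<tau> d} = {orb \<tau> a, orb \<tau> b}" using bspec[OF bspec[OF nc m(1)] m(2)] by metis
    then have "(c, d) \<in> orbit_pairs a b" using orb_pair_iff[OF W] by blast
    then obtain k where k: "{c, d} = {sh k a, sh k b}" "closed_segment c d = closed_segment (sh k a) (sh k b)"
      by (rule orbit_pairsE)
    have "z \<in> closed_segment (sh k a) (sh k b)" using * unfolding k(2) by blast
    then have "sh (- k) z \<in> closed_segment a b" unfolding sh_segment' .
    then have "\<bar>xco z - k - xco a\<bar> < 1/2" using seg_x_range(1)[of "sh (- k) z" a b] W(1) unfolding short_mod_x by simp
    moreover have "\<bar>xco z - xco a\<bar> < 1/2" using seg_x_range(1)[of z a b] * W(1) unfolding short_mod_x by linarith
    ultimately have "\<bar>real_of_int k\<bar> < 1" by linarith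
    then have "k = 0" by linarith
    then show "{a, b} = {c, d}" using k(1) by simp
  next
    fix a b assume ab: "admissible a b \<and> (a, b) \<notin> edges T"
    then have W: "short_mod \<tau> a b" "a \<in> Q" "b \<in> Q" unfolding admissible_def by auto
    let ?e = "{orb \<tau> a, orb \<tau> b}"
    have "?e \<notin> T" using ab W unfolding edges_iff by blast
    moreover have "is_segment \<tau> S ?e" using ab is_segment_iff by blast
    ultimately obtain f where f: "f \<in> T" "crossing \<tau> ?e f" using mx by blast
    then obtain c d where cd: "(c, d) \<in> edges T" "f = {orb \<tau> c, orb \<tau> d}" using edgesE[OF T] by blast
    have Wc: "short_mod \<tau> c d" using cd unfolding edges_iff by blast
    obtain y where y: "y \<in> lift \<tau> (closed_segment a b)" "y \<in> lift \<tau> (closed_segment c d)" "y \<notin> \<Union>(?e \<inter> f)"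
      using f(2) unfolding crossing_def cd(2) edge_pts_eq[OF W(1)] edge_pts_eq[OF Wc] by blast
    obtain k where k: "sh k y \<in> closed_segment a b" using y(1) unfolding lift_mem by blast
    obtain l where l: "sh l y \<in> closed_segment c d" using y(2) unfolding lift_mem by blast
    define z where "z = sh k y"
    have zl: "z \<in> closed_segment (sh (k - l) c) (sh (k - l) d)"
    proof -
      have e: "sh (k - l) (sh l y) = sh k y" by (simp only: sh_sh) simp
      show ?thesis using l sh_segment[of "sh l y" c d "k - l"] unfolding z_def e by blast
    qed
    \<comment> \<open>If z were a vertex, its orbit would be an end of both segments, and
      \<open>crossing\<close> does not count common ends.\<close>
    have "z \<notin> Q"
    proof
      assume zQ: "z \<in> Q"
      have "z = a \<or> z = b" using seg_P[of a b z] ab k zQ unfolding z_def by blast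
      moreover have "z = sh (k - l) c \<or> z = sh (k - l) d"
        using seg_P[OF seg_sh[OF edges_seg[OF T cd(1)]] zl zQ] .
      moreover have os: "orb \<tau> (sh i w) = orb \<tau> w" for i w using orb_eq orb_mem by blast
      ultimately have "orb \<tau> z = orb \<tau> a \<or> orb \<tau> z = orb \<tau> b" "orb \<tau> z = orb \<tau> c \<or> orb \<tau> z = orb \<tau> d"
        by metis+
      then have "orb \<tau> z \<in> ?e" "orb \<tau> z \<in> f" unfolding cd(2) by blast+
      moreover have "y \<in> orb \<tau> z" using os[of y k] orb_self[of y] unfolding z_def by blast
      ultimately show False using y(3) by blast
    qed
    then show "\<exists>c d z. (c, d) \<in> edges T \<and> z \<in> closed_segment a b \<and> z \<in> closed_segment c d \<and> z \<notin> Q"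
      using edges_sh[OF cd(1)] zl k unfolding z_def by blast
  qed
qed

section \<open>Flips and boundaries on the cylinder\<close>

lemma edges_flip:
  assumes "(p, q) \<in> edges T" "r \<in> Q" "s \<in> Q" "short_mod \<tau> r s"
  shows "edges (insert {orb \<tau> r, orb \<tau> s} (T - {{orb \<tau> p, orb \<tau> q}})) = flip_edges (edges T) p q r s"
proof -
  have W: "short_mod \<tau> p q" using assms(1) unfolding edges_iff by blast
  have rs: "a \<in> Q \<and> b \<in> Q \<and> short_mod \<tau> a b" if ab: "(a, b) \<in> orbit_pairs r s" for a b
  proof -
    obtain k where "a = sh k r \<and> b = sh k s \<or> a = sh k s \<and> b = sh k r" using ab unfolding orbit_pairs_def by blast
    then show ?thesis
    proof (elim disjE conjE)
      assume "a = sh k r" "b = sh k s"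
      then show ?thesis using Q_shift[OF assms(2), of k] Q_shift[OF assms(3), of k] W_shift[OF assms(4), of k] by metis
    next
      assume "a = sh k s" "b = sh k r"
      then show ?thesis
        using Q_shift[OF assms(2), of k] Q_shift[OF assms(3), of k] W_shift[OF W_sym[OF assms(4)], of k] by metis
    qed
  qed
  have "(a, b) \<in> edges (insert {orb \<tau> r, orb \<tau> s} (T - {{orb \<tau> p, orb \<tau> q}})) \<longleftrightarrow>
    (a, b) \<in> flip_edges (edges T) p q r s" for a b
  proof (cases "a \<in> Q \<and> b \<in> Q \<and> short_mod \<tau> a b")
    case True
    then have "{orb \<tau> a, orb \<tau> b} = {orb \<tau> p, orb \<tau> q} \<longleftrightarrow> (a, b) \<in> orbit_pairs p q"
      "{orb \<tau> a, orb \<tau> b} = {orb \<tau> r, orb \<tau> s} \<longleftrightarrow> (a, b) \<in> orbit_pairs r s"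
      using orb_pair_iff[OF W, of a b] orb_pair_iff[OF assms(4), of a b] by simp_all
    then show ?thesis using True unfolding flip_edges_def Un_iff Diff_iff edges_iff insert_iff empty_iff by argo
  next
    case False
    then show ?thesis using rs[of a b] unfolding flip_edges_def Un_iff Diff_iff edges_iff by argo
  qed
  then show ?thesis by auto
qed

lemma empty_triangle_face:
  assumes "segments T" "max_noncrossing (edges T)" "empty_triangle (edges T) p q r"
  shows "face \<tau> S T p q r"
  using empty_triangle_component[OF assms(2,3)] assms(3) cov_edges[OF assms(1)] orb_in_S
  unfolding face_def empty_triangle_def edges_def by auto

text \<open>The reverse flip is recorded too, because the path from the second triangulation to its
  locally optimal one has to be walked backwards.\<close>

lemma improving_flips:
  assumes T: "segments T" and E: "max_noncrossing (edges T)" and I: "improving (edges T) p q r s z"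
  shows "\<exists>T'. flip \<tau> S T T' \<and> flip \<tau> S T' T \<and> segments T' \<and> edges T' = flip_edges (edges T) p q r s"
proof -
  have QD: "quad (edges T) p q r s" using I unfolding improving_def by auto
  note D = quadD[OF E QD] and F = improving_flip[OF E I] and rs = diagonal_seg[OF E I]
  let ?T = "insert {orb \<tau> r, orb \<tau> s} (T - {{orb \<tau> p, orb \<tau> q}})"
  have tri: "empty_triangle (edges T) p q r" "empty_triangle (edges T) p q s" using QD unfolding quad_def by auto
  have eq: "edges ?T = flip_edges (edges T) p q r s" by (rule edges_flip[OF D(1,8,9) F(2)])
  have E': "max_noncrossing (edges ?T)" unfolding eq by (rule flip_edges_noncrossing[OF E I])
  have T': "segments ?T" using T rs is_segment_iff unfolding segments_def by blast
  have pqW: "short_mod \<tau> p q" and pqT: "{orb \<tau> p, orb \<tau> q} \<in> T" using D(1) unfolding edges_iff by auto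
  have tri': "empty_triangle (edges ?T) r s p" "empty_triangle (edges ?T) r s q"
    unfolding eq by (rule flip_edges_triangles[OF E I])+
  have "flip \<tau> S T ?T" unfolding flip_def
    using empty_triangle_face[OF T E tri(1)] empty_triangle_face[OF T E tri(2)] pqT edge_pts_eq[OF pqW]
      edge_pts_eq[OF F(2)] rs is_segment_iff diagonal_subset[OF E I] by blast
  moreover have "flip \<tau> S ?T T"
  proof -
    \<comment> \<open>Otherwise removing the new diagonal again would not give back
      \<open>T\<close>.\<close>
    have "{orb \<tau> r, orb \<tau> s} \<notin> T"
    proof
      assume "{orb \<tau> r, orb \<tau> s} \<in> T"
      then have e: "(r, s) \<in> edges T" using D F(2) unfolding edges_iff by blast
      have z: "z \<in> closed_segment r s" "z \<in> closed_segment p q"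
        using I F(1) unfolding improving_def open_segment_def by auto
      have "{r, s} = {p, q}" using noncrossing_nc[OF E e D(1) z open_seg_notP[OF E D(1) F(1)]] .
      then show False using quad_sign[OF QD] by (auto simp: doubleton_eq_iff)
    qed
    then have "T = insert {orb \<tau> p, orb \<tau> q} (?T - {{orb \<tau> r, orb \<tau> s}})" using pqT by blast
    moreover have "is_segment \<tau> S {orb \<tau> p, orb \<tau> q}" using T pqT unfolding segments_def by blast
    ultimately show ?thesis unfolding flip_def
      using empty_triangle_face[OF T' E' tri'(1)] empty_triangle_face[OF T' E' tri'(2)] edge_pts_eq[OF pqW]
        edge_pts_eq[OF F(2)] edge_subset_hulls[OF E I]
      by (intro exI[of _ r] exI[of _ s] exI[of _ p] exI[of _ q]) simp
  qed
  ultimately show ?thesis using T' eq by blast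
qed

lemma reach_loc_optimal:
  assumes "segments T" "max_noncrossing (edges T)"
  shows "\<exists>L. (flip \<tau> S)\<^sup>*\<^sup>* T L \<and> (flip \<tau> S)\<^sup>*\<^sup>* L T \<and> segments L \<and> max_noncrossing (edges L) \<and> loc_optimal (edges L) \<and>
    onesided (edges L) = onesided (edges T)"
  using assms
proof (induction "card (alive (edges T))" arbitrary: T rule: less_induct)
  case less
  show ?case
  proof (cases "loc_optimal (edges T)")
    case True
    then show ?thesis using less.prems by blast
  next
    case False
    then obtain p q r s z where I: "improving (edges T) p q r s z" unfolding loc_optimal_def by blast
    obtain T' where T': "flip \<tau> S T T'" "flip \<tau> S T' T" "segments T'" "edges T' = flip_edges (edges T) p q r s"
      using improving_flips[OF less.prems I] by blast
    have E': "max_noncrossing (edges T')" unfolding T'(4) by (rule flip_edges_noncrossing[OF less.prems(2) I])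
    have c: "card (alive (edges T')) < card (alive (edges T))"
      unfolding T'(4) by (rule alive_flip_edges[OF less.prems(2) I])
    have o: "onesided (edges T') = onesided (edges T)"
      unfolding T'(4) by (rule onesided_flip_edges[OF less.prems(2) I])
    from less.hyps[OF c T'(3) E'] obtain L where L: "(flip \<tau> S)\<^sup>*\<^sup>* T' L" "(flip \<tau> S)\<^sup>*\<^sup>* L T'" "segments L"
      "max_noncrossing (edges L)" "loc_optimal (edges L)" "onesided (edges L) = onesided (edges T')" by blast
    have "(flip \<tau> S)\<^sup>*\<^sup>* T L" using T'(1) L(1) by (rule converse_rtranclp_into_rtranclp)
    moreover have "(flip \<tau> S)\<^sup>*\<^sup>* L T" using L(2) T'(2) by (rule rtranclp.rtrancl_into_rtrancl)
    ultimately show ?thesis using L(3-5) trans[OF L(6) o] by blast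
  qed
qed

lemma tri_region_eq:
  assumes "segments T"
  shows "tri_region \<tau> S T = region Q (edges T)"
  unfolding tri_region_def region_def face_def orb_in_S cov_edges[OF assms] by blast

text \<open>Turns the hypothesis on boundaries, which concerns frontiers of regions, into the
  combinatorial one that \<open>loc_optimal_subset\<close> needs.\<close>

lemma boundary_edges_eq:
  assumes T: "segments T" and E: "max_noncrossing (edges T)"
  shows "boundary_edges \<tau> S T = {{orb \<tau> a, orb \<tau> b} | a b. (a, b) \<in> onesided (edges T)}"
proof (intro set_eqI iffI)
  fix e assume "e \<in> boundary_edges \<tau> S T"
  then have e: "e \<in> T" "edge_pts \<tau> e \<subseteq> frontier (region Q (edges T))"
    unfolding boundary_edges_def tri_region_eq[OF T] by auto
  obtain a0 b0 where ab0: "(a0, b0) \<in> edges T" "e = {orb \<tau> a0, orb \<tau> b0}" by (rule edgesE[OF T e(1)])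
  obtain a b where ab: "(a, b) \<in> edges T" "u a < u b" "{a0, b0} = {a, b}"
    using oriented[OF E ab0(1) ends_in_segment(1)] by metis
  have eab: "e = {orb \<tau> a, orb \<tau> b}" using ab0(2) ab(3) by (auto simp: doubleton_eq_iff)
  have W: "short_mod \<tau> a b" using ab(1) unfolding edges_iff by blast
  have "closed_segment a b \<subseteq> lift \<tau> (closed_segment a b)" using lift_self by blast
  then have "closed_segment a b \<subseteq> frontier (region Q (edges T))"
    using e(2) unfolding eab edge_pts_eq[OF W] by blast
  then have "(a, b) \<in> onesided (edges T)" by (rule frontier_onesided[OF E ab(1,2)])
  then show "e \<in> {{orb \<tau> a, orb \<tau> b} | a b. (a, b) \<in> onesided (edges T)}" using eab by blast
next
  fix e assume "e \<in> {{orb \<tau> a, orb \<tau> b} | a b. (a, b) \<in> onesided (edges T)}"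
  then obtain a b where ab: "e = {orb \<tau> a, orb \<tau> b}" "(a, b) \<in> onesided (edges T)" by blast
  then have abE: "(a, b) \<in> edges T" unfolding onesided_def by blast
  then have W: "short_mod \<tau> a b" "e \<in> T" using ab(1) unfolding edges_iff by auto
  have "z \<in> frontier (region Q (edges T))" if z: "z \<in> lift \<tau> (closed_segment a b)" for z
  proof -
    obtain k where k: "sh k z \<in> closed_segment a b" using z unfolding lift_mem by blast
    then have "z \<in> closed_segment (sh (- k) a) (sh (- k) b)" using sh_segment[of "sh k z" a b "- k"] by simp
    then show ?thesis using onesided_frontier[OF E onesided_sh[OF E ab(2)]] by blast
  qed
  then show "e \<in> boundary_edges \<tau> S T"
    unfolding boundary_edges_def tri_region_eq[OF T] using W(2) edge_pts_eq[OF W(1)] ab(1) by auto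
qed

lemma onesided_boundary:
  assumes "segments T1" "max_noncrossing (edges T1)" "segments T2" "max_noncrossing (edges T2)"
    "boundary_edges \<tau> S T1 \<subseteq> boundary_edges \<tau> S T2"
  shows "onesided (edges T1) \<subseteq> onesided (edges T2)"
proof
  fix e assume e: "e \<in> onesided (edges T1)"
  obtain a b where ab: "e = (a, b)" by (cases e)
  then have abE: "(a, b) \<in> edges T1" "u a < u b" using e unfolding onesided_def by auto
  have "{orb \<tau> a, orb \<tau> b} \<in> boundary_edges \<tau> S T2"
    using e ab assms(5) unfolding boundary_edges_eq[OF assms(1,2)] by blast
  then obtain c d where cd: "{orb \<tau> a, orb \<tau> b} = {orb \<tau> c, orb \<tau> d}" "(c, d) \<in> onesided (edges T2)"
    unfolding boundary_edges_eq[OF assms(3,4)] by blast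
  have cdE: "(c, d) \<in> edges T2" "u c < u d" using cd(2) unfolding onesided_def by auto
  have "(a, b) \<in> orbit_pairs c d"
    using orb_pair_iff[of c d a b] cd(1) abE(1) cdE(1) unfolding edges_iff by blast
  then obtain k where "a = sh k c" "b = sh k d" using orbit_pairs_oriented abE(2) cdE(2) by blast
  then show "e \<in> onesided (edges T2)" using onesided_sh[OF assms(4) cd(2)] ab by blast
qed

lemma flip_connected:
  assumes "triangulation \<tau> S T1" "triangulation \<tau> S T2" and bd: "boundary_edges \<tau> S T1 = boundary_edges \<tau> S T2"
  shows "(flip \<tau> S)\<^sup>*\<^sup>* T1 T2"
proof -
  note 1 = triangulation_edges[OF assms(1)] and 2 = triangulation_edges[OF assms(2)]
  have o: "onesided (edges T1) = onesided (edges T2)"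
    using onesided_boundary[OF 1 2] onesided_boundary[OF 2 1] bd by blast
  obtain L1 where L1: "(flip \<tau> S)\<^sup>*\<^sup>* T1 L1" "segments L1" "max_noncrossing (edges L1)" "loc_optimal (edges L1)"
    "onesided (edges L1) = onesided (edges T1)" using reach_loc_optimal[OF 1] by blast
  obtain L2 where L2: "(flip \<tau> S)\<^sup>*\<^sup>* L2 T2" "segments L2" "max_noncrossing (edges L2)" "loc_optimal (edges L2)"
    "onesided (edges L2) = onesided (edges T2)" using reach_loc_optimal[OF 2] by blast
  have sub: "onesided E \<subseteq> E" for E unfolding onesided_def by blast
  have "onesided (edges L1) = onesided (edges L2)" using L1(5) L2(5) o by simp
  then have "onesided (edges L1) \<subseteq> edges L2" "onesided (edges L2) \<subseteq> edges L1"
    using sub[of "edges L1"] sub[of "edges L2"] by simp_all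
  then have "edges L1 = edges L2"
    using loc_optimal_subset[OF L1(3,4) L2(3,4)] loc_optimal_subset[OF L2(3,4) L1(3,4)] by (meson equalityI)
  then have "L1 = L2" by (rule edges_inj[OF L1(2) L2(2)])
  then show ?thesis using L1(1) L2(1) by (meson rtranclp_trans)
qed

end

theorem theorem4p3:
  fixes \<tau> :: complex and S :: "complex set set" and T1 T2 :: "complex set set set"
  assumes "\<tau> \<noteq> 0" and "finite S" and "S \<subseteq> cyl_points \<tau>"
    and "triangulation \<tau> S T1" and "triangulation \<tau> S T2"
    and "boundary_edges \<tau> S T1 = boundary_edges \<tau> S T2"
  shows "(flip \<tau> S)\<^sup>*\<^sup>* T1 T2"
proof -
  interpret cyl_config \<tau> S using assms(1-3) by unfold_locales
  obtain u v nn where "sweep_frame u v \<tau> nn (\<Union>S) (short_mod \<tau>)" using generic_frame by blast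
  then interpret framed_config \<tau> S u v nn by (intro framed_config.intro cyl_config_axioms)
  show ?thesis using assms(4-6) by (rule flip_connected)
qed

end
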